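(* Let $P$ be a finite volume convex polytope in hyperbolic space $\mathbb{H}^n$ or in Euclidean space $\mathbb{E}^n$ with exactly $k$ facets. If $P$ admits a Coxeter decomposition $\Theta$ with fundamental polytope $F$, then $F$ has at most $k$ facets.
   Context: A polytope is called a Coxeter polytope if all its dihedral angles are integer parts of $\pi$, i.e. of the form $\pi/m$ with $m\ge 2$ an integer. A convex polytope $P$ admits a Coxeter decomposition if it is tiled by finitely many Coxeter polytopes such that any two tiles having a common facet are symmetric with respect to this facet (i.e. the reflection in the hyperplane containing the common facet exchanges the two tiles). The tiles of the decomposition are called fundamental polytopes; they are all congruent to one another, and $F$ denotes any of them. Polytopes are full-dimensional, and facets are faces of codimension one; a finite volume polytope in $\mathbb{H}^n$ need not be compact (it may have ideal vertices). *)

theory Defs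
  imports "HOL-Analysis.Analysis"
begin

section \<open>Euclidean space\<close>

text \<open>
  Euclidean n-space is a type of class \<open>euclidean_space\<close> with n = \<open>DIM('a)\<close>.  Polytopes are
  allowed to be unbounded here; finite volume is a separate hypothesis.
\<close>

definition euc_convex_polytope :: "'a::euclidean_space set \<Rightarrow> bool" where
  "euc_convex_polytope P \<longleftrightarrow> polyhedron P \<and> aff_dim P = int DIM('a)"

text \<open>
  \<open>u\<close> is the outward unit normal of \<open>P\<close> along \<open>f\<close>, and \<open>{x. u \<bullet> x = b}\<close> is a supporting
  hyperplane of \<open>P\<close> that cuts out \<open>f\<close>.  If \<open>f\<close> is a facet of a full-dimensional \<open>P\<close>, then
  \<open>u\<close> and \<open>b\<close> exist and are unique.
\<close>

definition euc_outer_normal :: "'a::euclidean_space set \<Rightarrow> 'a set \<Rightarrow> 'a \<Rightarrow> real \<Rightarrow> bool" where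
  "euc_outer_normal P f u b \<longleftrightarrow>
     norm u = 1 \<and> P \<subseteq> {x. u \<bullet> x \<le> b} \<and> f = P \<inter> {x. u \<bullet> x = b}"

definition euc_reflection :: "'a::euclidean_space \<Rightarrow> real \<Rightarrow> 'a \<Rightarrow> 'a" where
  "euc_reflection u b x = x - (2 * (u \<bullet> x - b)) *\<^sub>R u"

text \<open>
  A polytope has a dihedral angle at each face of codimension two, that is, at \<open>f \<inter> g\<close> for
  adjacent facets \<open>f\<close> and \<open>g\<close>.  The interior angle there is \<open>\<pi>\<close> minus the angle between
  the outward normals.  The condition \<open>f \<inter> g \<noteq> {}\<close> only matters for n = 1, where the empty
  set has dimension \<open>-1 = n - 2\<close>.
\<close>

definition euc_coxeter_polytope :: "'a::euclidean_space set \<Rightarrow> bool" where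
  "euc_coxeter_polytope P \<longleftrightarrow>
     euc_convex_polytope P \<and>
     (\<forall>f g u b v c.
        f facet_of P \<and> g facet_of P \<and> f \<noteq> g \<and>
        f \<inter> g \<noteq> {} \<and> aff_dim (f \<inter> g) = int DIM('a) - 2 \<and>
        euc_outer_normal P f u b \<and> euc_outer_normal P g v c \<longrightarrow>
        (\<exists>m::nat. m \<ge> 2 \<and> pi - arccos (u \<bullet> v) = pi / real m))"

text \<open>
  Tilings are facet-to-facet: tiles that meet in codimension one meet in a common facet.
  Otherwise the symmetry condition would say nothing about tiles that share only a part of a facet.
\<close>

definition euc_tiling :: "'a::euclidean_space set \<Rightarrow> 'a set set \<Rightarrow> bool" where
  "euc_tiling P \<Theta> \<longleftrightarrow>
     finite \<Theta> \<and> (\<forall>T\<in>\<Theta>. euc_convex_polytope T) \<and> \<Union>\<Theta> = P \<and>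
     (\<forall>S\<in>\<Theta>. \<forall>T\<in>\<Theta>. S \<noteq> T \<longrightarrow> interior S \<inter> interior T = {}) \<and>
     (\<forall>S\<in>\<Theta>. \<forall>T\<in>\<Theta>. S \<noteq> T \<and> aff_dim (S \<inter> T) = int DIM('a) - 1 \<longrightarrow>
        (S \<inter> T) facet_of S \<and> (S \<inter> T) facet_of T)"

definition euc_coxeter_decomposition :: "'a::euclidean_space set \<Rightarrow> 'a set set \<Rightarrow> bool" where
  "euc_coxeter_decomposition P \<Theta> \<longleftrightarrow>
     euc_tiling P \<Theta> \<and> (\<forall>T\<in>\<Theta>. euc_coxeter_polytope T) \<and>
     (\<forall>S\<in>\<Theta>. \<forall>T\<in>\<Theta>. \<forall>f u b.
        S \<noteq> T \<and> f facet_of S \<and> f facet_of T \<and> euc_outer_normal S f u b \<longrightarrow>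
        euc_reflection u b ` S = T \<and> euc_reflection u b ` T = S)"


section \<open>Hyperbolic space\<close>

text \<open>
  Hyperbolic n-space, n = \<open>DIM('a)\<close>, is the upper sheet of the hyperboloid in \<open>'a \<times> real\<close> with
  the Lorentzian form of signature (n, 1).
\<close>

definition lorentz :: "'a::euclidean_space \<times> real \<Rightarrow> 'a \<times> real \<Rightarrow> real" where
  "lorentz p q = fst p \<bullet> fst q - snd p * snd q"

definition hyp_space :: "('a::euclidean_space \<times> real) set" where
  "hyp_space = {p. lorentz p p = -1 \<and> snd p > 0}"

text \<open>
  The half-spaces and hyperplanes of hyperbolic space are given by the vectors \<open>e\<close> with
  \<open>lorentz e e = 1\<close>.  At each point of the hyperplane, \<open>e\<close> is a unit tangent vector
  normal to the hyperplane and pointing out of the half-space.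
\<close>

definition hyp_halfspace :: "'a::euclidean_space \<times> real \<Rightarrow> ('a \<times> real) set" where
  "hyp_halfspace e = {p \<in> hyp_space. lorentz e p \<le> 0}"

definition hyp_hyperplane :: "'a::euclidean_space \<times> real \<Rightarrow> ('a \<times> real) set" where
  "hyp_hyperplane e = {p \<in> hyp_space. lorentz e p = 0}"

definition hyp_reflection :: "'a::euclidean_space \<times> real \<Rightarrow> 'a \<times> real \<Rightarrow> 'a \<times> real" where
  "hyp_reflection e p = p - (2 * lorentz e p) *\<^sub>R e"

text \<open>
  The hyperbolic subspaces are the nonempty intersections of \<open>hyp_space\<close> with linear subspaces,
  so this is the dimension of the smallest hyperbolic subspace containing \<open>S\<close> (-1 if \<open>S\<close> is
  empty), in analogy with \<open>aff_dim\<close>.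
\<close>

definition hyp_dim :: "('a::euclidean_space \<times> real) set \<Rightarrow> int" where
  "hyp_dim S = int (dim S) - 1"

text \<open>
  The Riemannian volume.  In the chart \<open>x \<mapsto> (x, sqrt (1 + x \<bullet> x))\<close> the metric tensor is
  \<open>I - x x\<^sup>T / (1 + x \<bullet> x)\<close>, whose determinant is \<open>1 / (1 + x \<bullet> x)\<close>.
\<close>

definition hyp_measure :: "('a::euclidean_space \<times> real) measure" where
  "hyp_measure =
     distr (density lborel (\<lambda>x. ennreal (1 / sqrt (1 + x \<bullet> x)))) borel
       (\<lambda>x. (x, sqrt (1 + x \<bullet> x)))"

definition hyp_convex_polytope :: "('a::euclidean_space \<times> real) set \<Rightarrow> bool" where
  "hyp_convex_polytope P \<longleftrightarrow>
     (\<exists>E. finite E \<and> (\<forall>e\<in>E. lorentz e e = 1) \<and> P = hyp_space \<inter> (\<Inter>e\<in>E. hyp_halfspace e)) \<and>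
     hyp_dim P = int DIM('a)"

definition hyp_outer_normal ::
    "('a::euclidean_space \<times> real) set \<Rightarrow> ('a \<times> real) set \<Rightarrow> 'a \<times> real \<Rightarrow> bool" where
  "hyp_outer_normal P f e \<longleftrightarrow>
     lorentz e e = 1 \<and> P \<subseteq> hyp_halfspace e \<and> f = P \<inter> hyp_hyperplane e"

definition hyp_facet_of ::
    "('a::euclidean_space \<times> real) set \<Rightarrow> ('a \<times> real) set \<Rightarrow> bool" (infixr \<open>(hyp'_facet'_of)\<close> 50)
  where
  "f hyp_facet_of P \<longleftrightarrow> (\<exists>e. hyp_outer_normal P f e) \<and> f \<noteq> {} \<and> hyp_dim f = hyp_dim P - 1"

definition hyp_coxeter_polytope :: "('a::euclidean_space \<times> real) set \<Rightarrow> bool" where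
  "hyp_coxeter_polytope P \<longleftrightarrow>
     hyp_convex_polytope P \<and>
     (\<forall>f g d e.
        f hyp_facet_of P \<and> g hyp_facet_of P \<and> f \<noteq> g \<and>
        f \<inter> g \<noteq> {} \<and> hyp_dim (f \<inter> g) = int DIM('a) - 2 \<and>
        hyp_outer_normal P f d \<and> hyp_outer_normal P g e \<longrightarrow>
        (\<exists>m::nat. m \<ge> 2 \<and> pi - arccos (lorentz d e) = pi / real m))"

definition hyp_tiling ::
    "('a::euclidean_space \<times> real) set \<Rightarrow> ('a \<times> real) set set \<Rightarrow> bool" where
  "hyp_tiling P \<Theta> \<longleftrightarrow>
     finite \<Theta> \<and> (\<forall>T\<in>\<Theta>. hyp_convex_polytope T) \<and> \<Union>\<Theta> = P \<and>
     (\<forall>S\<in>\<Theta>. \<forall>T\<in>\<Theta>. S \<noteq> T \<longrightarrow>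
        (top_of_set hyp_space interior_of S) \<inter> (top_of_set hyp_space interior_of T) = {}) \<and>
     (\<forall>S\<in>\<Theta>. \<forall>T\<in>\<Theta>. S \<noteq> T \<and> hyp_dim (S \<inter> T) = int DIM('a) - 1 \<longrightarrow>
        (S \<inter> T) hyp_facet_of S \<and> (S \<inter> T) hyp_facet_of T)"

definition hyp_coxeter_decomposition ::
    "('a::euclidean_space \<times> real) set \<Rightarrow> ('a \<times> real) set set \<Rightarrow> bool" where
  "hyp_coxeter_decomposition P \<Theta> \<longleftrightarrow>
     hyp_tiling P \<Theta> \<and> (\<forall>T\<in>\<Theta>. hyp_coxeter_polytope T) \<and>
     (\<forall>S\<in>\<Theta>. \<forall>T\<in>\<Theta>. \<forall>f e.
        S \<noteq> T \<and> f hyp_facet_of S \<and> f hyp_facet_of T \<and> hyp_outer_normal S f e \<longrightarrow>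
        hyp_reflection e ` S = T \<and> hyp_reflection e ` T = S)"

end

theory Submission
  imports Defs
begin

text \<open>
  Let \<open>W\<close> be the Coxeter group of \<open>F\<close> in its geometric representation, whose basis consists of
  one simple root for each of the \<open>m\<close> facets of \<open>F\<close>.  The finitely many tiles are chambers
  \<open>w F\<close>, and the walls of tiles supporting \<open>P\<close> are given by at most \<open>k\<close> roots.  If \<open>k < m\<close>, some
  nonzero functional \<open>l\<close> kills all these roots.  Let \<open>x\<close> lie inside the fundamental chamber.
  On the line \<open>x + t l\<close> these roots stay positive, so the chambers met by the line all belong
  to tiles; being finitely many, one of them contains the direction \<open>l\<close> and another
  one \<open>- l\<close>.  But finite volume of \<open>F\<close> yields a positive combination of the simple roots
  having nonpositive products with them.  Its images under \<open>W\<close> only get larger, so it would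
  be nonnegative on \<open>l\<close> and \<open>- l\<close> and nonzero on \<open>l\<close>, a contradiction.
\<close>

section \<open>Coxeter groups in the geometric representation\<close>

text \<open>The \<open>m\<close> normals of \<open>F\<close> live in a space of dimension
  \<open>n + 1\<close>. As \<open>m\<close> may be larger, they can be linearly dependent, and
  counting dimensions among them proves nothing. In the space of formal combinations the simple
  roots are independent, and fewer than \<open>m\<close> equations always have a nonzero solution.
  The price is that the line \<open>x + t l\<close> leaves the geometric space: a priori its points
  need not lie in any chamber. That they do is forced by a descent that cannot leave the finite set
  of tiles. A second price is that formal objects must be recovered from geometric ones. Distinct
  group elements must have distinct chambers, or infinitely many elements could belong to finitely
  many tiles. Distinct roots must give distinct normals, or more than \<open>k\<close> roots could
  support \<open>P\<close>. Finally, the angle condition speaks of adjacent facets only, while the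
  form has to be of Coxeter type on all pairs. Facets that are not adjacent turn out to have product
  at most -1, which is the label infinity.\<close>

lemma underdetermined_system:
  fixes M :: "('i \<Rightarrow> real) set"
  assumes "finite M" "finite N" "card M < card N"
  shows "\<exists>l. (\<exists>i\<in>N. l i \<noteq> 0) \<and> (\<forall>g\<in>M. (\<Sum>i\<in>N. g i * l i) = 0)"
  using assms
proof (induction "card N" arbitrary: N M)
  case 0
  then show ?case by simp
next
  case (Suc n)
  show ?case
  proof (cases "\<exists>g\<in>M. \<exists>i\<in>N. g i \<noteq> 0")
    case False
    obtain j where "j \<in> N" using Suc by (metis card.empty ex_in_conv nat.distinct(1))
    then show ?thesis using False by (intro exI[of _ "\<lambda>_. 1"]) auto
  next
    case True
    then obtain g j where g: "g \<in> M" "j \<in> N" "g j \<noteq> 0" by blast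
    \<comment> \<open>Gaussian elimination: \<open>g\<close> clears coordinate \<open>j\<close> from
      the other equations, and \<open>c\<close> below solves \<open>g\<close> for that coordinate.
      Equations that coincide afterwards only make \<open>M'\<close> smaller.\<close>
    define M' where "M' = (\<lambda>h i. h i - h j / g j * g i) ` (M - {g})"
    have "card M' \<le> card (M - {g})" unfolding M'_def using Suc by (intro card_image_le) auto
    also have "\<dots> < card M" using g Suc by (intro psubset_card_mono) auto
    finally have "card M' < card (N - {j})" using g Suc by auto
    moreover have "finite M'" "finite (N - {j})" "n = card (N - {j})"
      using Suc g unfolding M'_def by auto
    ultimately obtain l where l: "\<exists>i\<in>N - {j}. l i \<noteq> 0"
      "\<forall>h\<in>M'. (\<Sum>i\<in>N - {j}. h i * l i) = 0" using Suc.hyps(1)[of "N - {j}" M'] by blast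
    define c where "c = - (\<Sum>i\<in>N - {j}. g i * l i) / g j"
    have sumj: "(\<Sum>i\<in>N. h i * (l(j := c)) i) = h j * c + (\<Sum>i\<in>N - {j}. h i * l i)" for h
    proof -
      have "(\<Sum>i\<in>N. h i * (l(j := c)) i) = h j * c + (\<Sum>i\<in>N - {j}. h i * (l(j := c)) i)"
        using Suc.prems(2) g(2) by (subst sum.remove[of _ j]) auto
      also have "(\<Sum>i\<in>N - {j}. h i * (l(j := c)) i) = (\<Sum>i\<in>N - {j}. h i * l i)"
        by (intro sum.cong) auto
      finally show ?thesis .
    qed
    have "(\<Sum>i\<in>N. h i * (l(j := c)) i) = 0" if "h \<in> M" for h
    proof (cases "h = g")
      case True
      have "g j * c = - (\<Sum>i\<in>N - {j}. g i * l i)" using g by (simp add: c_def)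
      then show ?thesis using True sumj[of g] by simp
    next
      case False
      then have "(\<lambda>i. h i - h j / g j * g i) \<in> M'" using that unfolding M'_def by auto
      then have "(\<Sum>i\<in>N - {j}. (h i - h j / g j * g i) * l i) = 0" using l(2) by fast
      then have "(\<Sum>i\<in>N - {j}. h i * l i) = h j / g j * (\<Sum>i\<in>N - {j}. g i * l i)"
        by (simp add: algebra_simps sum_subtractf sum_distrib_left)
      moreover have "h j * c = - (h j / g j * (\<Sum>i\<in>N - {j}. g i * l i))" by (simp add: c_def)
      ultimately show ?thesis using sumj[of h] by simp
    qed
    moreover have "\<exists>i\<in>N. (l(j := c)) i \<noteq> 0" using l(1) by auto
    ultimately show ?thesis by blast
  qed
qed

text \<open>The second alternative in \<open>B_cox\<close> is the label infinity: it describes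
  facets whose hyperplanes are parallel or ultraparallel, and the latter have products below
  -1.\<close>

locale coxeter =
  fixes N :: "'i set" and B :: "'i \<Rightarrow> 'i \<Rightarrow> real"
  assumes finite_N: "finite N"
    and B_sym: "B i j = B j i"
    and B_one: "i \<in> N \<Longrightarrow> B i i = 1"
    and B_cox: "i \<in> N \<Longrightarrow> j \<in> N \<Longrightarrow> i \<noteq> j \<Longrightarrow>
      (\<exists>m::nat. m \<ge> 2 \<and> B i j = - cos (pi / real m)) \<or> B i j \<le> -1"
begin

text \<open>
  Vectors are coefficient functions of formal combinations of the simple roots \<open>simple e\<close>, even when
  the normals they stand for are linearly dependent; words over \<open>N\<close> act on them through \<open>act\<close>.
\<close>

definition bf :: "('i \<Rightarrow> real) \<Rightarrow> 'i \<Rightarrow> real" where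
  "bf c e = (\<Sum>i\<in>N. c i * B i e)"

definition s :: "'i \<Rightarrow> ('i \<Rightarrow> real) \<Rightarrow> ('i \<Rightarrow> real)" where
  "s e c = c(e := c e - 2 * bf c e)"

definition simple :: "'i \<Rightarrow> 'i \<Rightarrow> real" where
  "simple e = (\<lambda>i. if i = e then 1 else 0)"

definition act :: "'i list \<Rightarrow> ('i \<Rightarrow> real) \<Rightarrow> ('i \<Rightarrow> real)" where
  "act xs = foldr s xs"

definition comb :: "real \<Rightarrow> ('i \<Rightarrow> real) \<Rightarrow> real \<Rightarrow> ('i \<Rightarrow> real) \<Rightarrow> ('i \<Rightarrow> real)" where
  "comb a c b d = (\<lambda>i. a * c i + b * d i)"

lemma act_Nil [simp]: "act [] c = c" by (simp add: act_def)
lemma act_Cons [simp]: "act (x # xs) c = s x (act xs c)" by (simp add: act_def)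
lemma act_append [simp]: "act (xs @ ys) c = act xs (act ys c)" by (induction xs) auto

lemma act_append_fun: "act (xs @ ys) = act xs \<circ> act ys" by auto

lemma bf_comb: "bf (comb a c b d) e = a * bf c e + b * bf d e"
  by (simp add: bf_def comb_def algebra_simps sum.distrib sum_distrib_left)

lemma s_comb: "s e (comb a c b d) = comb a (s e c) b (s e d)"
  by (rule ext) (simp add: s_def bf_comb, simp add: comb_def algebra_simps)

lemma act_comb: "act xs (comb a c b d) = comb a (act xs c) b (act xs d)"
  by (induction xs) (auto simp: s_comb)

lemma bf_simple: "j \<in> N \<Longrightarrow> bf (simple j) e = B j e"
proof -
  assume j: "j \<in> N"
  have "bf (simple j) e = (\<Sum>i\<in>N. if i = j then B i e else 0)"
    unfolding bf_def simple_def by (intro sum.cong) auto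
  then show ?thesis using j finite_N by simp
qed

lemma s_eq_comb: "s e c = comb 1 c (- 2 * bf c e) (simple e)"
  by (rule ext) (simp add: s_def comb_def simple_def)

lemma s_s [simp]: "e \<in> N \<Longrightarrow> s e (s e c) = c"
proof -
  assume e: "e \<in> N"
  have "bf (s e c) e = - bf c e" by (subst s_eq_comb) (simp add: bf_comb bf_simple e B_one)
  then show ?thesis by (auto simp: s_def)
qed

lemma s_fix: "bf c e = 0 \<Longrightarrow> s e c = c" by (simp add: s_def)

lemma s_simple_self: "e \<in> N \<Longrightarrow> s e (simple e) = (\<lambda>i. - simple e i)"
  by (rule ext) (simp add: s_def bf_simple B_one, simp add: simple_def)

section \<open>Rank two: alternating words and Chebyshev polynomials\<close>

fun alt :: "nat \<Rightarrow> 'i \<Rightarrow> 'i \<Rightarrow> 'i list" where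
  "alt 0 x y = []"
| "alt (Suc n) x y = x # alt n y x"

text \<open>Chebyshev polynomials of the second kind with the degree shifted by one: the value at
  \<open>cos t\<close> is \<open>sin (n t) / sin t\<close>. They are the coefficients of roots in a
  rank two root system with \<open>c = - B x y\<close>.\<close>

fun cheb :: "real \<Rightarrow> nat \<Rightarrow> real" where
  "cheb c 0 = 0"
| "cheb c (Suc 0) = 1"
| "cheb c (Suc (Suc n)) = 2 * c * cheb c (Suc n) - cheb c n"

lemma length_alt [simp]: "length (alt n x y) = n" by (induction n arbitrary: x y) auto

lemma set_alt: "set (alt n x y) \<subseteq> {x, y}"
proof (induction n arbitrary: x y)
  case (Suc n) then show ?case using Suc[of y x] by auto
qed simp

lemma alt_add:
  "alt (i + j) x y = alt i x y @ (if even i then alt j x y else alt j y x)"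
  by (induction i arbitrary: x y) auto

lemma alt_Suc_right: "alt (Suc n) x y = alt n x y @ [if even n then x else y]"
  using alt_add[of n 1 x y] by auto

text \<open>The simple root is the one whose letter would continue the alternation. With this choice
  each further letter in front is one step of the Chebyshev recurrence, with the roles of the two
  letters swapped.\<close>

lemma act_alt:
  assumes "x \<in> N" "y \<in> N"
  shows "act (alt n x y) (simple (if even n then x else y))
    = comb (cheb (- B x y) (Suc n)) (simple x) (cheb (- B x y) n) (simple y)"
  using assms
proof (induction n arbitrary: x y)
  case 0
  then show ?case by (auto simp: comb_def)
next
  case (Suc n)
  have eq: "(if even (Suc n) then x else y) = (if even n then y else x)" by auto
  have "act (alt (Suc n) x y) (simple (if even (Suc n) then x else y))
    = s x (comb (cheb (- B y x) (Suc n)) (simple y) (cheb (- B y x) n) (simple x))"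
    unfolding eq using Suc.IH[of y x] Suc.prems by simp
  also have "\<dots> = comb (cheb (- B x y) (Suc (Suc n))) (simple x) (cheb (- B x y) (Suc n)) (simple y)"
    by (subst s_eq_comb, simp add: bf_comb bf_simple Suc.prems B_one B_sym[of y x])
       (auto simp: comb_def algebra_simps)
  finally show ?case .
qed

lemma cheb_sin: "sin t \<noteq> 0 \<Longrightarrow> cheb (cos t) n = sin (real n * t) / sin t"
proof (induction "cos t" n rule: cheb.induct)
  case (3 n)
  have "sin (real (Suc (Suc n)) * t) = 2 * cos t * sin (real (Suc n) * t) - sin (real n * t)"
  proof -
    have 1: "real (Suc (Suc n)) * t = real (Suc n) * t + t" "real n * t = real (Suc n) * t - t"
      by (simp_all add: algebra_simps)
    show ?thesis unfolding 1 sin_add sin_diff by simp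
  qed
  then show ?case using 3 by (simp add: diff_divide_distrib)
qed auto

lemma cheb_ge_one: "c \<ge> 1 \<Longrightarrow> 0 \<le> cheb c n \<and> cheb c n \<le> cheb c (Suc n)"
proof (induction n)
  case (Suc n)
  then have "0 \<le> cheb c n" "cheb c n \<le> cheb c (Suc n)" by auto
  moreover have "1 * cheb c (Suc n) \<le> c * cheb c (Suc n)" using Suc by (intro mult_right_mono) auto
  ultimately show ?case by simp
qed auto

lemma sin_pi_div_pos: "m \<ge> 2 \<Longrightarrow> sin (pi / real m) > 0"
  by (intro sin_gt_zero) (auto simp: field_simps)

lemma cheb_nonneg: "m \<ge> 2 \<Longrightarrow> n \<le> m \<Longrightarrow> cheb (cos (pi / real m)) n \<ge> 0"
proof -
  assume m: "m \<ge> 2" "n \<le> m"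
  have "sin (real n * (pi / real m)) \<ge> 0"
    using m by (intro sin_ge_zero) (auto simp: field_simps)
  then show ?thesis using cheb_sin[of "pi / real m" n] sin_pi_div_pos[OF m(1)] by simp
qed

text \<open>The relation \<open>(x y)^m = 1\<close>, in the form that shortens a word by two
  letters. The form is nondegenerate on the plane of the two simple roots, so every vector is a
  combination of them plus a vector fixed by both reflections; it suffices to compare both sides on
  the two roots.\<close>

lemma braid:
  assumes xy: "x \<in> N" "y \<in> N" and m: "m \<ge> 2" "B x y = - cos (pi / real m)"
  shows "act (alt (Suc m) x y) = act (alt (m - 1) y x)"
proof -
  define c where "c = cos (pi / real m)"
  have sp: "sin (pi / real m) > 0" using m by (simp add: sin_pi_div_pos)
  have c2: "c\<^sup>2 \<noteq> 1" unfolding c_def using sp sin_cos_squared_add[of "pi / real m"]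
    by (smt (verit) power_zero_numeral zero_less_power)
  have B: "- B x y = c" "- B y x = c" using m B_sym[of x y] by (auto simp: c_def)
  have um: "cheb c m = 0" using cheb_sin[of "pi / real m" m] sp m by (simp add: c_def)
  obtain p where p: "m = Suc (Suc p)" using m by (metis add_2_eq_Suc nat_le_iff_add)
  have um1: "cheb c (Suc p) = 1"
  proof -
    have "real (Suc p) * (pi / real m) = pi - pi / real m" using p by (simp add: field_simps)
    then show ?thesis using cheb_sin[of "pi / real m" "Suc p"] sp by (simp add: c_def)
  qed
  have um2: "cheb c p = 2 * c" using um um1 p by simp
  have up1: "cheb c (Suc m) = - 1" "cheb c (Suc (Suc m)) = - 2 * c" using um um1 p by auto
  \<comment> \<open>\<open>l\<close> is the last letter of the left word and \<open>z\<close> the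
    letter that would continue it; for the right word the roles are exchanged. So
    \<open>act_alt\<close> applies at once to one of the two roots, and to the other after the last
    letter has turned its own simple root into its negative.\<close>
  define z where "z = (if even m then y else x)"
  define l where "l = (if even m then x else y)"
  have mm: "m - 1 = Suc p" using p by simp
  have L1: "act (alt (Suc m) x y) (simple z) = comb (- 2 * c) (simple x) (- 1) (simple y)"
  proof -
    have "(if even (Suc m) then x else y) = z" by (simp add: z_def)
    then show ?thesis using act_alt[OF xy, of "Suc m"] unfolding B up1 by (simp only:)
  qed
  have neg: "act xs (s e (simple e)) = comb (- 1) (act xs (simple e)) 0 (simple e)" if "e \<in> N" for e xs
  proof -
    have "s e (simple e) = comb (- 1) (simple e) 0 (simple e)" using that by (auto simp: s_simple_self comb_def)
    then show ?thesis by (simp add: act_comb) (simp add: comb_def)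
  qed
  have lN: "l \<in> N" "z \<in> N" using xy by (auto simp: l_def z_def)
  have L2: "act (alt (Suc m) x y) (simple l) = simple x"
  proof -
    have "act (alt m x y) (simple l) = comb (- 1) (simple x) 0 (simple y)"
      using act_alt[OF xy, of m] unfolding B l_def up1 um .
    then show ?thesis unfolding alt_Suc_right act_append l_def[symmetric]
      by (simp add: neg lN) (simp add: comb_def)
  qed
  have R1: "act (alt (m - 1) y x) (simple l) = simple x"
    using act_alt[OF xy(2,1), of "m - 1"] unfolding B l_def mm um1 using um p
    by (auto simp: comb_def)
  have R2: "act (alt (m - 1) y x) (simple z) = comb (- 2 * c) (simple x) (- 1) (simple y)"
  proof -
    have "act (alt p y x) (simple z) = comb 1 (simple y) (2 * c) (simple x)"
      using act_alt[OF xy(2,1), of p] unfolding B z_def um1 um2 using p by auto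
    moreover have "alt (m - 1) y x = alt p y x @ [z]" unfolding mm alt_Suc_right z_def using p by auto
    ultimately show ?thesis by (simp add: neg lN) (auto simp: comb_def)
  qed
  have xyz: "act (alt (Suc m) x y) (simple x) = act (alt (m - 1) y x) (simple x)"
    "act (alt (Suc m) x y) (simple y) = act (alt (m - 1) y x) (simple y)"
    using L1 L2 R1 R2 by (auto simp: z_def l_def split: if_splits)
  show ?thesis
  proof (rule ext)
    fix d
    \<comment> \<open>Coefficients of the projection of \<open>d\<close> to the plane; 1 - c^2 is
      the Gram determinant.\<close>
    define a where "a = (bf d x + c * bf d y) / (1 - c\<^sup>2)"
    define b where "b = (bf d y + c * bf d x) / (1 - c\<^sup>2)"
    define d0 where "d0 = comb 1 d (- 1) (comb a (simple x) b (simple y))"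
    have Bxy: "B x y = - c" "B y x = - c" using B by auto
    have eq: "X - c * Y = p" if "X = (p + c * q) / (1 - c\<^sup>2)" "Y = (q + c * p) / (1 - c\<^sup>2)" for X Y p q
    proof -
      have "X - c * Y = ((p + c * q) - c * (q + c * p)) / (1 - c\<^sup>2)" by (simp add: that diff_divide_distrib)
      also have "(p + c * q) - c * (q + c * p) = p * (1 - c\<^sup>2)" by (simp add: algebra_simps power2_eq_square)
      finally show ?thesis using c2 by simp
    qed
    have ab: "a - c * b = bf d x" "b - c * a = bf d y"
      using eq a_def b_def by blast+
    have "bf d0 x = 0" "bf d0 y = 0"
      using ab unfolding d0_def bf_comb bf_simple[OF xy(1)] bf_simple[OF xy(2)] Bxy
        B_one[OF xy(1)] B_one[OF xy(2)] by (auto simp: algebra_simps)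
    then have f: "s x d0 = d0" "s y d0 = d0" by (auto simp: s_fix)
    have "act xs d0 = d0" if "set xs \<subseteq> {x, y}" for xs
      using that f by (induction xs) auto
    then have "act (alt (Suc m) x y) d0 = d0" "act (alt (m - 1) y x) d0 = d0"
      using set_alt by blast+
    moreover have "d = comb 1 d0 1 (comb a (simple x) b (simple y))" by (auto simp: d0_def comb_def)
    ultimately show "act (alt (Suc m) x y) d = act (alt (m - 1) y x) d"
      using xyz by (simp only: act_comb)
  qed
qed

lemma dihedral_word:
  assumes "x \<in> N" "y \<in> N" "set zs \<subseteq> {x, y}"
  shows "(\<exists>n p q. {p, q} = {x, y} \<and> zs = alt n p q) \<or>
    (\<exists>zs'. set zs' \<subseteq> {x, y} \<and> length zs' < length zs \<and> act zs' = act zs)"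
  using assms(3)
proof (induction zs)
  case Nil
  have "[] = alt 0 x y" by simp
  then show ?case by blast
next
  case (Cons a zs)
  then have a: "a = x \<or> a = y" by auto
  have IH: "(\<exists>n p q. {p, q} = {x, y} \<and> zs = alt n p q) \<or>
    (\<exists>zs'. set zs' \<subseteq> {x, y} \<and> length zs' < length zs \<and> act zs' = act zs)" using Cons by simp
  then show ?case
  proof (elim disjE exE conjE)
    fix zs' assume zs': "set zs' \<subseteq> {x, y}" "length zs' < length zs" "act zs' = act zs"
    have "act (a # zs') = act (a # zs)" by (rule ext) (simp add: zs'(3))
    moreover have "set (a # zs') \<subseteq> {x, y}" "length (a # zs') < length (a # zs)" using zs' a by auto
    ultimately show ?thesis by blast
  next
    fix n p q assume pq: "{p, q} = {x, y}" "zs = alt n p q"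
    show ?thesis
    proof (cases n)
      case 0
      have "a # zs = alt 1 a (if a = x then y else x)" using 0 pq by simp
      moreover have "{a, if a = x then y else x} = {x, y}" using a by auto
      ultimately show ?thesis by blast
    next
      case (Suc n')
      have zs: "zs = p # alt n' q p" using Suc pq by simp
      show ?thesis
      proof (cases "a = p")
        case True
        have "p \<in> N" using pq assms by (auto simp: doubleton_eq_iff)
        then have "act (alt n' q p) = act (a # zs)" using zs True by (auto simp: fun_eq_iff)
        moreover have "set (alt n' q p) \<subseteq> {x, y}" using set_alt[of n' q p] pq by blast
        moreover have "length (alt n' q p) < length (a # zs)" using zs by simp
        ultimately show ?thesis by blast
      next
        case False
        then have "a = q" using a pq by (auto simp: doubleton_eq_iff)
        then have "a # zs = alt (Suc n) q p" using pq by simp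
        then show ?thesis using pq by (metis insert_commute)
      qed
    qed
  qed
qed

text \<open>Rank two case of positivity. As long as \<open>zs @ [x]\<close> alternates and has at
  most \<open>m\<close> letters, the Chebyshev coefficients are nonnegative; beyond that the braid
  relation shortens it. With label infinity they are always nonnegative. Lengths are compared with
  \<open>zs\<close> even for \<open>zs @ [x]\<close>, because this is what contradicts the length
  assumption of \<open>reduced_pos\<close>.\<close>

lemma dihedral:
  assumes xy: "x \<in> N" "y \<in> N" "x \<noteq> y" "set zs \<subseteq> {x, y}"
  shows "(\<exists>a b. a \<ge> 0 \<and> b \<ge> 0 \<and> act zs (simple x) = comb a (simple x) b (simple y)) \<or>
    (\<exists>zs'. set zs' \<subseteq> {x, y} \<and> length zs' < length zs \<and> (act zs' = act zs \<or> act zs' = act (zs @ [x])))"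
proof -
  from dihedral_word[OF xy(1,2,4)] show ?thesis
  proof (elim disjE exE conjE)
    fix n p q assume pq: "{p, q} = {x, y}" "zs = alt n p q"
    have pqN: "p \<in> N" "q \<in> N" "p \<noteq> q" using pq xy by (auto simp: doubleton_eq_iff)
    show ?thesis
    proof (cases "(if even n then p else q) = x")
      case z: True
      have act: "act zs (simple x) = comb (cheb (- B p q) (Suc n)) (simple p) (cheb (- B p q) n) (simple q)"
        using act_alt[OF pqN(1,2), of n] z pq by simp
      have nn: ?thesis if "cheb (- B p q) (Suc n) \<ge> 0" "cheb (- B p q) n \<ge> 0"
      proof -
        have "p = x \<and> q = y \<or> p = y \<and> q = x" using pq by (auto simp: doubleton_eq_iff)
        then show ?thesis
        proof
          assume "p = x \<and> q = y" then show ?thesis using that act by blast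
        next
          assume "p = y \<and> q = x"
          then have "act zs (simple x) = comb (cheb (- B p q) n) (simple x) (cheb (- B p q) (Suc n)) (simple y)"
            using act by (auto simp: comb_def)
          then show ?thesis using that by blast
        qed
      qed
      from B_cox[OF pqN] show ?thesis
      proof (elim disjE exE conjE)
        assume "B p q \<le> - 1"
        then have "- B p q \<ge> 1" by simp
        then show ?thesis using cheb_ge_one nn by blast
      next
        fix m :: nat assume m: "m \<ge> 2" "B p q = - cos (pi / real m)"
        show ?thesis
        proof (cases "Suc n \<le> m")
          case True
          then show ?thesis using nn cheb_nonneg[OF m(1)] m(2) by simp
        next
          case False
          define r where "r = (if even (Suc m) then alt (n - m) p q else alt (n - m) q p)"
          have "zs @ [x] = alt (Suc n) p q" using pq z by (simp only: alt_Suc_right)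
          also have "\<dots> = alt (Suc m) p q @ r" using alt_add[of "Suc m" "n - m" p q] False
            by (simp add: r_def)
          finally have "act (zs @ [x]) = act (alt (m - 1) q p @ r)"
            by (simp only: act_append_fun braid[OF pqN(1,2) m])
          moreover have "set (alt (m - 1) q p @ r) \<subseteq> {x, y}"
            using set_alt[of "m - 1" q p] set_alt[of "n - m" p q] set_alt[of "n - m" q p] pq
            unfolding r_def by (auto split: if_splits)
          moreover have "length (alt (m - 1) q p @ r) < length zs" using pq False m by (auto simp: r_def)
          ultimately show ?thesis by metis
        qed
      qed
    next
      case z: False
      show ?thesis
      proof (cases n)
        case 0
        then have "act zs (simple x) = comb 1 (simple x) 0 (simple y)" using pq by (auto simp: comb_def)
        then show ?thesis by (intro disjI1 exI[of _ 1] exI[of _ 0]) simp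
      next
        case (Suc n')
        have "zs = alt n' p q @ [if even n' then p else q]" using pq Suc by (simp only: alt_Suc_right)
        moreover have "(if even n' then p else q) = x"
          using z Suc pq pqN by (auto simp: doubleton_eq_iff)
        ultimately have "act (alt n' p q) = act (zs @ [x])" using xy by (auto simp: fun_eq_iff)
        moreover have "set (alt n' p q) \<subseteq> {x, y}" using set_alt[of n' p q] pq by auto
        moreover have "length (alt n' p q) < length zs" using Suc pq by simp
        ultimately show ?thesis by blast
      qed
    qed
  qed blast
qed

section \<open>Reduced words and the signs of roots\<close>

definition reduced :: "'i list \<Rightarrow> bool" where
  "reduced xs \<longleftrightarrow> set xs \<subseteq> N \<and> (\<forall>ys. set ys \<subseteq> N \<and> act ys = act xs \<longrightarrow> length xs \<le> length ys)"

lemma reduced_exists: "set xs \<subseteq> N \<Longrightarrow> \<exists>ys. reduced ys \<and> act ys = act xs \<and> length ys \<le> length xs"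
proof -
  assume xs: "set xs \<subseteq> N"
  define Q where "Q = (\<lambda>ys. set ys \<subseteq> N \<and> act ys = act xs)"
  have "Q xs" using xs by (simp add: Q_def)
  from ex_has_least_nat[of Q xs length, OF this] obtain ys where
    ys: "Q ys" and least: "\<And>zs. Q zs \<Longrightarrow> length ys \<le> length zs" by blast
  have eq: "act ys = act xs" using ys by (simp add: Q_def)
  have "length ys \<le> length zs" if "set zs \<subseteq> N" "act zs = act ys" for zs
    by (rule least) (simp only: Q_def that eq simp_thms)
  then have "reduced ys" using ys unfolding reduced_def Q_def by blast
  then show ?thesis using eq least[OF \<open>Q xs\<close>] by blast
qed

lemma act_cong_append: "act xs = act xs' \<Longrightarrow> act ys = act ys' \<Longrightarrow> act (xs @ ys) = act (xs' @ ys')"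
  by (simp add: act_append_fun)

lemma reduced_prefix: "reduced (ys @ zs) \<Longrightarrow> reduced ys"
proof -
  assume r: "reduced (ys @ zs)"
  have "length ys \<le> length vs" if "set vs \<subseteq> N" "act vs = act ys" for vs
  proof -
    have "set (vs @ zs) \<subseteq> N" "act (vs @ zs) = act (ys @ zs)"
      using r that by (auto simp: reduced_def)
    then have "length (ys @ zs) \<le> length (vs @ zs)" using r unfolding reduced_def by blast
    then show ?thesis by simp
  qed
  then show ?thesis using r by (simp add: reduced_def)
qed

text \<open>
  Split off the longest possible alternating suffix in two letters; the rest is handled by
  induction and the suffix by a computation in a dihedral group.
\<close>

lemma reduced_pos:
  assumes "reduced xs" "e \<in> N" "\<And>ys. set ys \<subseteq> N \<Longrightarrow> act ys = act (xs @ [e]) \<Longrightarrow> length xs \<le> length ys"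
  shows "act xs (simple e) i \<ge> 0"
  using assms
proof (induction "length xs" arbitrary: xs e i rule: less_induct)
  case less
  show ?case
  proof (cases "xs = []")
    case True then show ?thesis by (simp add: simple_def)
  next
    case False
    define t where "t = last xs"
    have xt: "xs = butlast xs @ [t]" using False by (simp add: t_def)
    have xsN: "set xs \<subseteq> N" using less by (simp add: reduced_def)
    have tN: "t \<in> N" using xsN False by (auto simp: t_def)
    have bN: "set (butlast xs) \<subseteq> N" using xsN by (meson in_set_butlastD subset_iff)
    \<comment> \<open>Otherwise \<open>butlast xs\<close> would represent \<open>xs @ [e]\<close>
      with fewer letters than \<open>xs\<close>.\<close>
    have te: "e \<noteq> t"
    proof
      assume "e = t"
      then have "act (butlast xs) = act (xs @ [e])"
      proof -
        have "xs @ [e] = butlast xs @ [t, t]" using xt \<open>e = t\<close> by simp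
        then show ?thesis by (intro ext) (simp only: act_append act_Cons act_Nil s_s[OF tN])
      qed
      then show False using less.prems(3)[OF bN] False by (metis diff_less length_butlast length_greater_0_conv not_le zero_less_one)
    qed
    define Q where "Q = (\<lambda>(ys, zs). set ys \<subseteq> N \<and> set zs \<subseteq> {e, t} \<and> act (ys @ zs) = act xs
       \<and> length ys + length zs = length xs)"
    \<comment> \<open>This candidate already moves one letter into the suffix, so the optimal
      \<open>ys\<close> is strictly shorter than \<open>xs\<close> and the induction hypothesis
      applies to it.\<close>
    have Q0: "Q (butlast xs, [t])" using bN False by (simp add: Q_def xt[symmetric] act_append_fun[symmetric])
    from ex_has_least_nat[of Q _ "length \<circ> fst", OF this] obtain ys zs where
      Q: "Q (ys, zs)" and least: "\<And>ys' zs'. Q (ys', zs') \<Longrightarrow> length ys \<le> length ys'"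
      by (auto simp: comp_def)
    have Qd: "set ys \<subseteq> N" "set zs \<subseteq> {e, t}" "act (ys @ zs) = act xs" "length ys + length zs = length xs"
      using Q by (auto simp: Q_def)
    have reduced_yz: "reduced (ys @ zs)"
    proof -
      have "set (ys @ zs) \<subseteq> N" "length (ys @ zs) = length xs" using Qd less.prems(2) tN by auto
      then show ?thesis using less.prems(1) Qd(3) unfolding reduced_def by metis
    qed
    have lys: "length ys < length xs"
    proof -
      have "length (butlast xs) < length xs" using False by simp
      then show ?thesis using least[OF Q0] by linarith
    qed
    have reduced_ys: "reduced ys" using reduced_yz by (rule reduced_prefix)
    \<comment> \<open>A word for \<open>ys @ [h]\<close> shorter than \<open>ys\<close> would let
      \<open>h\<close> pass to the suffix without lengthening the whole, against minimality of
      \<open>ys\<close>.\<close>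
    have step: "act ys (simple h) i \<ge> 0" if h: "h \<in> {e, t}" for h i
    proof (rule less.hyps[OF lys reduced_ys])
      show "h \<in> N" using h tN less.prems(2) by auto
    next
      fix vs assume vs: "set vs \<subseteq> N" "act vs = act (ys @ [h])"
      show "length ys \<le> length vs"
      proof (rule ccontr)
        assume "\<not> ?thesis"
        then have lt: "length vs < length ys" by simp
        have hN: "h \<in> N" using h tN less.prems(2) by auto
        have eq: "act (vs @ h # zs) = act xs"
        proof (rule ext)
          fix c
          have "act vs (s h (act zs c)) = act ys (s h (s h (act zs c)))" by (simp add: vs(2))
          then show "act (vs @ h # zs) c = act xs c"
            using hN Qd(3)[symmetric] by simp
        qed
        have "length xs \<le> length (vs @ h # zs)"
        proof -
          have "set (vs @ h # zs) \<subseteq> N" using vs hN Qd(2) tN less.prems(2) by auto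
          then show ?thesis using less.prems(1) eq unfolding reduced_def by blast
        qed
        then have "Q (vs, h # zs)"
        proof -
          have "length (vs @ h # zs) \<le> length xs" using lt Qd(4) by simp
          then have "length vs + length (h # zs) = length xs" using \<open>length xs \<le> _\<close> by simp
          moreover have "set (h # zs) \<subseteq> {e, t}" using h Qd(2) by simp
          ultimately show ?thesis using eq vs(1) unfolding Q_def by simp
        qed
        then have "length ys \<le> length vs" by (rule least)
        then show False using lt by simp
      qed
    qed
    \<comment> \<open>A shorter suffix would give a word for \<open>xs\<close> or for
      \<open>xs @ [e]\<close> with fewer letters than \<open>xs\<close>.\<close>
    have "\<not> (\<exists>zs'. set zs' \<subseteq> {e, t} \<and> length zs' < length zs \<and> (act zs' = act zs \<or> act zs' = act (zs @ [e])))"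
    proof
      assume "\<exists>zs'. set zs' \<subseteq> {e, t} \<and> length zs' < length zs \<and> (act zs' = act zs \<or> act zs' = act (zs @ [e]))"
      then obtain zs' where z: "set zs' \<subseteq> {e, t}" "length zs' < length zs"
        and alt: "act zs' = act zs \<or> act zs' = act (zs @ [e])" by blast
      have zN: "set (ys @ zs') \<subseteq> N" using z(1) Qd(1) less.prems(2) tN by auto
      have ln: "length (ys @ zs') < length xs" using z(2) Qd(4) by simp
      have "act (xs @ [e]) = act (ys @ zs @ [e])" using act_cong_append[OF Qd(3) refl, of "[e]"] by (simp only: append_assoc)
      then have "act (ys @ zs') = act xs \<or> act (ys @ zs') = act (xs @ [e])"
        using alt
      proof (elim disjE)
        assume "act zs' = act zs"
        from act_cong_append[OF refl this, of ys] show ?thesis by (simp only: Qd(3) simp_thms)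
      next
        assume "act zs' = act (zs @ [e])"
        from act_cong_append[OF refl this, of ys] show ?thesis
          using \<open>act (xs @ [e]) = act (ys @ zs @ [e])\<close> by (simp only: simp_thms)
      qed
      then show False
      proof
        assume "act (ys @ zs') = act xs"
        then have "length xs \<le> length (ys @ zs')" using less.prems(1) zN unfolding reduced_def by blast
        then show False using ln by simp
      next
        assume "act (ys @ zs') = act (xs @ [e])"
        then show False using less.prems(3)[OF zN] ln by simp
      qed
    qed
    then obtain a b where ab: "a \<ge> 0" "b \<ge> 0" "act zs (simple e) = comb a (simple e) b (simple t)"
      using dihedral[OF less.prems(2) tN te Qd(2)] by blast
    have "act xs (simple e) = comb a (act ys (simple e)) b (act ys (simple t))"
      by (simp only: Qd(3)[symmetric] act_append ab(3) act_comb)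
    then have "act xs (simple e) i = a * act ys (simple e) i + b * act ys (simple t) i" by (simp only: comb_def)
    moreover have "act ys (simple e) i \<ge> 0" "act ys (simple t) i \<ge> 0" by (rule step, simp)+
    ultimately show ?thesis using ab(1,2) by simp
  qed
qed

section \<open>The group, its roots and the pairing with the dual space\<close>

definition W :: "(('i \<Rightarrow> real) \<Rightarrow> ('i \<Rightarrow> real)) set" where
  "W = {act xs | xs. set xs \<subseteq> N}"

text \<open>The second argument is a point of the dual space, recorded by its values on the simple
  roots. The chamber of \<open>w\<close> there consists of the points nonnegative on all
  \<open>w (simple e)\<close>.\<close>

definition pair :: "('i \<Rightarrow> real) \<Rightarrow> ('i \<Rightarrow> real) \<Rightarrow> real" where
  "pair c y = (\<Sum>i\<in>N. c i * y i)"

definition bb :: "('i \<Rightarrow> real) \<Rightarrow> ('i \<Rightarrow> real) \<Rightarrow> real" where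
  "bb c d = (\<Sum>i\<in>N. d i * bf c i)"

definition R :: "('i \<Rightarrow> real) set" where
  "R = {w (simple e) | w e. w \<in> W \<and> e \<in> N}"

definition supp :: "('i \<Rightarrow> real) \<Rightarrow> bool" where
  "supp c \<longleftrightarrow> (\<forall>i. i \<notin> N \<longrightarrow> c i = 0)"

lemma W_reduced: "w \<in> W \<Longrightarrow> \<exists>xs. reduced xs \<and> w = act xs"
  unfolding W_def using reduced_exists by force

lemma id_W: "id \<in> W"
proof -
  have "act [] = id" by auto
  then show ?thesis unfolding W_def by (metis (mono_tags, lifting) empty_set empty_subsetI mem_Collect_eq)
qed

lemma act_single: "act [e] = s e" by (rule ext) simp

lemma s_W: "e \<in> N \<Longrightarrow> s e \<in> W"
  unfolding W_def using act_single by (auto intro!: exI[of _ "[e]"])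

lemma comp_W: "w \<in> W \<Longrightarrow> w' \<in> W \<Longrightarrow> w \<circ> w' \<in> W"
proof -
  assume "w \<in> W" "w' \<in> W"
  then obtain xs ys where "set xs \<subseteq> N" "w = act xs" "set ys \<subseteq> N" "w' = act ys"
    unfolding W_def by blast
  then have "w \<circ> w' = act (xs @ ys)" "set (xs @ ys) \<subseteq> N" by (auto simp: act_append_fun)
  then show ?thesis unfolding W_def by blast
qed

lemma act_rev: "set xs \<subseteq> N \<Longrightarrow> act xs (act (rev xs) c) = c"
  by (induction xs arbitrary: c) auto

lemma W_inverse: "w \<in> W \<Longrightarrow> \<exists>w'\<in>W. (\<forall>c. w (w' c) = c) \<and> (\<forall>c. w' (w c) = c)"
proof -
  assume "w \<in> W"
  then obtain xs where xs: "set xs \<subseteq> N" "w = act xs" unfolding W_def by blast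
  then have "act (rev xs) \<in> W" unfolding W_def by (auto intro!: exI[of _ "rev xs"])
  then show ?thesis using act_rev[of xs] act_rev[of "rev xs"] xs by (intro bexI) auto
qed

lemma W_comb: "w \<in> W \<Longrightarrow> w (comb a c b d) = comb a (w c) b (w d)"
  unfolding W_def using act_comb by blast

lemma W_neg: "w \<in> W \<Longrightarrow> w (s e (simple e)) = comb (- 1) (w (simple e)) 0 (w (simple e))" if "e \<in> N"
proof -
  assume w: "w \<in> W"
  have "s e (simple e) = comb (- 1) (simple e) 0 (simple e)" using that by (auto simp: s_simple_self comb_def)
  then show ?thesis using W_comb[OF w] by simp
qed

lemma reduced_snoc_pos: "reduced (ys @ [e]) \<Longrightarrow> act ys (simple e) i \<ge> 0"
proof (rule reduced_pos)
  assume r: "reduced (ys @ [e])"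
  then show "reduced ys" by (rule reduced_prefix)
  show "e \<in> N" using r by (simp add: reduced_def)
  fix zs assume "set zs \<subseteq> N" "act zs = act (ys @ [e])"
  then have "length (ys @ [e]) \<le> length zs" using r unfolding reduced_def by blast
  then show "length ys \<le> length zs" by simp
qed

lemma act_snoc_neg:
  assumes "reduced (ys @ [e])" shows "act (ys @ [e]) (simple e) i \<le> 0"
proof -
  have "e \<in> N" using assms by (simp add: reduced_def)
  then have "act ys (s e (simple e)) = comb (- 1) (act ys (simple e)) 0 (act ys (simple e))"
    using assms by (intro W_neg) (auto simp: W_def reduced_def)
  then show ?thesis using reduced_snoc_pos[OF assms] by (simp add: comb_def)
qed

text \<open>If appending \<open>e\<close> shortens the word, then \<open>w\<close> has a reduced
  word ending in \<open>e\<close>, and the root is the negative of a positive one; otherwise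
  \<open>reduced_pos\<close> applies.\<close>

lemma root_sign:
  assumes "w \<in> W" "e \<in> N"
  shows "(\<forall>i. w (simple e) i \<ge> 0) \<or> (\<forall>i. w (simple e) i \<le> 0)"
proof -
  obtain xs where xs: "reduced xs" "w = act xs" using W_reduced assms by blast
  show ?thesis
  proof (cases "\<forall>ys. set ys \<subseteq> N \<longrightarrow> act ys = act (xs @ [e]) \<longrightarrow> length xs \<le> length ys")
    case True
    then show ?thesis using reduced_pos[OF xs(1) assms(2)] xs(2) by blast
  next
    case False
    then obtain ys where ys: "set ys \<subseteq> N" "act ys = act (xs @ [e])" "length ys < length xs" by force
    obtain zs where zs: "reduced zs" "act zs = act ys" "length zs \<le> length ys" using reduced_exists[OF ys(1)] by blast
    have eq: "act (zs @ [e]) = act xs"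
      using zs(2) ys(2) assms(2) by (intro ext) simp
    have "reduced (zs @ [e])"
      unfolding reduced_def
    proof (intro conjI allI impI)
      show "set (zs @ [e]) \<subseteq> N" using zs assms by (auto simp: reduced_def)
      fix vs assume "set vs \<subseteq> N \<and> act vs = act (zs @ [e])"
      then have "length xs \<le> length vs" using xs(1) eq unfolding reduced_def by auto
      then show "length (zs @ [e]) \<le> length vs" using zs(3) ys(3) by simp
    qed
    from act_snoc_neg[OF this] show ?thesis unfolding xs(2) eq by blast
  qed
qed

text \<open>The last letter of a reduced word is such an \<open>e\<close>. This is what later
  separates the chambers of different elements.\<close>

lemma W_nontrivial:
  assumes "w \<in> W" "w \<noteq> id"
  shows "\<exists>e\<in>N. \<forall>i. w (simple e) i \<le> 0"
proof -
  obtain xs where xs: "reduced xs" "w = act xs" using W_reduced assms by blast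
  have "xs \<noteq> []" using assms(2) xs(2) by auto
  then obtain ys e where ye: "xs = ys @ [e]" by (metis rev_exhaust)
  then have "e \<in> N" using xs by (simp add: reduced_def)
  then show ?thesis using act_snoc_neg[of ys e] xs ye by blast
qed

text \<open>Along a reduced word each new letter \<open>e\<close> adds the nonnegative number
  \<open>- 2 * bf v e\<close> times a positive root.\<close>

lemma W_increasing:
  assumes "w \<in> W" "\<And>e. e \<in> N \<Longrightarrow> bf v e \<le> 0"
  shows "w v i \<ge> v i"
proof -
  have "act xs v i \<ge> v i" if "reduced xs" for xs
    using that
  proof (induction xs rule: rev_induct)
    case (snoc e ys)
    have "e \<in> N" using snoc by (simp add: reduced_def)
    then have "bf v e \<le> 0" by (rule assms)
    moreover have "act (ys @ [e]) v = comb 1 (act ys v) (- 2 * bf v e) (act ys (simple e))"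
      by (simp only: act_append act_Cons act_Nil s_eq_comb act_comb)
    ultimately have "act (ys @ [e]) v i \<ge> act ys v i"
      using reduced_snoc_pos[OF snoc.prems, of i] by (simp add: comb_def mult_nonpos_nonneg)
    then show ?case using snoc.IH[OF reduced_prefix[OF snoc.prems]] by simp
  qed simp
  then show ?thesis using W_reduced[OF assms(1)] by blast
qed

lemma supp_W: "w \<in> W \<Longrightarrow> supp c \<Longrightarrow> supp (w c)"
proof -
  have "set xs \<subseteq> N \<Longrightarrow> supp c \<Longrightarrow> supp (act xs c)" for xs
    by (induction xs) (auto simp: supp_def s_def)
  then show "w \<in> W \<Longrightarrow> supp c \<Longrightarrow> supp (w c)" unfolding W_def by blast
qed

lemma supp_simple: "e \<in> N \<Longrightarrow> supp (simple e)" by (auto simp: supp_def simple_def)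

lemma bb_comb: "bb (comb a c b d) g = a * bb c g + b * bb d g"
  "bb g (comb a c b d) = a * bb g c + b * bb g d"
  by (simp_all add: bb_def bf_comb algebra_simps sum.distrib sum_distrib_left)
     (simp add: comb_def algebra_simps sum.distrib sum_distrib_left)

lemma sum_simple: "e \<in> N \<Longrightarrow> (\<Sum>i\<in>N. simple e i * f i) = f e"
proof -
  assume e: "e \<in> N"
  have "(\<Sum>i\<in>N. simple e i * f i) = (\<Sum>i\<in>N. if i = e then f i else 0)"
    unfolding simple_def by (intro sum.cong) auto
  then show ?thesis using e finite_N by simp
qed

lemma bb_simple: "e \<in> N \<Longrightarrow> bb c (simple e) = bf c e"
  unfolding bb_def by (rule sum_simple)

lemma bb_simple': "e \<in> N \<Longrightarrow> bb (simple e) c = bf c e"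
  unfolding bb_def bf_def[of c] using B_sym[of e] by (simp add: bf_simple)

lemma bb_s: "e \<in> N \<Longrightarrow> bb (s e c) (s e d) = bb c d"
  unfolding s_eq_comb bb_comb by (simp add: bb_simple bb_simple' bf_simple B_one)

lemma bb_W: "w \<in> W \<Longrightarrow> bb (w c) (w d) = bb c d"
proof -
  have "set xs \<subseteq> N \<Longrightarrow> bb (act xs c) (act xs d) = bb c d" for xs
    by (induction xs) (auto simp: bb_s)
  then show "w \<in> W \<Longrightarrow> bb (w c) (w d) = bb c d" unfolding W_def by blast
qed

lemma root_supp: "c \<in> R \<Longrightarrow> supp c"
  unfolding R_def using supp_W supp_simple by blast

lemma root_norm: "c \<in> R \<Longrightarrow> bb c c = 1"
  unfolding R_def using bb_W bb_simple bf_simple B_one by auto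

lemma W_root: "w \<in> W \<Longrightarrow> c \<in> R \<Longrightarrow> w c \<in> R"
proof -
  assume "w \<in> W" "c \<in> R"
  then obtain w' e where "w' \<in> W" "e \<in> N" "c = w' (simple e)" unfolding R_def by blast
  then have "w c = (w \<circ> w') (simple e)" "w \<circ> w' \<in> W" "e \<in> N" using comp_W \<open>w \<in> W\<close> by auto
  then show ?thesis unfolding R_def by blast
qed

lemma simple_root: "e \<in> N \<Longrightarrow> simple e \<in> R"
  unfolding R_def using id_W by (auto intro!: exI[of _ id])

lemma root_sign': "c \<in> R \<Longrightarrow> (\<forall>i. c i \<ge> 0) \<or> (\<forall>i. c i \<le> 0)"
  unfolding R_def using root_sign by blast

lemma root_multiple:
  assumes "c \<in> R" "e \<in> N" "\<And>i. c i \<ge> 0" "\<And>i. i \<in> N \<Longrightarrow> i \<noteq> e \<Longrightarrow> c i = 0"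
  shows "c = simple e"
proof -
  have c: "c = comb (c e) (simple e) 0 (simple e)"
  proof (rule ext)
    fix i show "c i = comb (c e) (simple e) 0 (simple e) i"
      using assms(4)[of i] root_supp[OF assms(1)] by (cases "i \<in> N") (auto simp: comb_def simple_def supp_def)
  qed
  have "bb c c = c e * c e"
    by (subst (1 2) c) (simp add: bb_comb bb_simple bf_simple B_one assms(2))
  then have "c e * c e = 1" using root_norm assms by simp
  then have "c e = 1" using assms(3)[of e] by (metis abs_of_nonneg mult.right_neutral real_sqrt_abs2 real_sqrt_one)
  then show ?thesis using c by (auto simp: comb_def)
qed

text \<open>The reflection alters only the coordinate at \<open>e\<close>. A positive root other
  than \<open>simple e\<close> has another positive coordinate, which survives and decides the sign
  of all of them.\<close>

lemma simple_permutes: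
  assumes "c \<in> R" "e \<in> N" "\<And>i. c i \<ge> 0" "c \<noteq> simple e"
  shows "s e c i \<ge> 0"
proof -
  obtain j where j: "j \<in> N" "j \<noteq> e" "c j \<noteq> 0" using root_multiple[OF assms(1-3)] assms(4) by blast
  then have "c j > 0" using assms(3)[of j] by simp
  then have "s e c j > 0" using j by (simp add: s_def)
  moreover have "s e c \<in> R" using W_root[OF s_W] assms by blast
  ultimately show ?thesis using root_sign' by (meson linorder_not_le)
qed

lemma pair_comb: "pair (comb a c b d) y = a * pair c y + b * pair d y"
  by (simp add: pair_def comb_def algebra_simps sum.distrib sum_distrib_left)

lemma bf_sum: "bf (\<lambda>i. \<Sum>j\<in>N. c j * f j i) e = (\<Sum>j\<in>N. c j * bf (f j) e)"
  unfolding bf_def sum_distrib_right sum_distrib_left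
  by (subst sum.swap) (simp add: mult.assoc)

lemma W_expand:
  assumes "w \<in> W" "supp c"
  shows "w c i = (\<Sum>e\<in>N. c e * w (simple e) i)"
proof -
  have "act xs c = (\<lambda>i. \<Sum>e\<in>N. c e * act xs (simple e) i)" if "set xs \<subseteq> N" for xs
    using that
  proof (induction xs)
    case Nil
    show ?case
    proof (rule ext)
      fix i
      show "act [] c i = (\<Sum>e\<in>N. c e * act [] (simple e) i)"
      proof (cases "i \<in> N")
        case True
        then show ?thesis using sum_simple[of i c] by (simp add: simple_def mult.commute eq_commute)
      next
        case False
        then have "(\<Sum>e\<in>N. c e * act [] (simple e) i) = 0" by (intro sum.neutral) (auto simp: simple_def)
        then show ?thesis using assms(2) False by (simp add: supp_def)
      qed
    qed
  next
    case (Cons x xs)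
    then have IH: "act xs c = (\<lambda>i. \<Sum>e\<in>N. c e * act xs (simple e) i)" by simp
    show ?case
    proof (rule ext)
      fix i
      have "act (x # xs) c i = s x (\<lambda>i. \<Sum>e\<in>N. c e * act xs (simple e) i) i" by (simp only: act_Cons IH)
      also have "\<dots> = (\<Sum>e\<in>N. c e * s x (act xs (simple e)) i)"
        by (simp add: s_def bf_sum algebra_simps sum_subtractf sum_distrib_left)
      finally show "act (x # xs) c i = (\<Sum>e\<in>N. c e * act (x # xs) (simple e) i)" by simp
    qed
  qed
  then show ?thesis using assms(1) unfolding W_def by auto
qed

lemma pair_expand:
  assumes "w \<in> W" "supp c"
  shows "pair (w c) y = (\<Sum>e\<in>N. c e * pair (w (simple e)) y)"
  unfolding pair_def W_expand[OF assms] sum_distrib_right sum_distrib_left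
  by (subst sum.swap) (simp add: mult.assoc)

text \<open>
  Moving from \<open>w\<close> to \<open>w \<circ> s e\<close> whenever the functional \<open>y\<close> is negative on
  \<open>w (simple e)\<close> strictly shrinks the set of roots separating \<open>y\<close> from the chamber of \<open>w\<close>, so the
  game cannot cycle inside the finite set \<open>S\<close>.
\<close>

lemma numbers_game:
  assumes S: "finite S" "S \<subseteq> W" "S \<noteq> {}"
    and step: "\<And>w e. w \<in> S \<Longrightarrow> e \<in> N \<Longrightarrow> pair (w (simple e)) y < 0 \<Longrightarrow> w \<circ> s e \<in> S"
  shows "\<exists>w\<in>S. \<forall>e\<in>N. pair (w (simple e)) y \<ge> 0"
proof -
  \<comment> \<open>The roots that are positive on the chamber of \<open>w\<close> but negative at
    \<open>y\<close>.\<close>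
  define A where "A = (\<lambda>w::('i \<Rightarrow> real) \<Rightarrow> ('i \<Rightarrow> real).
    w ` {c \<in> R. (\<forall>i. c i \<ge> 0) \<and> pair (w c) y < 0})"
  \<comment> \<open>The sets \<open>A w\<close> may be infinite, since \<open>y\<close> need not lie
    in any chamber; a minimal one exists because there are only finitely many of them.\<close>
  obtain w where w: "w \<in> S" "\<And>w'. w' \<in> S \<Longrightarrow> \<not> A w' \<subset> A w"
    using finite_has_minimal[of "A ` S"] S by force
  have "pair (w (simple e)) y \<ge> 0" if e: "e \<in> N" for e
  proof (rule ccontr)
    assume "\<not> ?thesis"
    then have neg: "pair (w (simple e)) y < 0" by simp
    have wW: "w \<in> W" using w S by blast
    have sub: "A (w \<circ> s e) \<subseteq> A w"
    proof
      fix g assume "g \<in> A (w \<circ> s e)"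
      then obtain c where c: "c \<in> R" "\<And>i. c i \<ge> 0" "pair (w (s e c)) y < 0" "g = w (s e c)"
        unfolding A_def by auto
      have "c \<noteq> simple e"
      proof
        assume "c = simple e"
        then have "pair (w (s e c)) y = - pair (w (simple e)) y" using W_neg[OF e wW] by (simp add: pair_comb)
        then show False using neg c by simp
      qed
      then have "\<forall>i. s e c i \<ge> 0" using simple_permutes[OF c(1) e c(2)] by blast
      moreover have "s e c \<in> R" using W_root[OF s_W[OF e] c(1)] .
      ultimately show "g \<in> A w" unfolding A_def using c by blast
    qed
    have "w (simple e) \<in> A w" unfolding A_def using neg simple_root[OF e] by (auto simp: simple_def)
    moreover have "w (simple e) \<notin> A (w \<circ> s e)"
    proof
      assume "w (simple e) \<in> A (w \<circ> s e)"
      then obtain c where c: "\<And>i. c i \<ge> 0" "w (simple e) = w (s e c)" unfolding A_def by auto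
      then have "simple e = s e c" using W_inverse[OF wW] by metis
      then have "c = s e (simple e)" using s_s[OF e, of c] by simp
      then have "c e = - 1" using e by (simp add: s_simple_self) (simp add: simple_def)
      then show False using c(1)[of e] by simp
    qed
    ultimately have "A (w \<circ> s e) \<subset> A w" using sub by blast
    then show False using w(2) step[OF w(1) e neg] by blast
  qed
  then show ?thesis using w(1) by blast
qed

text \<open>In the application \<open>S\<close> consists of the elements whose chambers are tiles,
  \<open>M\<close> of the roots supporting \<open>P\<close>, \<open>x\<close> is an interior point
  of \<open>F\<close>, and \<open>v\<close> is the combination supplied by finite volume.\<close>

lemma card_le:
  assumes S: "finite S" "S \<subseteq> W" "S \<noteq> {}"
    and M: "finite M" "\<And>g. g \<in> M \<Longrightarrow> pair g x > 0"
    and step: "\<And>w e. w \<in> S \<Longrightarrow> e \<in> N \<Longrightarrow> w (simple e) \<in> M \<or> w \<circ> s e \<in> S"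
    and v: "\<And>e. e \<in> N \<Longrightarrow> v e > 0" "supp v" "\<And>e. e \<in> N \<Longrightarrow> bf v e \<le> 0"
  shows "card N \<le> card M"
proof (rule ccontr)
  assume "\<not> ?thesis"
  then obtain l where l: "\<exists>i\<in>N. l i \<noteq> 0" "\<And>g. g \<in> M \<Longrightarrow> pair g l = 0"
    using underdetermined_system[OF M(1) finite_N] unfolding pair_def by auto
  have add: "pair c (\<lambda>i. x i + t * y i) = pair c x + t * pair c y" for c y t
    by (simp add: pair_def algebra_simps sum.distrib sum_distrib_left)
  have dir: "\<exists>w\<in>S. \<forall>e\<in>N. pair (w (simple e)) y \<ge> 0" if y: "\<And>g. g \<in> M \<Longrightarrow> pair g y = 0" for y
  proof -
    \<comment> \<open>A root in \<open>M\<close> takes the same positive value at all points of the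
      line, so the game never crosses a wall of \<open>P\<close> and stays in
      \<open>S\<close>.\<close>
    have ex: "\<exists>w\<in>S. \<forall>e\<in>N. pair (w (simple e)) (\<lambda>i. x i + real n * y i) \<ge> 0" for n
    proof (rule numbers_game[OF S])
      fix w e assume we: "w \<in> S" "e \<in> N" "pair (w (simple e)) (\<lambda>i. x i + real n * y i) < 0"
      then have "w (simple e) \<notin> M" using M(2) y by (force simp: add)
      then show "w \<circ> s e \<in> S" using step we by blast
    qed
    then obtain f where f: "\<And>n. f n \<in> S" "\<And>n e. e \<in> N \<Longrightarrow> pair (f n (simple e)) (\<lambda>i. x i + real n * y i) \<ge> 0"
      by metis
    have "finite (range f)" using f(1) S(1) by (meson finite_subset image_subsetI)
    then obtain m where m: "infinite {n. f n = f m}"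
      using pigeonhole_infinite[of "UNIV :: nat set" f] by auto
    \<comment> \<open>One element serves infinitely many \<open>n\<close>; a negative slope would
      make the value negative for large \<open>n\<close>.\<close>
    have "pair (f m (simple e)) y \<ge> 0" if e: "e \<in> N" for e
    proof (rule ccontr)
      assume "\<not> ?thesis"
      then have neg: "pair (f m (simple e)) y < 0" by simp
      obtain n0 where n0: "real n0 > pair (f m (simple e)) x / - pair (f m (simple e)) y" using reals_Archimedean2 by blast
      obtain n where n: "n \<ge> n0" "f n = f m" using m by (auto simp: infinite_nat_iff_unbounded_le)
      have "real n > pair (f m (simple e)) x / - pair (f m (simple e)) y" using n0 n by linarith
      then have "pair (f m (simple e)) x < real n * - pair (f m (simple e)) y" using neg by (subst (asm) pos_divide_less_eq) auto
      then show False using f(2)[OF e, of n] n(2) by (simp add: add)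
    qed
    then show ?thesis using f(1) by blast
  qed
  \<comment> \<open>With \<open>w'\<close> the inverse of \<open>w\<close>, the value of
    \<open>v\<close> at \<open>y\<close> is a sum of nonnegative numbers with weights
    \<open>w' v e\<close>, which are at least \<open>v e\<close> and hence positive. If it is zero,
    \<open>y\<close> vanishes on the basis \<open>w (simple e)\<close>.\<close>
  have nn: "pair v y \<ge> 0 \<and> (pair v y = 0 \<longrightarrow> (\<forall>i\<in>N. y i = 0))"
    if w: "w \<in> W" "\<And>e. e \<in> N \<Longrightarrow> pair (w (simple e)) y \<ge> 0" for w y
  proof -
    obtain w' where w': "w' \<in> W" "\<And>c. w (w' c) = c" using W_inverse[OF w(1)] by blast
    have "w' v e \<ge> v e" for e using W_increasing[OF w'(1) v(3)] .
    then have pos: "w' v e > 0" if "e \<in> N" for e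
      using v(1)[OF that] \<open>\<And>e. w' v e \<ge> v e\<close>[of e] by linarith
    have eq: "pair v y = (\<Sum>e\<in>N. w' v e * pair (w (simple e)) y)"
      using pair_expand[OF w(1) supp_W[OF w'(1) v(2)], of y] w'(2) by simp
    have terms: "w' v e * pair (w (simple e)) y \<ge> 0" if "e \<in> N" for e
      using pos[OF that] w(2)[OF that] by simp
    have "y i = 0" if 0: "pair v y = 0" and i: "i \<in> N" for i
    proof -
      have "\<forall>e\<in>N. w' v e * pair (w (simple e)) y = 0"
      proof -
        have "(\<Sum>e\<in>N. w' v e * pair (w (simple e)) y) = 0" using 0 eq by argo
        then show ?thesis by (subst (asm) sum_nonneg_eq_0_iff) (use finite_N terms in blast)+
      qed
      then have "\<forall>e\<in>N. pair (w (simple e)) y = 0" using pos by (metis less_irrefl mult_eq_0_iff)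
      then have "pair (w (w' (simple i))) y = 0"
        using pair_expand[OF w(1) supp_W[OF w'(1) supp_simple[OF i]], of y] by simp
      then show ?thesis using w'(2) sum_simple[OF i] by (simp add: pair_def)
    qed
    moreover have "pair v y \<ge> 0" unfolding eq using terms by (rule sum_nonneg)
    ultimately show ?thesis by blast
  qed
  have neg: "pair c (\<lambda>i. - l i) = - pair c l" for c by (simp add: pair_def sum_negf)
  obtain w where "w \<in> S" "\<And>e. e \<in> N \<Longrightarrow> pair (w (simple e)) l \<ge> 0" using dir[OF l(2)] by blast
  then have 1: "pair v l \<ge> 0 \<and> (pair v l = 0 \<longrightarrow> (\<forall>i\<in>N. l i = 0))" using nn S by blast
  obtain w' where "w' \<in> S" "\<And>e. e \<in> N \<Longrightarrow> pair (w' (simple e)) (\<lambda>i. - l i) \<ge> 0"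
    using dir[of "\<lambda>i. - l i"] l(2) neg by force
  then have "pair v (\<lambda>i. - l i) \<ge> 0" using nn S by blast
  then show False using 1 l(1) neg by force
qed

end

section \<open>Polyhedral cones and their normals\<close>

lemma dim_hyperplane_pair:
  fixes a b :: "'v::euclidean_space"
  assumes "a \<noteq> 0" "b \<notin> span {a}"
  shows "dim {x. a \<bullet> x = 0 \<and> b \<bullet> x = 0} = DIM('v) - 2"
proof -
  have ind: "independent {b, a}" using assms by (subst independent_insert) (auto simp: independent_insert dependent_single)
  have ne: "a \<noteq> b" using assms by (auto simp: span_base)
  have "dim (span {a, b}) = 2"
    using ind ne by (simp add: insert_commute dim_eq_card_independent)
  moreover have "{y \<in> UNIV. \<forall>x\<in>span {a, b}. orthogonal x y} = {x. a \<bullet> x = 0 \<and> b \<bullet> x = 0}"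
  proof (intro set_eqI iffI)
    fix y assume "y \<in> {y \<in> UNIV. \<forall>x\<in>span {a, b}. orthogonal x y}"
    then show "y \<in> {x. a \<bullet> x = 0 \<and> b \<bullet> x = 0}" by (auto simp: orthogonal_def span_base)
  next
    fix y assume y: "y \<in> {x. a \<bullet> x = 0 \<and> b \<bullet> x = 0}"
    have "orthogonal x y" if "x \<in> span {a, b}" for x
      using orthogonal_to_span[OF that, of y] y by (auto simp: orthogonal_def inner_commute)
    then show "y \<in> {y \<in> UNIV. \<forall>x\<in>span {a, b}. orthogonal x y}" by blast
  qed
  ultimately show ?thesis
    using dim_subspace_orthogonal_to_vectors[of "span {a, b}" UNIV] by simp
qed

text \<open>A sum over a basis taken from \<open>T\<close> serves as a relative interior point.\<close>

lemma spanning_point: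
  fixes T :: "'v::euclidean_space set"
  assumes "T \<noteq> {}" "\<And>x y. x \<in> T \<Longrightarrow> y \<in> T \<Longrightarrow> x + y \<in> T"
  shows "\<exists>z\<in>T. \<forall>a. (\<forall>p\<in>T. a \<bullet> p \<le> 0) \<longrightarrow> a \<bullet> z = 0 \<longrightarrow> (\<forall>p\<in>T. a \<bullet> p = 0)"
proof -
  obtain b where b: "b \<subseteq> T" "independent b" "T \<subseteq> span b" by (meson basis_exists)
  have fb: "finite b" using b(2) by (simp add: independent_imp_finite)
  show ?thesis
  proof (cases "b = {}")
    case True
    then have "T = {0}" using b(3) assms(1) by auto
    then show ?thesis by auto
  next
    case False
    have "\<Sum>c \<in> T" if "finite c" "c \<noteq> {}" "c \<subseteq> b" for c
      using that
    proof (induction c rule: finite_ne_induct)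
      case (insert x F)
      then show ?case using assms(2) b(1) by auto
    qed (use b in auto)
    then have z: "\<Sum>b \<in> T" using fb False by blast
    have "\<forall>p\<in>T. a \<bullet> p = 0" if a: "\<forall>p\<in>T. a \<bullet> p \<le> 0" "a \<bullet> \<Sum>b = 0" for a
    proof -
      have "(\<Sum>p\<in>b. - (a \<bullet> p)) = 0" using a(2) by (simp add: inner_sum_right sum_negf)
      moreover have "0 \<le> - (a \<bullet> p)" if "p \<in> b" for p using a(1) b(1) that by auto
      ultimately have "\<forall>p\<in>b. - (a \<bullet> p) = 0"
        using sum_nonneg_eq_0_iff[OF fb, of "\<lambda>p. - (a \<bullet> p)"] by fast
      then have "orthogonal a p" if "p \<in> span b" for p
        by (intro orthogonal_to_span[OF that]) (simp add: orthogonal_def)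
      then show ?thesis using b(3) by (auto simp: orthogonal_def)
    qed
    then show ?thesis using z by blast
  qed
qed

lemma subspace_cover:
  fixes C :: "'v::euclidean_space set"
  assumes "finite A" "\<And>V. V \<in> A \<Longrightarrow> subspace V" "C \<noteq> {}" "C \<subseteq> \<Union>A"
    and C: "\<And>x y r. x \<in> C \<Longrightarrow> y \<in> C \<Longrightarrow> r > 0 \<Longrightarrow> x + r *\<^sub>R y \<in> C"
  shows "\<exists>V\<in>A. C \<subseteq> V"
  using assms(1,2,4)
proof (induction A rule: finite_induct)
  case empty
  then show ?case using assms(3) by simp
next
  case (insert V A)
  show ?case
  proof (cases "C \<subseteq> V")
    case False
    then obtain a where a: "a \<in> C" "a \<notin> V" by blast
    have sV: "subspace V" using insert by simp
    have "b \<in> \<Union>A" if b: "b \<in> C" for b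
    proof -
      define f where "f n = a + real (Suc n) *\<^sub>R b" for n
      have fC: "f n \<in> C" for n unfolding f_def using C a b by simp
      have one: "m = n" if "f m \<in> V" "f n \<in> V" for m n
      proof (rule ccontr)
        assume "m \<noteq> n"
        have "real (Suc m) *\<^sub>R f n - real (Suc n) *\<^sub>R f m \<in> V"
          using that sV by (intro subspace_diff subspace_scale)
        moreover have "real (Suc m) *\<^sub>R f n - real (Suc n) *\<^sub>R f m = (real m - real n) *\<^sub>R a"
          by (simp add: f_def algebra_simps)
        ultimately have "(1 / (real m - real n)) *\<^sub>R ((real m - real n) *\<^sub>R a) \<in> V"
          using sV by (metis subspace_scale)
        then show False using a(2) \<open>m \<noteq> n\<close> by simp
      qed
      have "finite {n. f n \<in> V}"
      proof (cases "\<exists>m. f m \<in> V")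
        case True
        then obtain m where "f m \<in> V" by blast
        then have "{n. f n \<in> V} \<subseteq> {m}" using one by blast
        then show ?thesis by (rule finite_subset) simp
      qed simp
      then have inf: "infinite (UNIV - {n. f n \<in> V})" by (rule Diff_infinite_finite) simp
      have "\<forall>n\<in>UNIV - {n. f n \<in> V}. \<exists>U\<in>A. f n \<in> U" using fC insert.prems(2) by blast
      from pigeonhole_infinite_rel[OF inf insert.hyps(1) this] obtain U where
        U: "U \<in> A" "infinite {n \<in> UNIV - {n. f n \<in> V}. f n \<in> U}" by blast
      obtain m where m: "f m \<in> U" using U(2) not_finite_existsD by fastforce
      obtain n where n: "f n \<in> U" "n > m" using U(2) unfolding infinite_nat_iff_unbounded by blast
      have sU: "subspace U" using insert.prems U by blast
      have "f n - f m \<in> U" using n m sU by (intro subspace_diff)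
      moreover have "f n - f m = (real n - real m) *\<^sub>R b" by (simp add: f_def algebra_simps)
      ultimately have "(1 / (real n - real m)) *\<^sub>R ((real n - real m) *\<^sub>R b) \<in> U"
        using sU by (metis subspace_scale)
      then show ?thesis using n U(1) by auto
    qed
    then show ?thesis using insert by blast
  qed blast
qed

text \<open>A finitely generated convex cone is closed, so a point outside it is strictly separated
  from it, and the separating functional violates the assumption.\<close>

lemma farkas:
  fixes p :: "'v::euclidean_space"
  assumes N: "finite N" and p: "\<And>x. (\<And>a. a \<in> N \<Longrightarrow> a \<bullet> x \<le> 0) \<Longrightarrow> p \<bullet> x \<le> 0"
  shows "\<exists>c. (\<forall>a\<in>N. c a \<ge> 0) \<and> p = (\<Sum>a\<in>N. c a *\<^sub>R a)"
proof -
  define K where "K = {(\<Sum>a\<in>N. c a *\<^sub>R a) | c. \<forall>a\<in>N. c a \<ge> (0::real)}"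
  have sub: "convex_cone hull N \<subseteq> K"
  proof (rule hull_minimal)
    show "N \<subseteq> K"
    proof
      fix b assume b: "b \<in> N"
      have "(\<Sum>a\<in>N. (if a = b then 1 else 0) *\<^sub>R a) = (\<Sum>a\<in>N. if a = b then a else 0)"
        by (intro sum.cong) auto
      also have "\<dots> = b" using N b by simp
      finally show "b \<in> K" unfolding K_def by (force intro!: exI[of _ "\<lambda>a. if a = b then 1 else 0"])
    qed
    show "convex_cone K"
      unfolding convex_cone_iff
    proof (intro conjI allI impI ballI)
      show "0 \<in> K" unfolding K_def by (force intro!: exI[of _ "\<lambda>_. 0"])
    next
      fix x y assume "x \<in> K" "y \<in> K"
      then obtain c d where "\<forall>a\<in>N. c a \<ge> 0" "x = (\<Sum>a\<in>N. c a *\<^sub>R a)" "\<forall>a\<in>N. d a \<ge> 0" "y = (\<Sum>a\<in>N. d a *\<^sub>R a)"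
        unfolding K_def by blast
      then have "x + y = (\<Sum>a\<in>N. (c a + d a) *\<^sub>R a)" "\<forall>a\<in>N. c a + d a \<ge> 0"
        by (auto simp: scaleR_add_left sum.distrib)
      then show "x + y \<in> K" unfolding K_def mem_Collect_eq by (intro exI[of _ "\<lambda>a. c a + d a"] conjI)
    next
      fix x and r :: real assume "x \<in> K" "0 \<le> r"
      then obtain c where "\<forall>a\<in>N. c a \<ge> 0" "x = (\<Sum>a\<in>N. c a *\<^sub>R a)" unfolding K_def by blast
      then have "r *\<^sub>R x = (\<Sum>a\<in>N. (r * c a) *\<^sub>R a)" "\<forall>a\<in>N. r * c a \<ge> 0"
        using \<open>0 \<le> r\<close> by (auto simp: scaleR_sum_right)
      then show "r *\<^sub>R x \<in> K" unfolding K_def mem_Collect_eq by (intro exI[of _ "\<lambda>a. r * c a"] conjI)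
    qed
  qed
  have "p \<in> convex_cone hull N"
  proof (rule ccontr)
    assume "p \<notin> convex_cone hull N"
    then obtain x b where x: "x \<bullet> p < b" "\<And>y. y \<in> convex_cone hull N \<Longrightarrow> b < x \<bullet> y"
      using separating_hyperplane_closed_point[OF convex_convex_cone_hull closed_convex_cone_hull[OF N]] by blast
    have "b < 0" using x(2)[OF convex_cone_hull_contains_0] by simp
    have "a \<bullet> (- x) \<le> 0" if "a \<in> N" for a
    proof (rule ccontr)
      assume "\<not> ?thesis"
      then have neg: "x \<bullet> a < 0" by (simp add: inner_commute)
      \<comment> \<open>The multiple of \<open>a\<close> on which the functional takes exactly the
        excluded value \<open>b\<close>.\<close>
      have "b < x \<bullet> ((b / (x \<bullet> a)) *\<^sub>R a)"
        using neg \<open>b < 0\<close> that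
        by (intro x(2) convex_cone_hull_mul hull_inc) (auto simp: divide_nonpos_neg)
      then show False using neg by simp
    qed
    then have "p \<bullet> (- x) \<le> 0" by (rule p)
    then show False using x(1) \<open>b < 0\<close> by (simp add: inner_commute)
  qed
  then show ?thesis using sub unfolding K_def by blast
qed

text \<open>By compactness of the unit vectors in the dual cone, strictness leaves room to subtract
  a small multiple of the sum of all normals before applying \<open>farkas\<close>. Adding it back
  makes every coefficient positive.\<close>

lemma farkas_strict:
  fixes p :: "'v::euclidean_space"
  assumes N: "finite N" and p: "\<And>x. x \<noteq> 0 \<Longrightarrow> (\<And>a. a \<in> N \<Longrightarrow> a \<bullet> x \<le> 0) \<Longrightarrow> p \<bullet> x < 0"
  shows "\<exists>c. (\<forall>a\<in>N. c a > 0) \<and> p = (\<Sum>a\<in>N. c a *\<^sub>R a)"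
proof -
  define K where "K = sphere 0 1 \<inter> (\<Inter>a\<in>N. {x. a \<bullet> x \<le> 0})"
  have cK: "compact K" unfolding K_def by (intro compact_Int_closed closed_INT) (auto simp: closed_halfspace_le)
  obtain \<eta> where \<eta>: "\<eta> > 0" "\<And>x. x \<in> K \<Longrightarrow> p \<bullet> x \<le> - \<eta>"
  proof (cases "K = {}")
    case True
    then show ?thesis using that[of 1] by simp
  next
    case False
    have "continuous_on K (\<lambda>x. p \<bullet> x)" by (intro continuous_intros)
    from continuous_attains_sup[OF cK False this] obtain z
      where z: "z \<in> K" "\<And>x. x \<in> K \<Longrightarrow> p \<bullet> x \<le> p \<bullet> z" by blast
    have "p \<bullet> z < 0" using z(1) by (intro p) (auto simp: K_def)
    then show ?thesis using that[of "- (p \<bullet> z)"] z(2) by simp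
  qed
  define \<sigma> where "\<sigma> = \<Sum>N"
  \<comment> \<open>The summand 1 guards against \<open>\<sigma> = 0\<close>.\<close>
  define \<epsilon> where "\<epsilon> = \<eta> / (norm \<sigma> + 1)"
  have "norm \<sigma> + 1 > 0" by (simp add: add_nonneg_pos)
  then have \<epsilon>: "\<epsilon> > 0" "\<epsilon> * norm \<sigma> \<le> \<eta>" using \<eta>(1) by (simp_all add: \<epsilon>_def field_simps)
  have "(p - \<epsilon> *\<^sub>R \<sigma>) \<bullet> x \<le> 0" if x: "\<And>a. a \<in> N \<Longrightarrow> a \<bullet> x \<le> 0" for x
  proof (cases "x = 0")
    case False
    define y where "y = (1 / norm x) *\<^sub>R x"
    have ny: "norm y = 1" using False by (simp add: y_def)
    have "y \<in> K" unfolding K_def using ny x by (auto simp: y_def divide_nonpos_nonneg)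
    then have "p \<bullet> y \<le> - \<eta>" by (rule \<eta>(2))
    moreover have "- (\<epsilon> *\<^sub>R \<sigma>) \<bullet> y \<le> \<eta>"
      using norm_cauchy_schwarz[of "- (\<epsilon> *\<^sub>R \<sigma>)" y] ny \<epsilon> by simp
    ultimately have "(p - \<epsilon> *\<^sub>R \<sigma>) \<bullet> y \<le> 0" by (simp add: inner_diff_left)
    moreover have "(p - \<epsilon> *\<^sub>R \<sigma>) \<bullet> x = norm x * ((p - \<epsilon> *\<^sub>R \<sigma>) \<bullet> y)" using False by (simp add: y_def)
    ultimately show ?thesis by (simp add: mult_nonneg_nonpos)
  qed simp
  from farkas[OF N this] obtain c where c: "\<forall>a\<in>N. c a \<ge> 0" "p - \<epsilon> *\<^sub>R \<sigma> = (\<Sum>a\<in>N. c a *\<^sub>R a)" by blast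
  have "p = (\<Sum>a\<in>N. (c a + \<epsilon>) *\<^sub>R a)"
    using c(2) by (simp add: \<sigma>_def scaleR_add_left sum.distrib scaleR_sum_right algebra_simps)
  moreover have "\<forall>a\<in>N. c a + \<epsilon> > 0" using c(1) \<epsilon>(1) by (simp add: add_nonneg_pos)
  ultimately show ?thesis by (intro exI[of _ "\<lambda>a. c a + \<epsilon>"] conjI)
qed

text \<open>
  Euclidean space (\<open>k = 0\<close>) and hyperbolic space (\<open>k = 1\<close>) are treated together: a set of points is
  replaced by the cone over it in \<open>'a \<times> real\<close>, and a half-space by a vector \<open>a\<close> acting as the
  functional \<open>p \<mapsto> a \<bullet> p\<close>.  The form \<open>B\<close> lives on functionals and \<open>sh\<close> turns
  them into vectors; dimensions exceed the geometric ones by one.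
\<close>

locale model =
  fixes k :: real
  assumes k01: "k = 0 \<or> k = 1"
begin

text \<open>The open upper half-space for \<open>k = 0\<close> and the open future light cone for
  \<open>k = 1\<close>.\<close>

definition ocone :: "('a::euclidean_space \<times> real) set" where
  "ocone = {p. 0 < snd p \<and> k * norm (fst p) < snd p}"

definition B :: "'a::euclidean_space \<times> real \<Rightarrow> 'a \<times> real \<Rightarrow> real" where
  "B a b = fst a \<bullet> fst b - k * (snd a * snd b)"

definition sh :: "'a::euclidean_space \<times> real \<Rightarrow> 'a \<times> real" where
  "sh a = (fst a, - k * snd a)"

definition refl :: "'a::euclidean_space \<times> real \<Rightarrow> 'a \<times> real \<Rightarrow> 'a \<times> real" where
  "refl a p = p - (2 * (a \<bullet> p)) *\<^sub>R sh a"

definition cell :: "('a::euclidean_space \<times> real) set \<Rightarrow> ('a \<times> real) set" where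
  "cell E = {p \<in> ocone. \<forall>a\<in>E. a \<bullet> p \<le> 0}"

definition poly :: "('a::euclidean_space \<times> real) set \<Rightarrow> bool" where
  "poly T \<longleftrightarrow> (\<exists>E. finite E \<and> (\<forall>a\<in>E. B a a = 1) \<and> T = cell E) \<and> dim T = DIM('a \<times> real)"

definition face :: "('a::euclidean_space \<times> real) set \<Rightarrow> 'a \<times> real \<Rightarrow> ('a \<times> real) set" where
  "face T a = {p \<in> T. a \<bullet> p = 0}"

text \<open>Facets are counted through their unit outward normals, since in a full-dimensional cell
  a facet determines its normal.\<close>

definition nrm :: "('a::euclidean_space \<times> real) set \<Rightarrow> ('a \<times> real) set" where
  "nrm T = {a. B a a = 1 \<and> (\<forall>p\<in>T. a \<bullet> p \<le> 0) \<and> dim (face T a) = DIM('a \<times> real) - 1}"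

lemma ocone_add: "p \<in> ocone \<Longrightarrow> q \<in> ocone \<Longrightarrow> p + q \<in> ocone"
  unfolding ocone_def using k01 norm_triangle_ineq[of "fst p" "fst q"] by auto

lemma ocone_scale: "p \<in> ocone \<Longrightarrow> r > 0 \<Longrightarrow> r *\<^sub>R p \<in> ocone"
  unfolding ocone_def using k01 by auto

lemma ocone_comb: "p \<in> ocone \<Longrightarrow> q \<in> ocone \<Longrightarrow> r > 0 \<Longrightarrow> t > 0 \<Longrightarrow> r *\<^sub>R p + t *\<^sub>R q \<in> ocone"
  using ocone_add ocone_scale by blast

lemma open_ocone: "open (ocone :: ('a::euclidean_space \<times> real) set)"
proof -
  have "ocone = {p :: 'a \<times> real. 0 < snd p} \<inter> {p. k * norm (fst p) < snd p}" by (auto simp: ocone_def)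
  moreover have "open {p::'a \<times> real. 0 < snd p}" by (intro open_Collect_less continuous_intros)
  moreover have "open {p::'a \<times> real. k * norm (fst p) < snd p}" by (intro open_Collect_less continuous_intros)
  ultimately show ?thesis by auto
qed

lemma B_sym: "B a b = B b a" by (simp add: B_def inner_commute mult.commute)

lemma B_nz: "B a a = 1 \<Longrightarrow> a \<noteq> 0" by (auto simp: B_def)

lemma B_lin: "B (x + y) b = B x b + B y b" "B (r *\<^sub>R x) b = r * B x b"
  "B b (x + y) = B b x + B b y" "B b (r *\<^sub>R x) = r * B b x" "B (- x) b = - B x b" "B b (- x) = - B b x"
  by (simp_all add: B_def algebra_simps)

lemma inner_sh: "a \<bullet> sh b = B a b"
  by (simp add: B_def sh_def inner_prod_def)

lemma inner_refl: "b \<bullet> refl a p = b \<bullet> p - 2 * (a \<bullet> p) * B b a"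
  by (simp add: refl_def inner_diff_right inner_sh)

lemma refl_refl: "B a a = 1 \<Longrightarrow> refl a (refl a p) = p"
  by (simp add: refl_def inner_diff_right inner_sh algebra_simps flip: scaleR_left.add)

section \<open>Facets and normals of a polyhedral cell\<close>

lemma cell_add: "p \<in> cell E \<Longrightarrow> q \<in> cell E \<Longrightarrow> p + q \<in> cell E"
  unfolding cell_def by (auto simp: ocone_add inner_add_right add_nonpos_nonpos)

lemma cell_comb: "p \<in> cell E \<Longrightarrow> q \<in> cell E \<Longrightarrow> r > 0 \<Longrightarrow> t > 0 \<Longrightarrow> r *\<^sub>R p + t *\<^sub>R q \<in> cell E"
  unfolding cell_def
  by (auto simp: ocone_comb inner_add_right add_nonpos_nonpos mult_nonneg_nonpos)

lemma face_cell_add: "p \<in> face (cell E) a \<Longrightarrow> q \<in> face (cell E) a \<Longrightarrow> p + q \<in> face (cell E) a"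
  unfolding face_def by (auto simp: cell_add inner_add_right)

text \<open>Only constraints tight at \<open>x\<close> restrict a small step, and \<open>d\<close>
  is orthogonal to those. Dimensions of faces are computed from the directions obtained in this
  way.\<close>

lemma cell_near:
  assumes "finite E" "x \<in> ocone" "\<And>a. a \<in> E \<Longrightarrow> a \<bullet> x < 0 \<or> a \<bullet> x \<le> 0 \<and> a \<bullet> d = 0"
  shows "\<exists>\<epsilon>>0. x + \<epsilon> *\<^sub>R d \<in> cell E"
proof -
  have lim: "((\<lambda>e. x + e *\<^sub>R d) \<longlongrightarrow> x + 0 *\<^sub>R d) (at_right 0)" by (intro tendsto_intros)
  have oc: "eventually (\<lambda>e. x + e *\<^sub>R d \<in> ocone) (at_right 0)"
    using topological_tendstoD[OF lim open_ocone] assms(2) by simp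
  have ev: "eventually (\<lambda>e. a \<bullet> (x + e *\<^sub>R d) \<le> 0) (at_right 0)" if "a \<in> E" for a
  proof (cases "a \<bullet> x < 0")
    case True
    have "((\<lambda>e. a \<bullet> (x + e *\<^sub>R d)) \<longlongrightarrow> a \<bullet> (x + 0 *\<^sub>R d)) (at_right 0)" by (intro tendsto_intros)
    from order_tendstoD(2)[OF this, of 0] True show ?thesis by (auto elim: eventually_mono)
  next
    case False
    then show ?thesis using assms(3)[OF that] by (auto simp: inner_add_right)
  qed
  have "eventually (\<lambda>e. \<forall>a\<in>E. a \<bullet> (x + e *\<^sub>R d) \<le> 0) (at_right 0)"
    by (intro eventually_ball_finite assms(1) ballI ev)
  moreover have "eventually (\<lambda>e::real. e > 0) (at_right 0)" by (simp add: eventually_at_right_less)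
  ultimately have "eventually (\<lambda>e. x + e *\<^sub>R d \<in> cell E \<and> e > 0) (at_right 0)"
    using oc unfolding cell_def by eventually_elim simp
  then show ?thesis using eventually_happens'[OF trivial_limit_at_right_real] by blast
qed

lemma parallel_normals:
  assumes T: "dim T = DIM('a \<times> real)" "\<And>p. p \<in> T \<Longrightarrow> a \<bullet> p \<le> 0" "\<And>p. p \<in> T \<Longrightarrow> b \<bullet> p \<le> 0"
    and ab: "B a a = 1" "B b b = 1" "b = c *\<^sub>R a"
  shows "a = (b :: 'a::euclidean_space \<times> real)"
proof -
  have "c * c = 1" using ab by (simp add: B_lin)
  then have "c = 1 \<or> c = - 1" by (simp add: square_eq_1_iff)
  moreover have "c \<noteq> - 1"
  proof
    assume "c = - 1"
    then have "T \<subseteq> {p. a \<bullet> p = 0}" using T(2,3) ab(3) by force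
    then have "dim T \<le> DIM('a \<times> real) - 1"
      using dim_subset[of T "{p. a \<bullet> p = 0}"] dim_hyperplane[OF B_nz[OF ab(1)]] by simp
    then show False using T(1) by simp
  qed
  ultimately show ?thesis using ab by simp
qed

lemma hyperplane_parallel:
  fixes a b :: "'v::euclidean_space"
  assumes "a \<noteq> 0" "f \<subseteq> {p. a \<bullet> p = 0}" "f \<subseteq> {p. b \<bullet> p = 0}" "dim f = DIM('v) - 1"
  shows "\<exists>c. b = c *\<^sub>R a"
proof -
  have "span f = {p. a \<bullet> p = 0}"
    using assms by (intro subspace_dim_equal span_minimal subspace_hyperplane) (auto simp: dim_hyperplane)
  moreover have "span f \<subseteq> {p. b \<bullet> p = 0}" using assms by (intro span_minimal subspace_hyperplane)
  ultimately have sub: "b \<bullet> p = 0" if "a \<bullet> p = 0" for p using that by blast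
  define d where "d = b - (b \<bullet> a / (a \<bullet> a)) *\<^sub>R a"
  have "a \<bullet> d = 0" using assms(1) by (simp add: d_def inner_diff_right inner_commute)
  then have "d \<bullet> d = 0" using sub[of d] by (simp add: d_def inner_diff_left)
  then show ?thesis by (auto simp: d_def)
qed

lemma normal_unique:
  assumes T: "dim T = DIM('a \<times> real)" "\<And>p. p \<in> T \<Longrightarrow> a \<bullet> p \<le> 0" "\<And>p. p \<in> T \<Longrightarrow> b \<bullet> p \<le> 0"
    and ab: "B a a = 1" "B b b = 1"
    and f: "f \<subseteq> {p. a \<bullet> p = 0}" "f \<subseteq> {p. b \<bullet> p = 0}" "dim f = DIM('a \<times> real) - 1"
  shows "a = (b :: 'a::euclidean_space \<times> real)"
  using hyperplane_parallel[OF B_nz[OF ab(1)] f] parallel_normals[OF T ab] by blast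

lemma face_dim:
  fixes a :: "'a::euclidean_space \<times> real"
  assumes E: "finite E" "a \<in> E" "a \<noteq> 0"
    and q: "q \<in> ocone" "a \<bullet> q = 0" "\<And>b. b \<in> E \<Longrightarrow> b \<noteq> a \<Longrightarrow> b \<bullet> q < 0"
  shows "dim (face (cell E) a) = DIM('a \<times> real) - 1"
proof -
  have nonpos: "b \<bullet> q < 0 \<or> b \<bullet> q \<le> 0 \<and> b \<bullet> d = 0" if "b \<in> E" "a \<bullet> d = 0" for b d
    using q(2) q(3)[OF that(1)] that(2) by (cases "b = a") auto
  have qc: "q \<in> face (cell E) a" using nonpos[of _ 0] q(1,2) by (force simp: face_def cell_def)
  have "{p. a \<bullet> p = 0} \<subseteq> span (face (cell E) a)"
  proof
    fix d assume d: "d \<in> {p. a \<bullet> p = 0}"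
    obtain e where e: "e > 0" "q + e *\<^sub>R d \<in> cell E" using cell_near[OF E(1) q(1) nonpos] d by blast
    then have "q + e *\<^sub>R d \<in> face (cell E) a" using q d by (auto simp: face_def inner_add_right)
    then have "(1 / e) *\<^sub>R ((q + e *\<^sub>R d) - q) \<in> span (face (cell E) a)"
      using qc by (intro span_scale span_diff span_base)
    then show "d \<in> span (face (cell E) a)" using e by simp
  qed
  then have "DIM('a \<times> real) - 1 \<le> dim (face (cell E) a)"
    using dim_subset dim_hyperplane[OF E(3)] by (metis dim_span)
  moreover have "dim (face (cell E) a) \<le> DIM('a \<times> real) - 1"
    using dim_subset[of "face (cell E) a" "{p. a \<bullet> p = 0}"] dim_hyperplane[OF E(3)]
    by (auto simp: face_def)
  ultimately show ?thesis by simp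
qed

text \<open>A smallest family of half-spaces defining \<open>T\<close> is the set of facet normals.
  Minimality yields for each member a point violating it alone, and from this a point where it alone
  is tight, which makes its face a facet. Conversely, a generic point of a facet is tight for some
  member.\<close>

lemma poly_normals:
  assumes "poly (T :: ('a::euclidean_space \<times> real) set)"
  shows "finite (nrm T)" "T = cell (nrm T)"
    "\<exists>p\<in>T. \<forall>a\<in>nrm T. a \<bullet> p < 0"
    "a \<in> nrm T \<Longrightarrow> \<exists>q\<in>T. a \<bullet> q = 0 \<and> (\<forall>b\<in>nrm T. b \<noteq> a \<longrightarrow> b \<bullet> q < 0)"
proof -
  have dT: "dim T = DIM('a \<times> real)" using assms by (simp add: poly_def)
  define Q where "Q = (\<lambda>E. finite E \<and> (\<forall>a\<in>E. B a a = 1) \<and> T = cell E)"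
  have "\<exists>E. Q E" using assms by (auto simp: poly_def Q_def)
  then obtain E where E: "Q E" "\<And>E'. Q E' \<Longrightarrow> card E \<le> card E'"
    using ex_has_least_nat[of Q _ card] by blast
  have fE: "finite E" and uE: "\<And>a. a \<in> E \<Longrightarrow> B a a = 1" and TE: "T = cell E" using E(1) by (auto simp: Q_def)
  have EnT: "a \<bullet> p \<le> 0" if "a \<in> E" "p \<in> T" for a p using that TE by (simp add: cell_def)
  have "T \<noteq> {}" using dT by auto
  then obtain p where p: "p \<in> T" "\<And>a. \<forall>p\<in>T. a \<bullet> p \<le> 0 \<Longrightarrow> a \<bullet> p = 0 \<Longrightarrow> \<forall>p\<in>T. a \<bullet> p = 0"
    using spanning_point[of T] cell_add TE by metis
  have po: "p \<in> ocone" using p(1) TE by (simp add: cell_def)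
  have pneg: "a \<bullet> p < 0" if "a \<in> E" for a
  proof (rule ccontr)
    assume "\<not> ?thesis"
    then have "a \<bullet> p = 0" using EnT[OF that p(1)] by simp
    then have "T \<subseteq> {p. a \<bullet> p = 0}" using p(2) EnT[OF that] by blast
    then have "dim T \<le> DIM('a \<times> real) - 1"
      using dim_subset[of T "{p. a \<bullet> p = 0}"] dim_hyperplane[OF B_nz[OF uE[OF that]]] by simp
    then show False using dT by simp
  qed
  have q: "\<exists>q\<in>T. a \<bullet> q = 0 \<and> (\<forall>b\<in>E. b \<noteq> a \<longrightarrow> b \<bullet> q < 0)" if a: "a \<in> E" for a
  proof -
    have "card (E - {a}) < card E" using a fE by (metis card_Diff1_less)
    then have "\<not> Q (E - {a})" using E(2)[of "E - {a}"] by linarith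
    then have "T \<noteq> cell (E - {a})" using fE uE by (auto simp: Q_def)
    moreover have "T \<subseteq> cell (E - {a})" using TE by (auto simp: cell_def)
    ultimately obtain x where xc: "x \<in> cell (E - {a})" "x \<notin> T" by blast
    then have x: "x \<in> ocone" "\<And>b. b \<in> E - {a} \<Longrightarrow> b \<bullet> x \<le> 0" by (auto simp: cell_def)
    have "\<exists>b\<in>E. b \<bullet> x > 0" using xc(2) x(1) unfolding TE cell_def by force
    then have x3: "a \<bullet> x > 0" using x(2) by fastforce
    \<comment> \<open>A positive multiple of the point where the segment from \<open>p\<close> to
      \<open>x\<close> crosses the hyperplane of \<open>a\<close>.\<close>
    define q where "q = (a \<bullet> x) *\<^sub>R p + (- (a \<bullet> p)) *\<^sub>R x"
    have aq: "a \<bullet> q = 0" by (simp add: q_def inner_diff_right)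
    have bq: "b \<bullet> q < 0" if "b \<in> E" "b \<noteq> a" for b
    proof -
      have "(a \<bullet> x) * (b \<bullet> p) < 0" using x3 pneg[OF that(1)] by (rule mult_pos_neg)
      moreover have "- (a \<bullet> p) * (b \<bullet> x) \<le> 0" using pneg[OF a] x(2) that by (intro mult_nonneg_nonpos) auto
      ultimately show ?thesis by (simp add: q_def inner_diff_right)
    qed
    have "q \<in> ocone" unfolding q_def
      by (rule ocone_comb[OF po x(1)]) (use x3 pneg[OF a] in auto)
    moreover have "b \<bullet> q \<le> 0" if "b \<in> E" for b using aq bq[OF that] by (cases "b = a") auto
    ultimately have "q \<in> T" unfolding TE cell_def by blast
    then show ?thesis using aq bq by blast
  qed
  have "nrm T = E"
  proof (intro equalityI subsetI)
    fix a assume a: "a \<in> E"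
    then obtain q where q: "q \<in> T" "a \<bullet> q = 0" "\<And>b. b \<in> E \<Longrightarrow> b \<noteq> a \<Longrightarrow> b \<bullet> q < 0" using q by blast
    have "q \<in> ocone" using q(1) TE by (simp add: cell_def)
    from face_dim[OF fE a B_nz[OF uE[OF a]] this q(2,3)] have "dim (face T a) = DIM('a \<times> real) - 1"
      unfolding TE .
    then show "a \<in> nrm T" using uE[OF a] EnT[OF a] by (simp add: nrm_def)
  next
    fix a assume a: "a \<in> nrm T"
    then have a': "B a a = 1" "\<And>p. p \<in> T \<Longrightarrow> a \<bullet> p \<le> 0" "dim (face T a) = DIM('a \<times> real) - 1"
      by (auto simp: nrm_def)
    have "face T a \<noteq> {}" using a'(3) DIM_positive[where 'a='a] by auto
    then obtain z where z: "z \<in> face T a"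
      "\<And>b. \<forall>p\<in>face T a. b \<bullet> p \<le> 0 \<Longrightarrow> b \<bullet> z = 0 \<Longrightarrow> \<forall>p\<in>face T a. b \<bullet> p = 0"
      using spanning_point[of "face T a"] face_cell_add TE by metis
    have zo: "z \<in> ocone" "z \<in> T" "a \<bullet> z = 0" using z(1) TE by (auto simp: face_def cell_def)
    \<comment> \<open>Otherwise a small step from \<open>z\<close> along \<open>a\<close> would stay
      in \<open>T\<close> and make \<open>a\<close> positive.\<close>
    have "\<exists>b\<in>E. b \<bullet> z = 0"
    proof (rule ccontr)
      assume "\<not> ?thesis"
      then have "b \<bullet> z < 0" if "b \<in> E" for b using EnT[OF that zo(2)] that by force
      then obtain e where e: "e > 0" "z + e *\<^sub>R a \<in> cell E" using cell_near[OF fE zo(1), of a] by blast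
      then have "a \<bullet> (z + e *\<^sub>R a) \<le> 0" using a' TE by blast
      then have "e * (a \<bullet> a) \<le> 0" using zo by (simp add: inner_add_right)
      then have "a \<bullet> a \<le> 0" using e by (simp add: mult_le_0_iff)
      then have "a = 0" using inner_gt_zero_iff[of a] by linarith
      then show False using B_nz[OF a'(1)] by simp
    qed
    then obtain b where b: "b \<in> E" "b \<bullet> z = 0" by blast
    have "\<forall>p\<in>face T a. b \<bullet> p \<le> 0" using EnT[OF b(1)] by (simp add: face_def)
    then have fb: "face T a \<subseteq> {p. b \<bullet> p = 0}" using z(2)[OF _ b(2)] by blast
    have fa: "face T a \<subseteq> {p. a \<bullet> p = 0}" by (auto simp: face_def)
    have "a = b" by (rule normal_unique[OF dT a'(2) EnT[OF b(1)] a'(1) uE[OF b(1)] fa fb a'(3)])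
    then show "a \<in> E" using b by simp
  qed
  then show "finite (nrm T)" "T = cell (nrm T)" "\<exists>p\<in>T. \<forall>a\<in>nrm T. a \<bullet> p < 0"
    "a \<in> nrm T \<Longrightarrow> \<exists>q\<in>T. a \<bullet> q = 0 \<and> (\<forall>b\<in>nrm T. b \<noteq> a \<longrightarrow> b \<bullet> q < 0)"
    using fE TE p(1) pneg q by blast+
qed

section \<open>Reflections and projections of the open cone\<close>

definition Q :: "'a::euclidean_space \<times> real \<Rightarrow> real" where
  "Q p = (snd p)\<^sup>2 - k * (fst p \<bullet> fst p)"

lemma ocone_Q: "p \<in> ocone \<longleftrightarrow> snd p > 0 \<and> Q p > 0"
proof -
  have "norm (fst p) < snd p \<longleftrightarrow> fst p \<bullet> fst p < (snd p)\<^sup>2" if "snd p > 0"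
    using that by (metis abs_of_pos abs_norm_cancel abs_square_less_1 norm_eq_square norm_lt_square power2_norm_eq_inner real_sqrt_abs real_sqrt_less_iff)
  then show ?thesis using k01 by (auto simp: ocone_def Q_def)
qed

lemma Q_shift: "Q (x - sh g) = Q x + 2 * k * (g \<bullet> x) - k * B g g"
  using k01 by (auto simp: Q_def sh_def B_def inner_prod_def algebra_simps power2_eq_square inner_commute)

lemma sh_scale: "sh (r *\<^sub>R g) = r *\<^sub>R sh g" by (simp add: sh_def)

text \<open>\<open>Q\<close> is never positive at height zero, so a segment on which it stays
  positive cannot pass from the upper to the lower half of the cone.\<close>

lemma ocone_path:
  assumes "x \<in> ocone" "\<And>t. 0 \<le> t \<Longrightarrow> t \<le> 1 \<Longrightarrow> Q (x - t *\<^sub>R d) > 0"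
  shows "x - d \<in> ocone"
proof -
  have "Q (x - d) > 0" using assms(2)[of 1] by simp
  moreover have "snd (x - d) > 0"
  proof (rule ccontr)
    assume neg: "\<not> ?thesis"
    have x: "snd x > 0" using assms(1) by (simp add: ocone_def)
    then have d: "snd d > 0" "snd x \<le> snd d" using neg by auto
    define t where "t = snd x / snd d"
    have "Q (x - t *\<^sub>R d) > 0" by (rule assms(2)) (use x d in \<open>auto simp: t_def field_simps\<close>)
    moreover have "snd (x - t *\<^sub>R d) = 0" using d by (simp add: t_def)
    moreover have "k * (fst (x - t *\<^sub>R d) \<bullet> fst (x - t *\<^sub>R d)) \<ge> 0" using k01 by auto
    ultimately show False unfolding Q_def by simp
  qed
  ultimately show ?thesis by (simp add: ocone_Q)
qed

lemma ocone_refl: "B a a = 1 \<Longrightarrow> x \<in> ocone \<Longrightarrow> refl a x \<in> ocone"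
proof -
  assume a: "B a a = 1" and x: "x \<in> ocone"
  have "x - (2 * (a \<bullet> x)) *\<^sub>R sh a \<in> ocone"
  proof (rule ocone_path[OF x])
    fix t :: real assume t: "0 \<le> t" "t \<le> 1"
    have "Q (x - t *\<^sub>R (2 * (a \<bullet> x)) *\<^sub>R sh a) = Q (x - sh ((t * (2 * (a \<bullet> x))) *\<^sub>R a))"
      by (simp add: sh_scale)
    also have "\<dots> = Q x + k * (4 * (a \<bullet> x)\<^sup>2 * (t * (1 - t)))"
      unfolding Q_shift by (simp add: B_lin a algebra_simps power2_eq_square)
    also have "\<dots> > 0"
    proof -
      have "k * (4 * (a \<bullet> x)\<^sup>2 * (t * (1 - t))) \<ge> 0" using t k01 by auto
      moreover have "Q x > 0" using x by (simp add: ocone_Q)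
      ultimately show ?thesis by linarith
    qed
    finally show "Q (x - t *\<^sub>R (2 * (a \<bullet> x)) *\<^sub>R sh a) > 0" .
  qed
  then show ?thesis by (simp add: refl_def)
qed

text \<open>The equation says that \<open>g\<close> vanishes at \<open>x - sh g\<close>, so this is
  a projection of \<open>x\<close>. Since \<open>g\<close> has nonnegative square, \<open>Q\<close>
  does not fall below \<open>Q x\<close> along the way.\<close>

lemma ocone_proj:
  assumes "x \<in> ocone" "g \<bullet> x = B g g" "B g g \<ge> 0"
  shows "x - sh g \<in> ocone"
proof (rule ocone_path[OF assms(1)])
  fix t :: real assume t: "0 \<le> t" "t \<le> 1"
  have "Q (x - t *\<^sub>R sh g) = Q (x - sh (t *\<^sub>R g))" by (simp add: sh_scale)
  also have "\<dots> = Q x + k * (B g g * (t * (2 - t)))"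
    unfolding Q_shift by (simp add: B_lin assms algebra_simps power2_eq_square)
  also have "\<dots> > 0"
  proof -
    have "k * (B g g * (t * (2 - t))) \<ge> 0" using t k01 assms by auto
    moreover have "Q x > 0" using assms by (simp add: ocone_Q)
    ultimately show ?thesis by linarith
  qed
  finally show "Q (x - t *\<^sub>R sh g) > 0" .
qed

lemma inner_minus_sh: "e \<bullet> (x - sh g) = e \<bullet> x - B e g"
  by (simp add: inner_diff_right inner_sh)

lemma nrm_unit: "a \<in> nrm T \<Longrightarrow> B a a = 1" by (simp add: nrm_def)

lemma nrm_le: "a \<in> nrm T \<Longrightarrow> p \<in> T \<Longrightarrow> a \<bullet> p \<le> 0" by (simp add: nrm_def)

lemma nrm_not_parallel:
  assumes "poly T" "a \<in> nrm T" "b \<in> nrm T" "a \<noteq> b"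
  shows "b \<notin> span {a}"
proof
  assume "b \<in> span {a}"
  then obtain c where "b = c *\<^sub>R a" by (auto simp: span_singleton)
  moreover have "dim T = DIM('a \<times> real)" using assms(1) by (simp add: poly_def)
  ultimately have "a = b"
    using parallel_normals[of T a b c] nrm_le[OF assms(2)] nrm_le[OF assms(3)]
      nrm_unit[OF assms(2)] nrm_unit[OF assms(3)] by blast
  then show False using assms(4) by simp
qed

lemma inj_on_face:
  fixes T :: "('a::euclidean_space \<times> real) set"
  assumes "poly T"
  shows "inj_on (face T) (nrm T)"
proof (rule inj_onI)
  fix a b assume ab: "a \<in> nrm T" "b \<in> nrm T" "face T a = face T b"
  then have "face T a \<subseteq> {p. a \<bullet> p = 0}" "face T a \<subseteq> {p. b \<bullet> p = 0}"
    by (auto simp: face_def)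
  then show "a = b" using normal_unique[of T a b "face T a"] assms ab(1,2)
    by (simp add: poly_def nrm_def)
qed

lemma face_pair_dim:
  assumes "poly (T :: ('a::euclidean_space \<times> real) set)" "a \<in> nrm T" "b \<in> nrm T" "a \<noteq> b"
    and "\<And>d. a \<bullet> d = 0 \<Longrightarrow> b \<bullet> d = 0 \<Longrightarrow> d \<in> span (face T a \<inter> face T b)"
  shows "dim (face T a \<inter> face T b) = DIM('a \<times> real) - 2"
proof -
  have *: "dim {x. a \<bullet> x = 0 \<and> b \<bullet> x = 0} = DIM('a \<times> real) - 2"
    by (rule dim_hyperplane_pair[OF B_nz[OF nrm_unit[OF assms(2)]] nrm_not_parallel[OF assms(1-4)]])
  have "dim (face T a \<inter> face T b) \<le> dim {x. a \<bullet> x = 0 \<and> b \<bullet> x = 0}"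
    by (rule dim_subset) (auto simp: face_def)
  moreover have "dim {x. a \<bullet> x = 0 \<and> b \<bullet> x = 0} \<le> dim (span (face T a \<inter> face T b))"
    by (rule dim_subset) (use assms(5) in auto)
  ultimately show ?thesis using * by simp
qed

section \<open>Cells with Coxeter angles: products of their normals\<close>

definition coxeter_angles :: "('a::euclidean_space \<times> real) set \<Rightarrow> bool" where
  "coxeter_angles T \<longleftrightarrow> (\<forall>a\<in>nrm T. \<forall>b\<in>nrm T. a \<noteq> b \<and> face T a \<inter> face T b \<noteq> {} \<and>
     dim (face T a \<inter> face T b) = DIM('a \<times> real) - 2 \<longrightarrow>
     (\<exists>m::nat. m \<ge> 2 \<and> B a b = - cos (pi / real m)))"

lemma cos_pi_div_nonneg: "m \<ge> 2 \<Longrightarrow> cos (pi / real m) \<ge> 0"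
  by (intro cos_ge_zero) (auto simp: field_simps intro: order_trans[of _ 0])

text \<open>A facet is cut out of its hyperplane by the adjacent facets, and these make acute angles with it.\<close>

lemma projection_stays_inside:
  fixes T :: "('a::euclidean_space \<times> real) set"
  assumes T: "poly T" "coxeter_angles T" and a: "a \<in> nrm T" and x: "x \<in> T"
  shows "x - sh ((a \<bullet> x) *\<^sub>R a) \<in> T"
proof (rule ccontr)
  define y where "y = x - sh ((a \<bullet> x) *\<^sub>R a)"
  assume "x - sh ((a \<bullet> x) *\<^sub>R a) \<notin> T"
  then have yT: "y \<notin> T" by (simp add: y_def)
  note fin = poly_normals(1)[OF T(1)] and cell = poly_normals(2)[OF T(1)]
  have aa: "B a a = 1" using a by (rule nrm_unit)
  have xo: "x \<in> ocone" using x cell by (auto simp: cell_def)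
  have yo: "y \<in> ocone" unfolding y_def using xo by (rule ocone_proj) (simp_all add: B_lin aa)
  have ay: "a \<bullet> y = 0" unfolding y_def inner_minus_sh by (simp add: B_lin aa)
  \<comment> \<open>Products with normals of non-adjacent facets are still unknown here. In a
    smallest family \<open>J\<close> cutting the facet out of its hyperplane every member belongs to
    an adjacent facet, so that only the given angles are used.\<close>
  define Z where "Z = (\<lambda>J. J \<subseteq> nrm T - {a} \<and> {p \<in> cell J. a \<bullet> p = 0} = face T a)"
  have "face T a = {p \<in> cell (nrm T - {a}). a \<bullet> p = 0}"
  proof (intro equalityI subsetI)
    fix p assume "p \<in> face T a"
    then have "p \<in> cell (nrm T)" "a \<bullet> p = 0" using cell by (auto simp: face_def)
    then show "p \<in> {p \<in> cell (nrm T - {a}). a \<bullet> p = 0}" by (auto simp: cell_def)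
  next
    fix p assume p: "p \<in> {p \<in> cell (nrm T - {a}). a \<bullet> p = 0}"
    then have "b \<bullet> p \<le> 0" if "b \<in> nrm T" for b using that by (cases "b = a") (auto simp: cell_def)
    then have "p \<in> cell (nrm T)" using p by (auto simp: cell_def)
    then show "p \<in> face T a" using cell p by (auto simp: face_def)
  qed
  then have "Z (nrm T - {a})" by (simp add: Z_def)
  from ex_has_least_nat[of Z _ card, OF this] obtain J where
    J: "Z J" "\<And>J'. Z J' \<Longrightarrow> card J \<le> card J'" by blast
  have JN: "J \<subseteq> nrm T" "a \<notin> J" "finite J" using J(1) fin finite_subset by (auto simp: Z_def)
  have Jf: "p \<in> face T a \<longleftrightarrow> p \<in> cell J \<and> a \<bullet> p = 0" for p using J(1) unfolding Z_def by blast
  have "y \<notin> cell J" using Jf[of y] ay yT by (auto simp: face_def)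
  then obtain j where j: "j \<in> J" "j \<bullet> y > 0" using yo by (force simp: cell_def)
  have "\<not> Z (J - {j})" using J(2)[of "J - {j}"] card_Diff1_less[OF JN(3) j(1)] by linarith
  then have "{p \<in> cell (J - {j}). a \<bullet> p = 0} \<noteq> face T a" using JN J(1) by (auto simp: Z_def)
  moreover have "face T a \<subseteq> {p \<in> cell (J - {j}). a \<bullet> p = 0}" using Jf by (auto simp: cell_def)
  ultimately obtain w where w: "w \<in> cell (J - {j})" "a \<bullet> w = 0" "w \<notin> face T a" by blast
  have wo: "w \<in> ocone" using w by (simp add: cell_def)
  have "\<exists>b\<in>J. b \<bullet> w > 0" using w(2,3) Jf[of w] wo by (force simp: cell_def)
  then have jw: "j \<bullet> w > 0" using w(1) by (force simp: cell_def)
  obtain z where z: "z \<in> T" "a \<bullet> z = 0" "\<And>b. b \<in> nrm T \<Longrightarrow> b \<noteq> a \<Longrightarrow> b \<bullet> z < 0"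
    using poly_normals(4)[OF T(1) a] by blast
  have zo: "z \<in> ocone" using z(1) cell by (auto simp: cell_def)
  have zJ: "b \<bullet> z < 0" if "b \<in> J" for b using that z(3) JN by blast
  \<comment> \<open>Again a crossing point of a segment, now inside the hyperplane of
    \<open>a\<close>. Of the constraints in \<open>J\<close> only \<open>j\<close> is tight there,
    so the facets of \<open>a\<close> and \<open>j\<close> share a face of codimension two.\<close>
  define q where "q = (j \<bullet> w) *\<^sub>R z + (- (j \<bullet> z)) *\<^sub>R w"
  have qo: "q \<in> ocone" unfolding q_def using zJ[OF j(1)] jw by (intro ocone_comb[OF zo wo]) auto
  have iq: "b \<bullet> q = (j \<bullet> w) * (b \<bullet> z) + - (j \<bullet> z) * (b \<bullet> w)" for b
    unfolding q_def by (simp only: inner_add_right inner_scaleR_right)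
  have jq: "j \<bullet> q = 0" "a \<bullet> q = 0" using z(2) w(2) by (simp_all add: iq)
  have bq: "b \<bullet> q < 0" if "b \<in> J" "b \<noteq> j" for b
  proof -
    have "(j \<bullet> w) * (b \<bullet> z) < 0" using jw zJ[OF that(1)] by (rule mult_pos_neg)
    moreover have "b \<bullet> w \<le> 0" using w(1) that by (auto simp: cell_def)
    then have "- (j \<bullet> z) * (b \<bullet> w) \<le> 0" using zJ[OF j(1)] by (intro mult_nonneg_nonpos) auto
    ultimately show ?thesis unfolding iq by linarith
  qed
  have near: "q + 0 *\<^sub>R d \<in> face T a \<inter> face T j \<and> d \<in> span (face T a \<inter> face T j)"
    if d: "a \<bullet> d = 0" "j \<bullet> d = 0" for d
  proof -
    have "b \<bullet> q < 0 \<or> b \<bullet> q \<le> 0 \<and> b \<bullet> d = 0" if "b \<in> J" for b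
      using bq[OF that] jq d by (cases "b = j") auto
    from cell_near[OF JN(3) qo this] obtain e where e: "e > 0" "q + e *\<^sub>R d \<in> cell J" by blast
    have "b \<bullet> q \<le> 0" if "b \<in> J" for b using bq[OF that] jq by (cases "b = j") auto
    then have "q \<in> cell J" using qo by (simp add: cell_def)
    then have "q \<in> face T a" "q + e *\<^sub>R d \<in> face T a"
      unfolding Jf using e jq d by (auto simp: inner_add_right)
    then have qq: "q \<in> face T a \<inter> face T j" "q + e *\<^sub>R d \<in> face T a \<inter> face T j"
      using jq d by (auto simp: face_def inner_add_right)
    then have "(1 / e) *\<^sub>R ((q + e *\<^sub>R d) - q) \<in> span (face T a \<inter> face T j)"
      by (intro span_scale span_diff span_base)
    then show ?thesis using e qq by simp
  qed
  have jN: "j \<in> nrm T" "a \<noteq> j" using j JN by auto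
  have "dim (face T a \<inter> face T j) = DIM('a \<times> real) - 2"
    using near by (intro face_pair_dim[OF T(1) a jN]) blast
  moreover have "face T a \<inter> face T j \<noteq> {}" using near[of 0] by auto
  ultimately obtain m :: nat where m: "m \<ge> 2" "B a j = - cos (pi / real m)"
    using T(2) a jN unfolding coxeter_angles_def by blast
  have "j \<bullet> y = j \<bullet> x - (a \<bullet> x) * B a j" unfolding y_def inner_minus_sh by (simp add: B_lin B_sym)
  moreover have "(a \<bullet> x) * B a j \<ge> 0"
    using nrm_le[OF a x] m cos_pi_div_nonneg[OF m(1)] by (intro mult_nonpos_nonpos) auto
  ultimately show False using j(2) nrm_le[OF jN(1) x] by simp
qed

text \<open>Adjacency is no longer required. Take a point \<open>q\<close> of the facet of
  \<open>b\<close> where only \<open>b\<close> is tight. Its projection to the hyperplane of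
  \<open>a\<close> stays in \<open>T\<close>, and \<open>b\<close> takes there the value
  \<open>- (a \<bullet> q) * B a b\<close>, where \<open>a \<bullet> q < 0\<close>.\<close>

lemma acute:
  assumes T: "poly T" "coxeter_angles T" and ab: "a \<in> nrm T" "b \<in> nrm T" "a \<noteq> b"
  shows "B a b \<le> 0"
proof -
  obtain q where q: "q \<in> T" "b \<bullet> q = 0" "\<And>e. e \<in> nrm T \<Longrightarrow> e \<noteq> b \<Longrightarrow> e \<bullet> q < 0"
    using poly_normals(4)[OF T(1) ab(2)] by blast
  have "b \<bullet> (q - sh ((a \<bullet> q) *\<^sub>R a)) \<le> 0"
    using projection_stays_inside[OF T ab(1) q(1)] nrm_le[OF ab(2)] by blast
  then have "- (a \<bullet> q) * B a b \<le> 0" unfolding inner_minus_sh using q(2) by (simp add: B_lin B_sym)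
  moreover have "a \<bullet> q < 0" using q(3) ab by blast
  ultimately show ?thesis by (simp add: zero_le_mult_iff)
qed

text \<open>If the product exceeds -1, the form is positive definite on the span of \<open>a\<close>
  and \<open>b\<close>, which gives an orthogonal projection to the intersection of their
  hyperplanes. As distinct normals have nonpositive products, it maps \<open>T\<close> into
  \<open>T\<close>. So the two facets are adjacent, and the angle condition applies.\<close>

lemma coxeter_normals:
  fixes T :: "('a::euclidean_space \<times> real) set"
  assumes T: "poly T" "coxeter_angles T" and ab: "a \<in> nrm T" "b \<in> nrm T" "a \<noteq> b"
  shows "(\<exists>m::nat. m \<ge> 2 \<and> B a b = - cos (pi / real m)) \<or> B a b \<le> -1"
proof (cases "B a b \<le> -1")
  case False
  note fin = poly_normals(1)[OF T(1)] and cell = poly_normals(2)[OF T(1)]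
  have unit: "B a a = 1" "B b b = 1" using nrm_unit[OF ab(1)] nrm_unit[OF ab(2)] .
  define \<beta> where "\<beta> = B a b"
  have \<beta>: "\<beta> \<le> 0" "\<beta> > -1" using acute[OF T ab] False by (auto simp: \<beta>_def)
  define \<delta> where "\<delta> = 1 - \<beta>\<^sup>2"
  have \<delta>: "\<delta> > 0" unfolding \<delta>_def using \<beta> by (simp add: abs_square_less_1)
  define ca where "ca x = (a \<bullet> x - \<beta> * (b \<bullet> x)) / \<delta>" for x
  define cb where "cb x = (b \<bullet> x - \<beta> * (a \<bullet> x)) / \<delta>" for x
  \<comment> \<open>The combination of \<open>a\<close> and \<open>b\<close> whose products with
    them are \<open>a \<bullet> x\<close> and \<open>b \<bullet> x\<close>; the coefficients solve a
    Gram system of determinant \<open>\<delta>\<close> and are nonpositive for \<open>x\<close> in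
    \<open>T\<close>.\<close>
  define g where "g x = ca x *\<^sub>R a + cb x *\<^sub>R b" for x
  have Bba: "B b a = \<beta>" "B a b = \<beta>" using B_sym[of a b] by (auto simp: \<beta>_def)
  have solve: "X + \<beta> * Y = p" if "X = (p - \<beta> * q) / \<delta>" "Y = (q - \<beta> * p) / \<delta>" for X Y p q
  proof -
    have "X + \<beta> * Y = ((p - \<beta> * q) + \<beta> * (q - \<beta> * p)) / \<delta>" by (simp add: that add_divide_distrib)
    also have "(p - \<beta> * q) + \<beta> * (q - \<beta> * p) = p * \<delta>" by (simp add: \<delta>_def algebra_simps power2_eq_square)
    finally show ?thesis using \<delta> by simp
  qed
  have Bg: "B a (g x) = a \<bullet> x" "B b (g x) = b \<bullet> x" for x
    using solve[OF ca_def[of x] cb_def[of x]] solve[OF cb_def[of x] ca_def[of x]]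
    by (simp_all add: g_def B_lin unit Bba algebra_simps)
  have Bgg: "B (g x) (g x) = g x \<bullet> x" for x
  proof -
    have "B (g x) (g x) = ca x * B a (g x) + cb x * B b (g x)"
      by (subst (1) g_def) (simp add: B_lin)
    then show ?thesis unfolding Bg by (simp add: g_def inner_add_left)
  qed
  have proj: "x - sh (g x) \<in> face T a \<inter> face T b" if x: "x \<in> T" for x
  proof -
    have xo: "x \<in> ocone" using x cell by (auto simp: cell_def)
    have le: "a \<bullet> x \<le> 0" "b \<bullet> x \<le> 0" using nrm_le[OF ab(1) x] nrm_le[OF ab(2) x] .
    have "\<beta> * (b \<bullet> x) \<ge> 0" "\<beta> * (a \<bullet> x) \<ge> 0" using \<beta> le by (auto intro: mult_nonpos_nonpos)
    then have c: "ca x \<le> 0" "cb x \<le> 0" using \<delta> le by (auto simp: ca_def cb_def divide_le_0_iff)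
    have "g x \<bullet> x = ca x * (a \<bullet> x) + cb x * (b \<bullet> x)" by (simp add: g_def inner_add_left)
    also have "\<dots> \<ge> 0" using c le by (intro add_nonneg_nonneg mult_nonpos_nonpos)
    finally have "B (g x) (g x) \<ge> 0" using Bgg by simp
    then have yo: "x - sh (g x) \<in> ocone" by (intro ocone_proj[OF xo]) (simp_all add: Bgg)
    have y0: "a \<bullet> (x - sh (g x)) = 0" "b \<bullet> (x - sh (g x)) = 0" unfolding inner_minus_sh Bg by simp_all
    have "e \<bullet> (x - sh (g x)) \<le> 0" if e: "e \<in> nrm T" for e
    proof (cases "e = a \<or> e = b")
      case True then show ?thesis using y0 by auto
    next
      case False
      then have "B e a \<le> 0" "B e b \<le> 0" using acute[OF T e ab(1)] acute[OF T e ab(2)] by blast+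
      then have "0 \<le> ca x * B e a" "0 \<le> cb x * B e b" using c by (auto intro: mult_nonpos_nonpos)
      moreover have "e \<bullet> x \<le> 0" using nrm_le[OF e x] .
      ultimately show ?thesis unfolding inner_minus_sh by (simp add: g_def B_lin)
    qed
    then have "x - sh (g x) \<in> T" using yo cell by (auto simp: cell_def)
    then show ?thesis using y0 by (simp add: face_def)
  qed
  obtain p where p: "p \<in> T" "\<And>e. e \<in> nrm T \<Longrightarrow> e \<bullet> p < 0" using poly_normals(3)[OF T(1)] by blast
  have po: "p \<in> ocone" using p cell by (auto simp: cell_def)
  \<comment> \<open>A step along \<open>d\<close> does not change the coefficients of
    \<open>g\<close>, so the projections of its two ends differ by a multiple of
    \<open>d\<close>.\<close>
  have "d \<in> span (face T a \<inter> face T b)" if d: "a \<bullet> d = 0" "b \<bullet> d = 0" for d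
  proof -
    obtain e where e: "e > 0" "p + e *\<^sub>R d \<in> cell (nrm T)" using cell_near[OF fin po, of d] p(2) by blast
    then have "p + e *\<^sub>R d \<in> T" using cell by simp
    from proj[OF this] have "p + e *\<^sub>R d - sh (g p) \<in> face T a \<inter> face T b"
      using d by (simp add: g_def ca_def cb_def inner_add_right)
    moreover have "p - sh (g p) \<in> face T a \<inter> face T b" using proj[OF p(1)] .
    ultimately have "(1 / e) *\<^sub>R ((p + e *\<^sub>R d - sh (g p)) - (p - sh (g p))) \<in> span (face T a \<inter> face T b)"
      by (intro span_scale span_diff span_base)
    then show ?thesis using e by simp
  qed
  then have "dim (face T a \<inter> face T b) = DIM('a \<times> real) - 2" by (intro face_pair_dim[OF T(1) ab]) blast
  moreover have "face T a \<inter> face T b \<noteq> {}" using proj[OF p(1)] by blast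
  ultimately show ?thesis using T(2) ab unfolding coxeter_angles_def by blast
qed blast

section \<open>Crossing a facet of a tile\<close>

lemma B_diff: "B (x - y) b = B x b - B y b"
  by (simp add: B_def algebra_simps)

lemma B_sum:
  fixes b :: "'a::euclidean_space \<times> real"
  shows
  "B (\<Sum>i\<in>I. f i) b = (\<Sum>i\<in>I. B (f i) b)" "B b (\<Sum>i\<in>I. f i) = (\<Sum>i\<in>I. B b (f i))"
proof -
  have 0: "B 0 x = 0" for x :: "'a \<times> real" by (simp add: B_def)
  show "B (\<Sum>i\<in>I. f i) b = (\<Sum>i\<in>I. B (f i) b)" for b
    by (induction I rule: infinite_finite_induct) (simp_all add: B_lin 0)
  then show "B b (\<Sum>i\<in>I. f i) = (\<Sum>i\<in>I. B b (f i))" by (simp add: B_sym[of b])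
qed

lemma strict_interior:
  assumes "poly T" "p \<in> T" "\<And>a. a \<in> nrm T \<Longrightarrow> a \<bullet> p < 0" "u \<noteq> 0" "\<And>x. x \<in> T \<Longrightarrow> u \<bullet> x \<le> 0"
  shows "u \<bullet> p < 0"
proof -
  have "p \<in> ocone" using assms(2) poly_normals(2)[OF assms(1)] by (auto simp: cell_def)
  from cell_near[OF poly_normals(1)[OF assms(1)] this, of u] obtain e where
    e: "e > 0" "p + e *\<^sub>R u \<in> cell (nrm T)" using assms(3) by blast
  then have "p + e *\<^sub>R u \<in> T" using poly_normals(2)[OF assms(1)] by simp
  then have "u \<bullet> (p + e *\<^sub>R u) \<le> 0" by (rule assms(5))
  moreover have "e * (u \<bullet> u) > 0" using e(1) assms(4) by simp
  ultimately show ?thesis by (simp add: inner_add_right)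
qed

text \<open>Arbitrarily close to each point of the facet there are points of the union beyond it, so
  by finiteness the other tiles cover the facet. One of them contains a part of it of full
  dimension, and the facet-to-facet condition makes that tile the mirror image.\<close>

lemma neighbour:
  fixes T :: "('a::euclidean_space \<times> real) set"
  assumes fin: "finite \<Theta>" and polys: "\<And>T. T \<in> \<Theta> \<Longrightarrow> poly T" and P: "poly (\<Union>\<Theta>)"
    and disj: "\<And>S T. S \<in> \<Theta> \<Longrightarrow> T \<in> \<Theta> \<Longrightarrow> S \<noteq> T \<Longrightarrow> dim (S \<inter> T) \<noteq> DIM('a \<times> real)"
    and nb: "\<And>S T. S \<in> \<Theta> \<Longrightarrow> T \<in> \<Theta> \<Longrightarrow> S \<noteq> T \<Longrightarrow> dim (S \<inter> T) = DIM('a \<times> real) - 1 \<Longrightarrow>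
      \<exists>a\<in>nrm S. S \<inter> T = face S a \<and> refl a ` S = T"
    and T: "T \<in> \<Theta>" and a: "a \<in> nrm T" and x: "x \<in> \<Union>\<Theta>" "a \<bullet> x > 0"
  shows "refl a ` T \<in> \<Theta>"
proof -
  note cT = poly_normals(2)[OF polys[OF T]]
  have fdim: "dim (face T a) = DIM('a \<times> real) - 1" using a by (simp add: nrm_def)
  have cover: "\<exists>T'\<in>\<Theta> - {T}. q \<in> T'" if q: "q \<in> face T a" for q
  proof -
    have qT: "q \<in> T" "a \<bullet> q = 0" using q by (auto simp: face_def)
    \<comment> \<open>These points tend to \<open>q\<close> from beyond the facet: they stay in the
      convex cone of the union but not in \<open>T\<close>. A tile containing infinitely many of
      them satisfies its constraints at the limit \<open>q\<close>.\<close>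
    define r where "r n = q + (1 / real (Suc n)) *\<^sub>R x" for n
    have "\<exists>T'\<in>\<Theta> - {T}. r n \<in> T'" for n
    proof -
      have "1 *\<^sub>R q + (1 / real (Suc n)) *\<^sub>R x \<in> cell (nrm (\<Union>\<Theta>))"
        using qT(1) T x(1) poly_normals(2)[OF P] by (intro cell_comb) auto
      then have "r n \<in> \<Union>\<Theta>" using poly_normals(2)[OF P] by (simp add: r_def)
      moreover have "a \<bullet> r n > 0" using x(2) qT(2) by (simp add: r_def inner_add_right)
      then have "r n \<notin> T" using nrm_le[OF a, of "r n"] by auto
      ultimately show ?thesis by blast
    qed
    then have "\<forall>n\<in>UNIV. \<exists>T'\<in>\<Theta> - {T}. r n \<in> T'" by blast
    from pigeonhole_infinite_rel[OF infinite_UNIV_nat _ this] fin obtain T' where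
      T': "T' \<in> \<Theta> - {T}" "infinite {n. r n \<in> T'}" by auto
    have "b \<bullet> q \<le> 0" if b: "b \<in> nrm T'" for b
    proof (rule ccontr)
      assume "\<not> ?thesis"
      then have pos: "b \<bullet> q > 0" by simp
      obtain n0 where n0: "\<bar>b \<bullet> x\<bar> / (b \<bullet> q) < real n0" using reals_Archimedean2 by blast
      obtain n where n: "n > n0" "r n \<in> T'" using T'(2) unfolding infinite_nat_iff_unbounded by auto
      have "\<bar>b \<bullet> x\<bar> / (b \<bullet> q) < real (Suc n)" using n0 n by linarith
      then have "\<bar>b \<bullet> x\<bar> < real (Suc n) * (b \<bullet> q)" using pos by (simp add: pos_divide_less_eq)
      moreover have "b \<bullet> r n \<le> 0" using nrm_le[OF b n(2)] .
      then have "b \<bullet> q + (b \<bullet> x) / real (Suc n) \<le> 0" by (simp add: r_def inner_add_right)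
      then have "real (Suc n) * (b \<bullet> q + (b \<bullet> x) / real (Suc n)) \<le> 0"
        by (intro mult_nonneg_nonpos) auto
      then have "real (Suc n) * (b \<bullet> q) + (b \<bullet> x) \<le> 0" by (simp add: distrib_left del: of_nat_Suc)
      ultimately show False by linarith
    qed
    moreover have "q \<in> ocone" using qT(1) cT by (auto simp: cell_def)
    ultimately have "q \<in> cell (nrm T')" by (simp add: cell_def)
    then show ?thesis using T'(1) poly_normals(2)[OF polys, of T'] by auto
  qed
  have "\<exists>V\<in>(\<lambda>T'. span (face T a \<inter> T')) ` (\<Theta> - {T}). face T a \<subseteq> V"
  proof (rule subspace_cover)
    show "face T a \<noteq> {}" using fdim DIM_positive[where 'a='a] by auto
    show "face T a \<subseteq> \<Union>((\<lambda>T'. span (face T a \<inter> T')) ` (\<Theta> - {T}))"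
    proof
      fix q assume q: "q \<in> face T a"
      obtain T' where "T' \<in> \<Theta> - {T}" "q \<in> T'" using cover[OF q] by blast
      then show "q \<in> \<Union>((\<lambda>T'. span (face T a \<inter> T')) ` (\<Theta> - {T}))" using q by (blast intro: span_base)
    qed
  next
    fix p q and r :: real assume pq: "p \<in> face T a" "q \<in> face T a" "r > 0"
    then have "1 *\<^sub>R p + r *\<^sub>R q \<in> cell (nrm T)"
      using cT by (intro cell_comb) (auto simp: face_def)
    then show "p + r *\<^sub>R q \<in> face T a" using pq cT by (simp add: face_def inner_add_right)
  qed (use fin in auto)
  then obtain T' where T': "T' \<in> \<Theta>" "T' \<noteq> T" "face T a \<subseteq> span (face T a \<inter> T')" by blast
  define g where "g = face T a \<inter> T'"
  have "dim g = DIM('a \<times> real) - 1"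
  proof (rule antisym)
    show "dim g \<le> DIM('a \<times> real) - 1" using dim_subset[of g "face T a"] fdim by (simp add: g_def)
    show "DIM('a \<times> real) - 1 \<le> dim g" using dim_subset[OF T'(3)] fdim by (simp add: g_def)
  qed
  note gdim = this
  have gsub: "g \<subseteq> T \<inter> T'" by (auto simp: g_def face_def)
  have "dim (T \<inter> T') \<le> DIM('a \<times> real)" by (rule dim_subset_UNIV)
  moreover have "DIM('a \<times> real) - 1 \<le> dim (T \<inter> T')" using dim_subset[OF gsub] gdim by simp
  moreover have "dim (T \<inter> T') \<noteq> DIM('a \<times> real)" using disj[OF T T'(1)] T'(2) by blast
  ultimately have "dim (T \<inter> T') = DIM('a \<times> real) - 1" by linarith
  then obtain b where b: "b \<in> nrm T" "T \<inter> T' = face T b" "refl b ` T = T'"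
    using nb[OF T T'(1)] T'(2) by blast
  have "dim T = DIM('a \<times> real)" using polys[OF T] by (simp add: poly_def)
  moreover have "g \<subseteq> {p. a \<bullet> p = 0}" "g \<subseteq> {p. b \<bullet> p = 0}"
    using gsub b(2) by (auto simp: g_def face_def)
  ultimately have "a = b"
    using normal_unique[of T a b g] nrm_le[OF a] nrm_le[OF b(1)] nrm_unit[OF a] nrm_unit[OF b(1)] gdim
    by blast
  then show ?thesis using b(3) T'(1) by simp
qed

end

section \<open>Counting the facets of a tile\<close>

locale decomposition = model +
  fixes \<Theta> :: "('a::euclidean_space \<times> real) set set" and F :: "('a \<times> real) set"
  assumes finite_tiles: "finite \<Theta>" and poly_tiles: "T \<in> \<Theta> \<Longrightarrow> poly T" and poly_union: "poly (\<Union>\<Theta>)"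
    and disjoint: "S \<in> \<Theta> \<Longrightarrow> T \<in> \<Theta> \<Longrightarrow> S \<noteq> T \<Longrightarrow> dim (S \<inter> T) \<noteq> DIM('a \<times> real)"
    and adjacent: "S \<in> \<Theta> \<Longrightarrow> T \<in> \<Theta> \<Longrightarrow> S \<noteq> T \<Longrightarrow> dim (S \<inter> T) = DIM('a \<times> real) - 1 \<Longrightarrow>
      \<exists>a\<in>nrm S. S \<inter> T = face S a \<and> refl a ` S = T"
    and tile: "F \<in> \<Theta>" and angles: "coxeter_angles F"
    and light: "x \<noteq> 0 \<Longrightarrow> (\<And>a. a \<in> nrm F \<Longrightarrow> a \<bullet> x \<le> 0) \<Longrightarrow> snd x > 0 \<and> k * norm (fst x) \<le> snd x"
begin

lemma poly_F: "poly F" using tile poly_tiles by blast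

sublocale cx: coxeter "nrm F" B
proof
  show "finite (nrm F)" by (rule poly_normals(1)[OF poly_F])
  show "B i j = B j i" for i j by (rule B_sym)
  show "i \<in> nrm F \<Longrightarrow> B i i = 1" for i by (rule nrm_unit)
  show "i \<in> nrm F \<Longrightarrow> j \<in> nrm F \<Longrightarrow> i \<noteq> j \<Longrightarrow>
    (\<exists>m::nat. m \<ge> 2 \<and> B i j = - cos (pi / real m)) \<or> B i j \<le> -1" for i j
    by (rule coxeter_normals[OF poly_F angles])
qed

text \<open>Realises a formal combination as a functional. It has a kernel when the normals are
  dependent, so that injectivity on roots and on chambers needs separate arguments.\<close>

definition vec :: "('a \<times> real \<Rightarrow> real) \<Rightarrow> 'a \<times> real" where
  "vec c = (\<Sum>e\<in>nrm F. c e *\<^sub>R e)"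

definition wall :: "(('a \<times> real \<Rightarrow> real) \<Rightarrow> 'a \<times> real \<Rightarrow> real) \<Rightarrow> 'a \<times> real \<Rightarrow> 'a \<times> real" where
  "wall w e = vec (w (cx.simple e))"

definition chamber :: "(('a \<times> real \<Rightarrow> real) \<Rightarrow> 'a \<times> real \<Rightarrow> real) \<Rightarrow> ('a \<times> real) set" where
  "chamber w = cell (wall w ` nrm F)"

lemma vec_comb: "vec (cx.comb a c b d) = a *\<^sub>R vec c + b *\<^sub>R vec d"
  by (simp add: vec_def cx.comb_def scaleR_add_left sum.distrib scaleR_sum_right)

lemma vec_simple: "e \<in> nrm F \<Longrightarrow> vec (cx.simple e) = e"
proof -
  assume e: "e \<in> nrm F"
  have "vec (cx.simple e) = (\<Sum>i\<in>nrm F. if i = e then i else 0)"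
    unfolding vec_def cx.simple_def by (intro sum.cong) auto
  then show ?thesis using e cx.finite_N by simp
qed

lemma B_vec: "B (vec c) e = cx.bf c e"
  unfolding vec_def B_sum cx.bf_def B_lin ..

lemma B_vec_vec: "B (vec c) (vec d) = cx.bb c d"
  by (subst (2) vec_def) (simp add: B_sum B_lin B_vec cx.bb_def)

lemma inner_vec: "vec c \<bullet> p = (\<Sum>e\<in>nrm F. c e * (e \<bullet> p))"
  by (simp add: vec_def inner_sum_left)

text \<open>The dual action on actual points: a letter \<open>e\<close> acts by
  \<open>refl e\<close>, which preserves the open cone.\<close>

lemma W_point:
  assumes "w \<in> cx.W" "p \<in> ocone"
  shows "\<exists>p'\<in>ocone. \<forall>c. vec (w c) \<bullet> p' = vec c \<bullet> p"
proof -
  have "\<exists>p'\<in>ocone. \<forall>c. vec (cx.act xs c) \<bullet> p' = vec c \<bullet> p" if "set xs \<subseteq> nrm F" for xs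
    using that
  proof (induction xs)
    case Nil
    then show ?case using assms(2) by auto
  next
    case (Cons e xs)
    then obtain p' where p': "p' \<in> ocone" "\<And>c. vec (cx.act xs c) \<bullet> p' = vec c \<bullet> p" by auto
    have e: "e \<in> nrm F" "B e e = 1" using Cons.prems nrm_unit[of e F] by auto
    have "vec (cx.s e d) \<bullet> refl e p' = vec d \<bullet> p'" for d
      unfolding cx.s_eq_comb vec_comb vec_simple[OF e(1)]
      by (simp add: inner_refl inner_diff_left B_lin B_diff e(2) B_vec algebra_simps)
    then have "\<forall>c. vec (cx.act (e # xs) c) \<bullet> refl e p' = vec c \<bullet> p" using p'(2) by simp
    then show ?case using ocone_refl[OF e(2) p'(1)] by blast
  qed
  then show ?thesis using assms(1) unfolding cx.W_def by blast
qed

lemma wall_unit: "w \<in> cx.W \<Longrightarrow> e \<in> nrm F \<Longrightarrow> B (wall w e) (wall w e) = 1"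
  unfolding wall_def B_vec_vec using cx.bb_W cx.bb_simple cx.bf_simple cx.B_one by metis

lemma wall_expand:
  assumes "w \<in> cx.W" "cx.supp c"
  shows "vec (w c) \<bullet> p = (\<Sum>e\<in>nrm F. c e * (wall w e \<bullet> p))"
  using cx.pair_expand[OF assms, of "\<lambda>e. e \<bullet> p"]
  unfolding cx.pair_def wall_def inner_vec .

lemma chamber_id: "chamber id = F"
proof -
  have "wall id ` nrm F = nrm F" by (force simp: wall_def vec_simple)
  then show ?thesis unfolding chamber_def using poly_normals(2)[OF poly_F] by simp
qed

text \<open>The reflection in the wall \<open>wall w e\<close> is the conjugate of
  \<open>s e\<close> by \<open>w\<close>. So crossing this wall is multiplication by
  \<open>s e\<close> on the right, the move of the numbers game.\<close>

lemma chamber_reflect: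
  assumes w: "w \<in> cx.W" and e: "e \<in> nrm F"
  shows "refl (wall w e) ` chamber w = chamber (w \<circ> cx.s e)"
proof -
  define a where "a = wall w e"
  have a1: "B a a = 1" unfolding a_def by (rule wall_unit[OF w e])
  have inn: "wall w e' \<bullet> refl a p = wall (w \<circ> cx.s e) e' \<bullet> p" if e': "e' \<in> nrm F" for e' p
  proof -
    have "wall (w \<circ> cx.s e) e' = wall w e' - (2 * B e' e) *\<^sub>R a"
      unfolding wall_def comp_def cx.s_eq_comb cx.W_comb[OF w] vec_comb a_def
      by (simp add: cx.bf_simple e')
    moreover have "B (wall w e') a = B e' e"
      unfolding wall_def a_def B_vec_vec cx.bb_W[OF w] by (simp add: cx.bb_simple cx.bf_simple e e')
    ultimately show ?thesis by (simp add: inner_refl inner_diff_left)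
  qed
  have iff: "refl a p \<in> chamber w \<longleftrightarrow> p \<in> chamber (w \<circ> cx.s e)" for p
  proof -
    have "refl a p \<in> ocone \<longleftrightarrow> p \<in> ocone" using ocone_refl[OF a1] refl_refl[OF a1] by metis
    then show ?thesis by (simp add: chamber_def cell_def inn)
  qed
  show ?thesis unfolding a_def[symmetric]
  proof (intro equalityI subsetI)
    fix p assume "p \<in> refl a ` chamber w"
    then obtain q where "q \<in> chamber w" "p = refl a q" by blast
    then show "p \<in> chamber (w \<circ> cx.s e)" using iff refl_refl[OF a1] by metis
  next
    fix p assume "p \<in> chamber (w \<circ> cx.s e)"
    then have "refl a p \<in> chamber w" "p = refl a (refl a p)" using iff refl_refl[OF a1] by auto
    then show "p \<in> refl a ` chamber w" by blast
  qed
qed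

lemma base_point:
  obtains p where "p \<in> F" "p \<in> ocone" "\<And>e. e \<in> nrm F \<Longrightarrow> e \<bullet> p < 0"
proof -
  obtain p where "p \<in> F" "\<And>e. e \<in> nrm F \<Longrightarrow> e \<bullet> p < 0" using poly_normals(3)[OF poly_F] by blast
  moreover have "p \<in> ocone" using \<open>p \<in> F\<close> poly_normals(2)[OF poly_F] by (auto simp: cell_def)
  ultimately show ?thesis using that by blast
qed

lemma wall_normal:
  assumes w: "w \<in> cx.W" and e: "e \<in> nrm F"
  shows "wall w e \<in> nrm (chamber w)"
proof -
  obtain q where q: "q \<in> F" "e \<bullet> q = 0" "\<And>b. b \<in> nrm F \<Longrightarrow> b \<noteq> e \<Longrightarrow> b \<bullet> q < 0"
    using poly_normals(4)[OF poly_F e] by blast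
  have "q \<in> ocone" using q(1) poly_normals(2)[OF poly_F] by (auto simp: cell_def)
  then obtain q' where q': "q' \<in> ocone" "\<And>c. vec (w c) \<bullet> q' = vec c \<bullet> q" using W_point[OF w] by blast
  have wq: "wall w b \<bullet> q' = b \<bullet> q" if "b \<in> nrm F" for b using that by (simp add: wall_def q'(2) vec_simple)
  have "dim (face (chamber w) (wall w e)) = DIM('a \<times> real) - 1"
    unfolding chamber_def
  proof (rule face_dim[OF _ _ B_nz[OF wall_unit[OF w e]] q'(1)])
    show "wall w e \<bullet> q' = 0" using wq[OF e] q(2) by simp
    fix b assume "b \<in> wall w ` nrm F" "b \<noteq> wall w e"
    then obtain b' where b': "b' \<in> nrm F" "b = wall w b'" "b' \<noteq> e" by blast
    then show "b \<bullet> q' < 0" using wq[OF b'(1)] q(3)[OF b'(1,3)] by simp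
  qed (use e cx.finite_N in auto)
  then show ?thesis unfolding nrm_def using wall_unit[OF w e] e by (auto simp: chamber_def cell_def)
qed

text \<open>If the elements differ, some wall normal of \<open>w'\<close> is a combination of those
  of \<open>w\<close> with nonpositive coefficients. At an interior point of the common chamber its
  value is nonpositive, yet a sum of nonnegative terms. So all coefficients vanish, although the
  normal has norm one.\<close>

lemma chamber_inj:
  assumes w: "w \<in> cx.W" "w' \<in> cx.W" and eq: "chamber w = chamber w'"
  shows "w = w'"
proof (rule ccontr)
  assume "w \<noteq> w'"
  obtain v where v: "v \<in> cx.W" "\<And>c. w (v c) = c" "\<And>c. v (w c) = c" using cx.W_inverse[OF w(1)] by blast
  have "v \<circ> w' \<noteq> id"
  proof
    assume "v \<circ> w' = id"
    then have "w (v (w' c)) = w c" for c by (metis comp_apply id_apply)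
    then show False using v(2) \<open>w \<noteq> w'\<close> by auto
  qed
  then obtain e where e: "e \<in> nrm F" "\<And>i. (v \<circ> w') (cx.simple e) i \<le> 0"
    using cx.W_nontrivial[OF cx.comp_W[OF v(1) w(2)]] by blast
  define c where "c = v (w' (cx.simple e))"
  have c: "w c = w' (cx.simple e)" "cx.supp c" "\<And>i. c i \<le> 0"
    using v(2) e cx.supp_W[OF v(1) cx.supp_W[OF w(2) cx.supp_simple[OF e(1)]]] by (auto simp: c_def)
  obtain p where p: "p \<in> ocone" "\<And>e. e \<in> nrm F \<Longrightarrow> e \<bullet> p < 0" using base_point by blast
  obtain p' where p': "p' \<in> ocone" "\<And>c. vec (w c) \<bullet> p' = vec c \<bullet> p" using W_point[OF w(1) p(1)] by blast
  have neg: "wall w b \<bullet> p' < 0" if "b \<in> nrm F" for b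
    using that p(2) by (simp add: wall_def p'(2) vec_simple)
  have "p' \<in> chamber w" using neg p'(1) by (force simp: chamber_def cell_def)
  then have "wall w' e \<bullet> p' \<le> 0" unfolding eq using e(1) by (simp add: chamber_def cell_def)
  moreover have "wall w' e \<bullet> p' = (\<Sum>b\<in>nrm F. c b * (wall w b \<bullet> p'))"
    using wall_expand[OF w(1) c(2), of p'] by (simp add: wall_def c(1))
  moreover have terms: "c b * (wall w b \<bullet> p') \<ge> 0" if "b \<in> nrm F" for b
    using c(3)[of b] neg[OF that] by (intro mult_nonpos_nonpos) auto
  ultimately have "(\<Sum>b\<in>nrm F. c b * (wall w b \<bullet> p')) = 0"
    using sum_nonneg[of "nrm F" "\<lambda>b. c b * (wall w b \<bullet> p')"] by (metis antisym)
  then have "\<forall>b\<in>nrm F. c b * (wall w b \<bullet> p') = 0"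
    using sum_nonneg_eq_0_iff[OF cx.finite_N, of "\<lambda>b. c b * (wall w b \<bullet> p')"] terms by fast
  then have "\<forall>b\<in>nrm F. c b = 0" using neg by (metis less_irrefl mult_eq_0_iff)
  then have "wall w' e \<bullet> y = 0" for y
    using wall_expand[OF w(1) c(2), of y] by (simp add: wall_def c(1))
  then have "wall w' e = 0" by (metis inner_eq_zero_iff)
  then show False using B_nz[OF wall_unit[OF w(2) e(1)]] by simp
qed

text \<open>After one root is moved to a simple root \<open>e\<close>, the other, \<open>c\<close>,
  represents the same functional. An interior point of \<open>F\<close> shows that \<open>c\<close>
  is positive, and a point of \<open>F\<close> where only \<open>e\<close> is tight kills its other
  coefficients.\<close>

lemma vec_root_inj:
  assumes g: "g \<in> cx.R" "g' \<in> cx.R" and eq: "vec g = vec g'"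
  shows "g = g'"
proof -
  obtain w e where we: "w \<in> cx.W" "e \<in> nrm F" "g = w (cx.simple e)" using g(1) unfolding cx.R_def by blast
  obtain v where v: "v \<in> cx.W" "\<And>c. w (v c) = c" "\<And>c. v (w c) = c" using cx.W_inverse[OF we(1)] by blast
  define c where "c = v g'"
  have wc: "w c = g'" by (simp add: c_def v)
  have cR: "c \<in> cx.R" unfolding c_def by (rule cx.W_root[OF v(1) g(2)])
  have pair: "vec c \<bullet> p = e \<bullet> p" if p: "p \<in> ocone" for p
  proof -
    obtain p' where "\<And>c. vec (w c) \<bullet> p' = vec c \<bullet> p" using W_point[OF we(1) p] by blast
    then show ?thesis using eq we wc by (metis vec_simple)
  qed
  obtain p where p: "p \<in> ocone" "\<And>e. e \<in> nrm F \<Longrightarrow> e \<bullet> p < 0" using base_point by blast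
  have cpos: "\<forall>i. c i \<ge> 0"
  proof (rule ccontr)
    assume "\<not> ?thesis"
    then have "\<forall>i. c i \<le> 0" using cx.root_sign'[OF cR] by blast
    then have "(\<Sum>b\<in>nrm F. c b * (b \<bullet> p)) \<ge> 0"
      using p(2) by (intro sum_nonneg mult_nonpos_nonpos) (auto simp: less_imp_le)
    then show False using pair[OF p(1)] p(2)[OF we(2)] by (simp add: inner_vec)
  qed
  obtain q where q: "q \<in> F" "e \<bullet> q = 0" "\<And>b. b \<in> nrm F \<Longrightarrow> b \<noteq> e \<Longrightarrow> b \<bullet> q < 0"
    using poly_normals(4)[OF poly_F we(2)] by blast
  have "q \<in> ocone" using q(1) poly_normals(2)[OF poly_F] by (auto simp: cell_def)
  then have "(\<Sum>b\<in>nrm F. c b * (b \<bullet> q)) = 0" using pair q(2) by (simp add: inner_vec)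
  then have "(\<Sum>b\<in>nrm F. c b * - (b \<bullet> q)) = 0" by (simp add: sum_negf)
  moreover have "c b * - (b \<bullet> q) \<ge> 0" if "b \<in> nrm F" for b
  proof (rule mult_nonneg_nonneg)
    show "0 \<le> c b" using cpos by blast
    show "0 \<le> - (b \<bullet> q)" using q(2) q(3)[OF that] by (cases "b = e") auto
  qed
  ultimately have "\<forall>b\<in>nrm F. c b * - (b \<bullet> q) = 0"
    using sum_nonneg_eq_0_iff[OF cx.finite_N, of "\<lambda>b. c b * - (b \<bullet> q)"] by fast
  then have "c b = 0" if "b \<in> nrm F" "b \<noteq> e" for b using that q(3)[OF that] by force
  then have "c = cx.simple e" using cx.root_multiple[OF cR we(2)] cpos by blast
  then show ?thesis using we wc by simp
qed

text \<open>
  Finite volume enters only here: it puts the cone over \<open>F\<close> inside the closed light cone, so that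
  the functional dual to an interior point of \<open>F\<close> is a positive combination of all normals.
\<close>

lemma positive_combination:
  "\<exists>c. (\<forall>e\<in>nrm F. c e > 0) \<and> cx.supp c \<and> (\<forall>e\<in>nrm F. cx.bf c e \<le> 0)"
proof -
  obtain p where p: "p \<in> ocone" "\<And>e. e \<in> nrm F \<Longrightarrow> e \<bullet> p < 0" using base_point by blast
  \<comment> \<open>For \<open>k = 0\<close> this is a negative multiple of the height; for
    \<open>k = 1\<close> its negativity on the closed light cone is the reversed Cauchy-Schwarz
    inequality.\<close>
  define d where "d = (k *\<^sub>R fst p, - snd p)"
  have "d \<bullet> x < 0" if x: "x \<noteq> 0" "\<And>a. a \<in> nrm F \<Longrightarrow> a \<bullet> x \<le> 0" for x
  proof -
    have l: "snd x > 0" "k * norm (fst x) \<le> snd x" using light[OF x] by auto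
    have pp: "snd p > 0" "k * norm (fst p) < snd p" using p(1) by (auto simp: ocone_def)
    have "k * (fst p \<bullet> fst x) \<le> (k * norm (fst p)) * (k * norm (fst x))"
      using k01 norm_cauchy_schwarz[of "fst p" "fst x"] by auto
    also have "\<dots> \<le> (k * norm (fst p)) * snd x"
      using l k01 by (intro mult_left_mono) auto
    also have "\<dots> < snd p * snd x" using l pp by (intro mult_strict_right_mono)
    finally show ?thesis by (simp add: d_def inner_prod_def)
  qed
  from farkas_strict[OF cx.finite_N this] obtain c where
    c: "\<forall>e\<in>nrm F. c e > 0" "d = (\<Sum>e\<in>nrm F. c e *\<^sub>R e)" by blast
  define c' where "c' = (\<lambda>e. if e \<in> nrm F then c e else 0)"
  have "vec c' = d" unfolding vec_def c(2) c'_def by (intro sum.cong) auto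
  have "cx.bf c' e \<le> 0" if e: "e \<in> nrm F" for e
  proof -
    \<comment> \<open>In the Euclidean case this is zero: the combination is orthogonal to all
      simple roots.\<close>
    have "cx.bf c' e = k * (e \<bullet> p)"
      unfolding B_vec[symmetric] \<open>vec c' = d\<close>
      by (simp add: B_def d_def inner_prod_def inner_commute algebra_simps)
    then show ?thesis using p(2)[OF e] k01 by auto
  qed
  moreover have "\<forall>e\<in>nrm F. c' e > 0" "cx.supp c'" using c(1) by (auto simp: c'_def cx.supp_def)
  ultimately show ?thesis by blast
qed

text \<open>\<open>M\<close> lies between the two sides: \<open>vec\<close> injects it into the
  normals of the union, and \<open>card_le\<close> bounds the number of normals of \<open>F\<close>
  by its size.\<close>

theorem facet_count: "card (nrm F) \<le> card (nrm (\<Union>\<Theta>))"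
proof -
  define S where "S = {w \<in> cx.W. chamber w \<in> \<Theta>}"
  define M where "M = {w (cx.simple e) | w e. w \<in> S \<and> e \<in> nrm F \<and> (\<forall>x\<in>\<Union>\<Theta>. wall w e \<bullet> x \<le> 0)}"
  have "inj_on chamber S" using chamber_inj by (auto simp: inj_on_def S_def)
  moreover have "finite (chamber ` S)" using finite_tiles by (rule finite_subset[rotated]) (auto simp: S_def)
  ultimately have fS: "finite S" by (rule finite_imageD[rotated])
  have "id \<in> S" using chamber_id tile cx.id_W by (simp add: S_def)
  have "M \<subseteq> (\<lambda>(w, e). w (cx.simple e)) ` (S \<times> nrm F)" by (auto simp: M_def)
  then have fM: "finite M" by (rule finite_subset) (use fS cx.finite_N in auto)
  have MR: "M \<subseteq> cx.R" by (auto simp: M_def S_def cx.R_def)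
  have vM: "vec g \<in> nrm (\<Union>\<Theta>)" if g: "g \<in> M" for g
  proof -
    obtain w e where we: "w \<in> S" "e \<in> nrm F" "\<forall>x\<in>\<Union>\<Theta>. wall w e \<bullet> x \<le> 0" "g = w (cx.simple e)"
      using g unfolding M_def by blast
    have wW: "w \<in> cx.W" "chamber w \<in> \<Theta>" using we(1) by (auto simp: S_def)
    have nz: "wall w e \<noteq> 0" by (rule B_nz[OF wall_unit[OF wW(1) we(2)]])
    have "face (chamber w) (wall w e) \<subseteq> face (\<Union>\<Theta>) (wall w e)" using wW by (auto simp: face_def)
    then have "dim (face (chamber w) (wall w e)) \<le> dim (face (\<Union>\<Theta>) (wall w e))" by (rule dim_subset)
    moreover have "dim (face (chamber w) (wall w e)) = DIM('a \<times> real) - 1"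
      using wall_normal[OF wW(1) we(2)] by (simp add: nrm_def)
    moreover have "dim (face (\<Union>\<Theta>) (wall w e)) \<le> DIM('a \<times> real) - 1"
      using dim_subset[of "face (\<Union>\<Theta>) (wall w e)" "{p. wall w e \<bullet> p = 0}"] dim_hyperplane[OF nz]
      by (auto simp: face_def)
    ultimately have "wall w e \<in> nrm (\<Union>\<Theta>)"
      unfolding nrm_def using wall_unit[OF wW(1) we(2)] we(3) by simp
    then show ?thesis by (simp add: we(4) wall_def)
  qed
  have "inj_on vec M" using vec_root_inj MR by (intro inj_onI) blast
  then have cM: "card M \<le> card (nrm (\<Union>\<Theta>))"
    using vM poly_normals(1)[OF poly_union] by (intro card_inj_on_le) auto
  obtain p where p: "p \<in> F" "\<And>e. e \<in> nrm F \<Longrightarrow> e \<bullet> p < 0" using base_point by blast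
  obtain v where v: "\<forall>e\<in>nrm F. v e > 0" "cx.supp v" "\<forall>e\<in>nrm F. cx.bf v e \<le> 0"
    using positive_combination by blast
  have "card (nrm F) \<le> card M"
  \<comment> \<open>The sign is changed because outward normals are negative inside
    \<open>F\<close>, whereas \<open>card_le\<close> wants roots positive at the base point.\<close>
  proof (rule cx.card_le[of S M "\<lambda>e. - (e \<bullet> p)" v])
    fix g assume g: "g \<in> M"
    then have n: "vec g \<in> nrm (\<Union>\<Theta>)" by (rule vM)
    have "vec g \<bullet> p < 0"
      using strict_interior[OF poly_F p B_nz[OF nrm_unit[OF n]]] nrm_le[OF n] tile by blast
    then show "cx.pair g (\<lambda>e. - (e \<bullet> p)) > 0" by (simp add: cx.pair_def inner_vec sum_negf)
  next
    fix w e assume we: "w \<in> S" "e \<in> nrm F"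
    then have wW: "w \<in> cx.W" "chamber w \<in> \<Theta>" by (auto simp: S_def)
    show "w (cx.simple e) \<in> M \<or> w \<circ> cx.s e \<in> S"
    proof (cases "\<forall>x\<in>\<Union>\<Theta>. wall w e \<bullet> x \<le> 0")
      case True
      then show ?thesis using we unfolding M_def by blast
    next
      case False
      then obtain x where "x \<in> \<Union>\<Theta>" "wall w e \<bullet> x > 0" by force
      from neighbour[OF finite_tiles poly_tiles poly_union disjoint adjacent wW(2)
          wall_normal[OF wW(1) we(2)] this]
      have "chamber (w \<circ> cx.s e) \<in> \<Theta>" using chamber_reflect[OF wW(1) we(2)] by simp
      then show ?thesis using cx.comp_W[OF wW(1) cx.s_W[OF we(2)]] by (simp add: S_def)
    qed
  qed (use fS fM \<open>id \<in> S\<close> v in \<open>auto simp: S_def\<close>)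
  then show ?thesis using cM by simp
qed

end

section \<open>Infinite volume\<close>

lemma infinite_measure:
  assumes A: "A \<in> sets M" and S: "\<And>n::nat. S n \<in> sets M" "\<And>n. S n \<subseteq> A" "disjoint_family S"
    and c: "c > 0" "\<And>n. ennreal c \<le> emeasure M (S n)"
  shows "emeasure M A = \<infinity>"
proof (rule ccontr)
  assume "\<not> ?thesis"
  then obtain v where v: "emeasure M A = ennreal v" "v \<ge> 0" by (cases "emeasure M A") auto
  obtain m :: nat where m: "v < real m * c" using c(1) reals_Archimedean3 by blast
  have "ennreal (real m * c) = (\<Sum>n<m. ennreal c)"
    using c(1) by (simp add: ennreal_mult ennreal_of_nat_eq_real_of_nat)
  also have "\<dots> \<le> (\<Sum>n<m. emeasure M (S n))" using c(2) by (intro sum_mono)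
  also have "\<dots> = emeasure M (\<Union>n<m. S n)"
    using S(1,3) by (intro sum_emeasure) (auto simp: disjoint_family_on_def)
  also have "\<dots> \<le> emeasure M A" using A S(2) by (intro emeasure_mono) auto
  finally have "real m * c \<le> v" using v by (simp add: ennreal_le_iff)
  then show False using m by simp
qed

lemma disjoint_balls:
  assumes "\<And>m n::nat. m < n \<Longrightarrow> dist (f m) (f n) \<ge> r m + r n"
  shows "disjoint_family (\<lambda>n. ball (f n) (r n) :: 'a::metric_space set)"
proof -
  have "ball (f m) (r m) \<inter> ball (f n) (r n) = {}" if "m < n" for m n
  proof (rule ccontr)
    assume "\<not> ?thesis"
    then obtain x where "dist (f m) x < r m" "dist (f n) x < r n" by auto
    then have "dist (f m) (f n) < r m + r n" using dist_triangle2[of "f m" "f n" x] by (simp add: dist_commute)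
    then show False using assms[OF that] by simp
  qed
  then show ?thesis unfolding disjoint_family_on_def by (metis Int_commute linorder_neqE_nat)
qed

lemma infinite_lborel_ray:
  fixes c d :: "'a::euclidean_space"
  assumes A: "A \<in> sets lborel" and d: "d \<noteq> 0" and r: "r > 0"
    and sub: "\<And>t. t \<ge> 0 \<Longrightarrow> ball (c + t *\<^sub>R d) r \<subseteq> A"
  shows "emeasure lborel A = \<infinity>"
proof -
  \<comment> \<open>Puts consecutive centres at distance \<open>2 * r\<close>.\<close>
  define q where "q = 2 * r / norm d"
  define f where "f n = c + (real n * q) *\<^sub>R d" for n :: nat
  have fm: "dist (f m) (f n) \<ge> r + r" if "m < n" for m n
  proof -
    have "f m - f n = ((real m - real n) * q) *\<^sub>R d" by (simp add: f_def algebra_simps)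
    then have "dist (f m) (f n) = \<bar>(real m - real n) * q\<bar> * norm d"
      by (simp only: dist_norm norm_scaleR)
    also have "\<dots> = (real n - real m) * (2 * r)" using d r that by (simp add: abs_mult q_def)
    finally show ?thesis using that r by simp
  qed
  show ?thesis
  proof (rule infinite_measure[OF A, of "\<lambda>n. ball (f n) r" "unit_ball_vol (real DIM('a)) * r ^ DIM('a)"])
    show "disjoint_family (\<lambda>n. ball (f n) r)" using fm by (rule disjoint_balls)
    show "ball (f n) r \<subseteq> A" for n unfolding f_def q_def using sub r by simp
    show "0 < unit_ball_vol (real DIM('a)) * r ^ DIM('a)" using r by simp
  qed (use r in \<open>auto simp: emeasure_ball\<close>)
qed

lemma chart_measurable:
  "(\<lambda>x::'a::euclidean_space. (x, sqrt (1 + x \<bullet> x))) \<in> borel_measurable borel"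
  by (intro borel_measurable_continuous_onI continuous_intros)

text \<open>
  In the chart, the part of a cone with an interior light-like direction \<open>(u, 1)\<close> contains the
  balls \<open>ball (t u) (t r)\<close> for large \<open>t\<close>; their volume is bounded below since the density is of
  order \<open>1 / t\<close>.
\<close>

lemma infinite_hyp_measure:
  fixes u :: "'a::euclidean_space"
  assumes N: "finite N" and u: "norm u = 1" "\<And>a. a \<in> N \<Longrightarrow> a \<bullet> (u, 1) < 0"
    and A: "A \<in> sets borel" "{p \<in> hyp_space. \<forall>a\<in>N. a \<bullet> p \<le> 0} \<subseteq> A"
  shows "emeasure hyp_measure A = \<infinity>"
proof -
  have "open (\<Inter>a\<in>N. {z. a \<bullet> z < 0})" using N by (intro open_INT ballI open_halfspace_lt)
  moreover have "(u, 1) \<in> (\<Inter>a\<in>N. {z. a \<bullet> z < 0})" using u(2) by blast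
  ultimately obtain e where e: "e > 0" "ball (u, 1) e \<subseteq> (\<Inter>a\<in>N. {z. a \<bullet> z < 0})"
    using open_contains_ball by blast
  \<comment> \<open>\<open>1 / 4\<close> keeps the balls chosen below disjoint; \<open>e / 4\<close>
    makes the total error \<open>3 * r\<close> in \<open>in_A\<close> smaller than
    \<open>e\<close>.\<close>
  define r where "r = min (1 / 4) (e / 4)"
  have r: "r > 0" "r \<le> 1 / 4" "4 * r \<le> e" using e by (auto simp: r_def)
  define ch where "ch = (\<lambda>x::'a. (x, sqrt (1 + x \<bullet> x)))"
  define D where "D = density lborel (\<lambda>x::'a. ennreal (1 / sqrt (1 + x \<bullet> x)))"
  have meas: "ch \<in> measurable D borel" using chart_measurable by (simp add: D_def ch_def)
  have "emeasure hyp_measure A = emeasure D (ch -` A \<inter> space D)"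
    unfolding hyp_measure_def D_def[symmetric] ch_def[symmetric] by (rule emeasure_distr[OF meas A(1)])
  then have eq: "emeasure hyp_measure A = emeasure D (ch -` A)" by (simp add: D_def)
  \<comment> \<open>Divided by \<open>t\<close>, the lift of \<open>x\<close> is
    \<open>(w, h)\<close> with \<open>w\<close> near \<open>u\<close> and \<open>h\<close> near 1;
    the lower bound on \<open>t\<close> controls the term \<open>1 / t\<close> in the estimate of
    \<open>h\<close>.\<close>
  have in_A: "ch x \<in> A" if t: "t \<ge> 1 / r" and x: "x \<in> ball (t *\<^sub>R u) (t * r)" for t x
  proof -
    have "1 / r > 0" using r by simp
    then have t0: "t > 0" using t by linarith
    define w where "w = (1 / t) *\<^sub>R x"
    have xw: "x = t *\<^sub>R w" using t0 by (simp add: w_def)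
    have "t * norm (u - w) < t * r" using x t0 by (simp add: xw dist_norm flip: scaleR_diff_right)
    then have wu: "norm (w - u) < r" using t0 by (simp add: norm_minus_commute)
    have "norm w \<le> norm (w - u) + norm u" "norm u \<le> norm (w - u) + norm w"
      using norm_triangle_ineq[of "w - u" u] norm_triangle_ineq[of "u - w" w] by (simp_all add: norm_minus_commute)
    then have nw: "norm w \<le> 1 + r" "norm w \<ge> 1 - r" using wu u by auto
    define h where "h = sqrt (1 / t\<^sup>2 + w \<bullet> w)"
    have "sqrt (1 + x \<bullet> x) = t * h"
    proof -
      have "t * h = sqrt (t\<^sup>2 * (1 / t\<^sup>2 + w \<bullet> w))" using t0 by (simp add: h_def real_sqrt_mult)
      also have "t\<^sup>2 * (1 / t\<^sup>2 + w \<bullet> w) = 1 + x \<bullet> x" using t0 by (simp add: xw algebra_simps power2_eq_square)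
      finally show ?thesis ..
    qed
    then have chx: "ch x = t *\<^sub>R (w, h)" by (simp add: ch_def xw)
    have "1 / t \<le> r" using t r t0 by (simp add: field_simps)
    have "h \<le> sqrt (1 / t\<^sup>2) + sqrt (w \<bullet> w)" unfolding h_def by (rule sqrt_add_le_add_sqrt) auto
    also have "\<dots> = 1 / t + norm w" using t0 by (simp add: real_sqrt_divide norm_eq_sqrt_inner)
    finally have h1: "h \<le> 1 + 2 * r" using nw \<open>1 / t \<le> r\<close> by linarith
    have "sqrt (w \<bullet> w) \<le> h" unfolding h_def by simp
    then have h2: "h \<ge> 1 - r" using nw by (simp add: norm_eq_sqrt_inner)
    have "dist (u, 1) (w, h) \<le> dist u w + dist 1 h"
      unfolding dist_Pair_Pair by (rule sqrt_add_le_add_sqrt[THEN order_trans]) auto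
    also have "\<dots> < r + 2 * r" using wu h1 h2 r by (simp add: dist_norm norm_minus_commute dist_real_def)
    also have "\<dots> < e" using r by simp
    finally have "(w, h) \<in> ball (u, 1) e" by simp
    then have "\<forall>a\<in>N. a \<bullet> (w, h) < 0" using e(2) by blast
    then have "\<forall>a\<in>N. a \<bullet> ch x \<le> 0" unfolding chx inner_scaleR_right using t0 by (simp add: mult_nonneg_nonpos less_imp_le)
    moreover have "1 + x \<bullet> x > 0" by (simp add: add_pos_nonneg)
    then have "ch x \<in> hyp_space" by (simp add: ch_def hyp_space_def lorentz_def)
    ultimately show ?thesis using A(2) by blast
  qed
  \<comment> \<open>Doubling keeps the balls disjoint although their radii grow in proportion to
    \<open>t\<close>.\<close>
  define t where "t n = (1 / r) * 2 ^ n" for n :: nat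
  have tr: "t n \<ge> 1 / r" for n using r by (simp add: t_def divide_right_mono)
  have "1 / r \<ge> 1" using r by simp
  then have t1: "t n \<ge> 1" for n using tr[of n] by linarith
  have tt: "t n \<ge> 2 * t m" if "m < n" for m n
  proof -
    have "(2::real) ^ Suc m \<le> 2 ^ n" using that by (intro power_increasing) auto
    then show ?thesis using r by (simp add: t_def field_simps)
  qed
  define V where "V = unit_ball_vol (real DIM('a)) * r ^ DIM('a)"
  have V: "V > 0" using r by (simp add: V_def)
  have "emeasure D (ch -` A) = \<infinity>"
  \<comment> \<open>On each ball the norm is at most \<open>5 / 4 * t n\<close>, so the density is
    at least \<open>4 / (9 * t n)\<close>; the volume is \<open>V\<close> times a positive power of
    \<open>t n\<close>, which absorbs the remaining factor.\<close>
  proof (rule infinite_measure[of _ _ "\<lambda>n. ball (t n *\<^sub>R u) (t n * r)" "4 / 9 * V"])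
    show "ch -` A \<in> sets D" using measurable_sets[OF meas A(1)] by (simp add: D_def)
    show "ball (t n *\<^sub>R u) (t n * r) \<subseteq> ch -` A" for n using in_A[OF tr] by blast
    show "disjoint_family (\<lambda>n. ball (t n *\<^sub>R u) (t n * r))"
    proof (rule disjoint_balls)
      fix m n :: nat assume mn: "m < n"
      have "t m *\<^sub>R u - t n *\<^sub>R u = (t m - t n) *\<^sub>R u" by (simp add: scaleR_diff_left)
      then have "dist (t m *\<^sub>R u) (t n *\<^sub>R u) = t n - t m"
        using tt[OF mn] t1[of m] u by (simp add: dist_norm)
      moreover have "t m * r \<le> t m * (1 / 4)" "t n * r \<le> t n * (1 / 4)"
        using r t1[of m] t1[of n] by (auto intro!: mult_left_mono)
      ultimately show "t m * r + t n * r \<le> dist (t m *\<^sub>R u) (t n *\<^sub>R u)"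
        using tt[OF mn] t1[of m] by linarith
    qed
    show "ennreal (4 / 9 * V) \<le> emeasure D (ball (t n *\<^sub>R u) (t n * r))" for n
    proof -
      define X where "X = ball (t n *\<^sub>R u) (t n * r)"
      have tn: "t n \<ge> 1" by (rule t1)
      have dens: "1 / sqrt (1 + x \<bullet> x) \<ge> 4 / (9 * t n)" if "x \<in> X" for x
      proof -
        have "norm x \<le> norm (x - t n *\<^sub>R u) + norm (t n *\<^sub>R u)" using norm_triangle_ineq[of "x - t n *\<^sub>R u" "t n *\<^sub>R u"]
          by (simp only: diff_add_cancel)
        also have "\<dots> \<le> t n * r + t n" using that u tn by (simp add: X_def dist_norm norm_minus_commute)
        also have "\<dots> \<le> t n * (1 / 4) + t n" using r tn by (intro add_right_mono mult_left_mono) auto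
        finally have nx: "norm x \<le> 5 / 4 * t n" by simp
        have "sqrt (1 + x \<bullet> x) \<le> sqrt 1 + sqrt (x \<bullet> x)" by (rule sqrt_add_le_add_sqrt) auto
        also have "\<dots> \<le> 9 / 4 * t n" using nx tn by (simp add: norm_eq_sqrt_inner)
        finally have "sqrt (1 + x \<bullet> x) \<le> 9 / 4 * t n" .
        moreover have "sqrt (1 + x \<bullet> x) > 0" by (simp add: add_pos_nonneg)
        ultimately have "1 / (9 / 4 * t n) \<le> 1 / sqrt (1 + x \<bullet> x)" by (intro frac_le) simp_all
        then show ?thesis by simp
      qed
      have "t n ^ 1 \<le> t n ^ DIM('a)" using tn DIM_positive[where 'a='a] by (intro power_increasing) auto
      then have "1 \<le> t n ^ DIM('a) / t n" using tn by simp
      then have "4 / 9 * V * 1 \<le> 4 / 9 * V * (t n ^ DIM('a) / t n)" using V by (intro mult_left_mono) auto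
      also have "\<dots> = 4 / (9 * t n) * (unit_ball_vol (real DIM('a)) * (t n * r) ^ DIM('a))"
        by (simp add: V_def power_mult_distrib)
      finally have "4 / 9 * V \<le> 4 / (9 * t n) * (unit_ball_vol (real DIM('a)) * (t n * r) ^ DIM('a))" by simp
      then have "ennreal (4 / 9 * V) \<le> ennreal (4 / (9 * t n) * (unit_ball_vol (real DIM('a)) * (t n * r) ^ DIM('a)))"
        by (rule ennreal_leI)
      also have "\<dots> = ennreal (4 / (9 * t n)) * emeasure lborel X"
      proof -
        have "emeasure lborel X = ennreal (unit_ball_vol (real DIM('a)) * (t n * r) ^ DIM('a))"
          unfolding X_def using r tn by (intro emeasure_ball) simp
        then show ?thesis using r tn by (simp only:) (rule ennreal_mult, simp_all)
      qed
      also have "\<dots> = (\<integral>\<^sup>+x. ennreal (4 / (9 * t n)) * indicator X x \<partial>lborel)"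
        by (subst nn_integral_cmult_indicator) (auto simp: X_def)
      also have "\<dots> \<le> (\<integral>\<^sup>+x. ennreal (1 / sqrt (1 + x \<bullet> x)) * indicator X x \<partial>lborel)"
        using dens by (intro nn_integral_mono) (auto simp: indicator_def intro!: ennreal_leI)
      also have "\<dots> = emeasure D X"
        unfolding D_def by (subst emeasure_density) (auto simp: X_def)
      finally show ?thesis by (simp add: X_def)
    qed
  qed (use V in \<open>auto simp: D_def\<close>)
  then show ?thesis using eq by simp
qed

section \<open>Hyperbolic polytopes as cones\<close>

interpretation hyp: model 1 by unfold_locales simp

text \<open>By the intermediate value theorem the ray from the interior point \<open>p\<close> in
  direction \<open>x\<close> meets the light cone. The meeting point still satisfies all constraints
  strictly because \<open>p\<close> does, and it only has to be rescaled.\<close>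

lemma light_direction:
  fixes p x :: "'a::euclidean_space \<times> real"
  assumes p: "p \<in> hyp.ocone" "\<And>a. a \<in> N \<Longrightarrow> a \<bullet> p < 0"
    and x: "\<And>a. a \<in> N \<Longrightarrow> a \<bullet> x \<le> 0" "snd x < norm (fst x)"
  shows "\<exists>u. norm u = 1 \<and> (\<forall>a\<in>N. a \<bullet> (u, 1::real) < 0)"
proof (cases "N = {}")
  case True
  obtain b :: 'a where "b \<in> Basis" using nonempty_Basis by blast
  then show ?thesis using True by (intro exI[of _ b]) auto
next
  case False
  define g where "g t = snd (p + t *\<^sub>R x) - norm (fst (p + t *\<^sub>R x))" for t
  define h where "h = norm (fst x) - snd x"
  have h: "h > 0" using x(2) by (simp add: h_def)
  \<comment> \<open>By this time the ray is no longer in the open cone: in the limit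
    \<open>h\<close> is its loss per unit of time, and the numerator bounds what it starts
    with.\<close>
  define t1 where "t1 = (snd p + norm (fst p)) / h"
  have sp: "snd p > 0" "norm (fst p) < snd p" using p(1) by (auto simp: hyp.ocone_def)
  have t1: "t1 \<ge> 0" using h sp by (simp add: t1_def)
  have "norm (t1 *\<^sub>R fst x) \<le> norm (fst p + t1 *\<^sub>R fst x) + norm (fst p)"
    using norm_triangle_ineq4[of "fst p + t1 *\<^sub>R fst x" "fst p"] by simp
  then have "g t1 \<le> snd p + norm (fst p) - t1 * h" using t1 by (simp add: g_def h_def algebra_simps)
  also have "\<dots> = 0" using h by (simp add: t1_def)
  finally have "g t1 \<le> 0" .
  moreover have "g 0 \<ge> 0" using sp by (simp add: g_def)
  moreover have "continuous_on {0..t1} g" unfolding g_def by (intro continuous_intros)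
  ultimately obtain t where t: "t \<ge> 0" "g t = 0" using IVT2'[of g t1 0 0] t1 by auto
  define y where "y = p + t *\<^sub>R x"
  have y: "a \<bullet> y < 0" if "a \<in> N" for a
    unfolding y_def inner_add_right inner_scaleR_right using p(2)[OF that] x(1)[OF that] t(1)
    by (simp add: add_neg_nonpos mult_nonneg_nonpos)
  have sy: "snd y = norm (fst y)" using t(2) by (simp add: g_def y_def)
  have "y \<noteq> 0" using y False by force
  then have "fst y \<noteq> 0" using sy by (auto simp: prod_eq_iff)
  define u where "u = (1 / norm (fst y)) *\<^sub>R fst y"
  have yu: "y = norm (fst y) *\<^sub>R (u, 1)" using sy \<open>fst y \<noteq> 0\<close> by (simp add: u_def prod_eq_iff)
  have "a \<bullet> (u, 1) < 0" if "a \<in> N" for a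
  proof -
    have "norm (fst y) * (a \<bullet> (u, 1)) < 0" using y[OF that] by (subst (asm) yu) (simp only: inner_scaleR_right)
    then show ?thesis using \<open>fst y \<noteq> 0\<close> by (simp add: mult_less_0_iff)
  qed
  moreover have "norm u = 1" using \<open>fst y \<noteq> 0\<close> by (simp add: u_def)
  ultimately show ?thesis by blast
qed

text \<open>Turns a Lorentzian normal vector into the functional that it defines through the
  ordinary inner product.\<close>

definition flip :: "'a::euclidean_space \<times> real \<Rightarrow> 'a \<times> real" where
  "flip e = (fst e, - snd e)"

lemma flip_flip [simp]: "flip (flip e) = e" by (simp add: flip_def)

lemma flip_inner: "flip e \<bullet> p = lorentz e p"
  by (simp add: flip_def lorentz_def inner_prod_def)

lemma B_flip [simp]: "hyp.B (flip a) (flip b) = lorentz a b" "hyp.B a b = lorentz a b" "lorentz (flip a) (flip b) = lorentz a b"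
  by (simp_all add: hyp.B_def flip_def lorentz_def)

lemma refl_flip: "hyp.refl (flip e) = hyp_reflection e"
proof (rule ext)
  fix p
  have "hyp.sh (flip e) = e" by (simp add: hyp.sh_def flip_def)
  then show "hyp.refl (flip e) p = hyp_reflection e p"
    by (simp add: hyp.refl_def hyp_reflection_def flip_inner)
qed

definition proj :: "'a::euclidean_space \<times> real \<Rightarrow> 'a \<times> real" where
  "proj p = (1 / sqrt (hyp.Q p)) *\<^sub>R p"

definition hcone :: "('a::euclidean_space \<times> real) set \<Rightarrow> ('a \<times> real) set" where
  "hcone S = {p \<in> hyp.ocone. proj p \<in> S}"

lemma Q_lorentz: "hyp.Q p = - lorentz p p"
  by (simp add: hyp.Q_def lorentz_def power2_eq_square)

lemma hyp_space_ocone: "p \<in> hyp_space \<Longrightarrow> p \<in> hyp.ocone \<and> proj p = p"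
  by (auto simp: hyp_space_def hyp.ocone_Q Q_lorentz proj_def)

lemma ocone_pos: "p \<in> hyp.ocone \<Longrightarrow> sqrt (hyp.Q p) > 0" by (simp add: hyp.ocone_Q)

lemma proj_hyp_space: "p \<in> hyp.ocone \<Longrightarrow> proj p \<in> hyp_space"
proof -
  assume p: "p \<in> hyp.ocone"
  have "lorentz (r *\<^sub>R p) (r *\<^sub>R p) = r\<^sup>2 * lorentz p p" for r
    by (simp add: lorentz_def algebra_simps power2_eq_square)
  then have "lorentz (proj p) (proj p) = (1 / sqrt (hyp.Q p))\<^sup>2 * - hyp.Q p"
    by (simp add: proj_def Q_lorentz)
  also have "\<dots> = - 1" using p by (simp add: hyp.ocone_Q power_divide)
  finally show ?thesis using p ocone_pos[OF p] by (simp add: hyp_space_def proj_def hyp.ocone_Q)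
qed

lemma inner_proj: "p \<in> hyp.ocone \<Longrightarrow> (a \<bullet> proj p \<le> 0 \<longleftrightarrow> a \<bullet> p \<le> 0) \<and> (a \<bullet> proj p = 0 \<longleftrightarrow> a \<bullet> p = 0)
    \<and> (a \<bullet> proj p < 0 \<longleftrightarrow> a \<bullet> p < 0)"
  using ocone_pos[of p] by (auto simp: proj_def divide_le_0_iff divide_less_0_iff)

lemma hcone_Int: "hcone (S \<inter> T) = hcone S \<inter> hcone T" by (auto simp: hcone_def)

lemma hcone_Union: "hcone (\<Union>X) = \<Union>(hcone ` X)" by (auto simp: hcone_def)

lemma hcone_restrict: "S \<subseteq> hyp_space \<Longrightarrow> hcone S \<inter> hyp_space = S"
  using hyp_space_ocone by (fastforce simp: hcone_def)

lemma dim_hcone: "S \<subseteq> hyp_space \<Longrightarrow> dim (hcone S) = dim S"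
proof -
  assume S: "S \<subseteq> hyp_space"
  have "hcone S \<subseteq> span S"
  proof
    fix p assume "p \<in> hcone S"
    then have p: "p \<in> hyp.ocone" "proj p \<in> S" by (auto simp: hcone_def)
    have "p = sqrt (hyp.Q p) *\<^sub>R proj p" using ocone_pos[OF p(1)] by (simp add: proj_def)
    moreover have "sqrt (hyp.Q p) *\<^sub>R proj p \<in> span S" using p(2) by (intro span_scale span_base)
    ultimately show "p \<in> span S" by simp
  qed
  then have "dim (hcone S) \<le> dim S" using dim_subset[of "hcone S" "span S"] by simp
  moreover have "S \<subseteq> hcone S" using hcone_restrict[OF S] by blast
  ultimately show ?thesis using dim_subset[of S "hcone S"] by simp
qed

lemma polytope_subset: "hyp_convex_polytope P \<Longrightarrow> P \<subseteq> hyp_space"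
  by (auto simp: hyp_convex_polytope_def)

lemma polytope_hcone:
  assumes "hyp_convex_polytope (P :: ('a::euclidean_space \<times> real) set)"
  shows "hyp.poly (hcone P)"
proof -
  obtain E where E: "finite E" "\<And>e. e \<in> E \<Longrightarrow> lorentz e e = 1" "P = hyp_space \<inter> (\<Inter>e\<in>E. hyp_halfspace e)"
    using assms unfolding hyp_convex_polytope_def by blast
  have "hcone P = hyp.cell (flip ` E)"
  proof (intro set_eqI iffI)
    fix p assume "p \<in> hcone P"
    then have p: "p \<in> hyp.ocone" "proj p \<in> P" by (auto simp: hcone_def)
    then have "flip e \<bullet> proj p \<le> 0" if "e \<in> E" for e
      using that E(3) by (auto simp: hyp_halfspace_def flip_inner)
    then show "p \<in> hyp.cell (flip ` E)" using p(1) inner_proj[OF p(1)] by (auto simp: hyp.cell_def)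
  next
    fix p assume "p \<in> hyp.cell (flip ` E)"
    then have p: "p \<in> hyp.ocone" "\<And>e. e \<in> E \<Longrightarrow> flip e \<bullet> p \<le> 0" by (auto simp: hyp.cell_def)
    then have "lorentz e (proj p) \<le> 0" if "e \<in> E" for e
      using that inner_proj[OF p(1)] by (auto simp flip: flip_inner)
    then show "p \<in> hcone P"
      using p(1) proj_hyp_space[OF p(1)] E(3) by (auto simp: hcone_def hyp_halfspace_def)
  qed
  moreover have "\<forall>a\<in>flip ` E. hyp.B a a = 1" using E(2) by auto
  moreover have "dim (hcone P) = DIM('a \<times> real)"
    using dim_hcone[OF polytope_subset[OF assms]] assms by (simp add: hyp_convex_polytope_def hyp_dim_def)
  ultimately show ?thesis unfolding hyp.poly_def using E(1) by blast
qed

lemma hcone_halfspace: "S \<subseteq> hyp_space \<Longrightarrow> S \<subseteq> hyp_halfspace e \<longleftrightarrow> (\<forall>p\<in>hcone S. flip e \<bullet> p \<le> 0)"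
proof
  assume "S \<subseteq> hyp_halfspace e"
  then show "\<forall>p\<in>hcone S. flip e \<bullet> p \<le> 0"
    using inner_proj by (fastforce simp: hcone_def hyp_halfspace_def flip_inner[symmetric])
next
  assume S: "S \<subseteq> hyp_space" "\<forall>p\<in>hcone S. flip e \<bullet> p \<le> 0"
  then show "S \<subseteq> hyp_halfspace e"
    using hcone_restrict[OF S(1)] by (auto simp: hyp_halfspace_def flip_inner[symmetric])
qed

lemma hcone_face: "hcone (S \<inter> hyp_hyperplane e) = hyp.face (hcone S) (flip e)"
proof (rule set_eqI)
  fix p
  show "p \<in> hcone (S \<inter> hyp_hyperplane e) \<longleftrightarrow> p \<in> hyp.face (hcone S) (flip e)"
    using inner_proj[of p "flip e"] proj_hyp_space[of p]
    by (cases "p \<in> hyp.ocone") (simp_all add: hcone_def hyp.face_def hyp_hyperplane_def flip_inner)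
qed

lemma outer_normal_nrm:
  assumes P: "hyp_convex_polytope (P :: ('a::euclidean_space \<times> real) set)"
    and n: "hyp_outer_normal P f e" and d: "hyp_dim f = int DIM('a) - 1"
  shows "flip e \<in> hyp.nrm (hcone P)" "hcone f = hyp.face (hcone P) (flip e)"
proof -
  have n': "lorentz e e = 1" "P \<subseteq> hyp_halfspace e" "f = P \<inter> hyp_hyperplane e"
    using n by (auto simp: hyp_outer_normal_def)
  note Ps = polytope_subset[OF P]
  show f: "hcone f = hyp.face (hcone P) (flip e)" by (simp add: n'(3) hcone_face)
  have "dim (hcone f) = DIM('a)" using dim_hcone[of f] Ps n'(3) d by (auto simp: hyp_dim_def)
  then show "flip e \<in> hyp.nrm (hcone P)"
    using n'(1) hcone_halfspace[OF Ps] n'(2) f by (simp add: hyp.nrm_def)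
qed

lemma nrm_outer_normal:
  assumes P: "hyp_convex_polytope (P :: ('a::euclidean_space \<times> real) set)" and a: "a \<in> hyp.nrm (hcone P)"
  shows "hyp_outer_normal P (P \<inter> hyp_hyperplane (flip a)) (flip a)"
    "(P \<inter> hyp_hyperplane (flip a)) hyp_facet_of P"
proof -
  note Ps = polytope_subset[OF P]
  have a': "lorentz a a = 1" "\<forall>p\<in>hcone P. a \<bullet> p \<le> 0" "dim (hyp.face (hcone P) a) = DIM('a)"
    using a by (auto simp: hyp.nrm_def)
  show n: "hyp_outer_normal P (P \<inter> hyp_hyperplane (flip a)) (flip a)"
    using a' hcone_halfspace[OF Ps, of "flip a"] by (simp add: hyp_outer_normal_def)
  have "P \<inter> hyp_hyperplane (flip a) \<subseteq> hyp_space" using Ps by blast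
  then have d: "dim (P \<inter> hyp_hyperplane (flip a)) = DIM('a)"
    using a'(3) hcone_face[of P "flip a"] dim_hcone[of "P \<inter> hyp_hyperplane (flip a)"] by simp
  have "P \<inter> hyp_hyperplane (flip a) \<noteq> {}"
  proof
    assume "P \<inter> hyp_hyperplane (flip a) = {}"
    then show False using d DIM_positive[where 'a='a] by simp
  qed
  moreover have "hyp_dim (P \<inter> hyp_hyperplane (flip a)) = hyp_dim P - 1"
    using P d by (simp add: hyp_convex_polytope_def hyp_dim_def)
  ultimately show "(P \<inter> hyp_hyperplane (flip a)) hyp_facet_of P"
    using n unfolding hyp_facet_of_def by blast
qed

lemma facets_hcone:
  assumes P: "hyp_convex_polytope (P :: ('a::euclidean_space \<times> real) set)"
  shows "bij_betw (\<lambda>a. P \<inter> hyp_hyperplane (flip a)) (hyp.nrm (hcone P)) {f. f hyp_facet_of P}"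
  unfolding bij_betw_def
proof
  show "inj_on (\<lambda>a. P \<inter> hyp_hyperplane (flip a)) (hyp.nrm (hcone P))"
  proof (rule inj_onI)
    fix a b assume ab: "a \<in> hyp.nrm (hcone P)" "b \<in> hyp.nrm (hcone P)"
      "P \<inter> hyp_hyperplane (flip a) = P \<inter> hyp_hyperplane (flip b)"
    have "hyp.face (hcone P) a = hyp.face (hcone P) b"
      using hcone_face[of P "flip a"] hcone_face[of P "flip b"] ab(3) by simp
    then show "a = b" using inj_onD[OF hyp.inj_on_face[OF polytope_hcone[OF P]]] ab(1,2) by blast
  qed
  show "(\<lambda>a. P \<inter> hyp_hyperplane (flip a)) ` hyp.nrm (hcone P) = {f. f hyp_facet_of P}"
  proof (intro equalityI subsetI)
    fix f assume "f \<in> {f. f hyp_facet_of P}"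
    then obtain e where e: "hyp_outer_normal P f e" "hyp_dim f = hyp_dim P - 1"
      by (auto simp: hyp_facet_of_def)
    have "hyp_dim f = int DIM('a) - 1" using e(2) P by (simp add: hyp_convex_polytope_def)
    from outer_normal_nrm(1)[OF P e(1) this] have "flip e \<in> hyp.nrm (hcone P)" .
    moreover have "f = P \<inter> hyp_hyperplane (flip (flip e))" using e(1) by (simp add: hyp_outer_normal_def)
    ultimately show "f \<in> (\<lambda>a. P \<inter> hyp_hyperplane (flip a)) ` hyp.nrm (hcone P)" by blast
  next
    fix f assume "f \<in> (\<lambda>a. P \<inter> hyp_hyperplane (flip a)) ` hyp.nrm (hcone P)"
    then show "f \<in> {f. f hyp_facet_of P}" using nrm_outer_normal(2)[OF P] by blast
  qed
qed

text \<open>Reflections preserve \<open>Q\<close>, hence commute with the radial projection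
  \<open>proj\<close>.\<close>

lemma hcone_reflection: "lorentz e e = 1 \<Longrightarrow> hcone (hyp_reflection e ` S) = hyp.refl (flip e) ` hcone S"
proof -
  assume e: "lorentz e e = 1"
  have inv: "hyp.refl (flip e) (hyp.refl (flip e) p) = p" for p by (rule hyp.refl_refl) (simp add: e)
  have oc: "hyp.refl (flip e) p \<in> hyp.ocone" if "p \<in> hyp.ocone" for p
    using that by (intro hyp.ocone_refl) (simp_all add: e)
  have Q: "hyp.Q (hyp.refl (flip e) p) = hyp.Q p" for p
    unfolding hyp.refl_def using hyp.Q_shift[of p "(2 * (flip e \<bullet> p)) *\<^sub>R flip e"]
    by (simp add: hyp.sh_scale hyp.B_lin e del: B_flip(2))
  have pr: "proj (hyp.refl (flip e) p) = hyp.refl (flip e) (proj p)" for p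
    unfolding proj_def Q by (simp add: hyp.refl_def algebra_simps)
  show ?thesis
  proof (intro set_eqI iffI)
    fix p assume "p \<in> hcone (hyp_reflection e ` S)"
    then obtain q where q: "p \<in> hyp.ocone" "q \<in> S" "proj p = hyp.refl (flip e) q"
      by (auto simp: hcone_def refl_flip)
    have "hyp.refl (flip e) p \<in> hcone S" using q oc by (simp add: hcone_def pr inv)
    then show "p \<in> hyp.refl (flip e) ` hcone S" using inv[of p] by (metis imageI)
  next
    fix p assume "p \<in> hyp.refl (flip e) ` hcone S"
    then obtain q where "q \<in> hcone S" "p = hyp.refl (flip e) q" by blast
    then show "p \<in> hcone (hyp_reflection e ` S)" using oc by (auto simp: hcone_def pr refl_flip[symmetric])
  qed
qed

section \<open>Angles, interiors and volume of hyperbolic tiles\<close>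

text \<open>Vectors orthogonal to a point of hyperbolic space have nonnegative square; this is
  applied to \<open>d + e\<close> and \<open>d - e\<close>. The bound permits inverting
  \<open>arccos\<close> in the angle condition.\<close>

lemma lorentz_le_one:
  assumes p: "p \<in> hyp_space" "lorentz d p = 0" "lorentz e p = 0" and u: "lorentz d d = 1" "lorentz e e = 1"
  shows "\<bar>lorentz d e\<bar> \<le> 1"
proof -
  have sp: "lorentz x x \<ge> 0" if "lorentz x p = 0" for x
  proof -
    have p1: "fst p \<bullet> fst p = (snd p)\<^sup>2 - 1" "snd p > 0"
      using p(1) by (auto simp: hyp_space_def lorentz_def power2_eq_square)
    have "(snd x * snd p)\<^sup>2 = (fst x \<bullet> fst p)\<^sup>2" using that by (simp add: lorentz_def)
    also have "\<dots> \<le> (fst x \<bullet> fst x) * (fst p \<bullet> fst p)" by (rule Cauchy_Schwarz_ineq)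
    also have "\<dots> \<le> (fst x \<bullet> fst x) * (snd p)\<^sup>2" unfolding p1 by (intro mult_left_mono) auto
    finally have "(snd x)\<^sup>2 * (snd p)\<^sup>2 \<le> (fst x \<bullet> fst x) * (snd p)\<^sup>2" by (simp add: power_mult_distrib)
    then have "(snd x)\<^sup>2 \<le> fst x \<bullet> fst x" using p1(2) by simp
    then show ?thesis by (simp add: lorentz_def power2_eq_square)
  qed
  have lin: "lorentz (x + y) z = lorentz x z + lorentz y z" "lorentz (x - y) z = lorentz x z - lorentz y z"
    "lorentz z (x + y) = lorentz z x + lorentz z y" "lorentz z (x - y) = lorentz z x - lorentz z y" for x y z
    by (simp_all add: lorentz_def algebra_simps)
  have "lorentz e d = lorentz d e" by (simp add: lorentz_def inner_commute)
  then show ?thesis using sp[of "d + e"] sp[of "d - e"] p u by (auto simp: lin)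
qed

lemma coxeter_angles_hcone:
  assumes F: "hyp_coxeter_polytope (F :: ('a::euclidean_space \<times> real) set)"
  shows "hyp.coxeter_angles (hcone F)"
  unfolding hyp.coxeter_angles_def
proof (intro ballI impI, elim conjE)
  have P: "hyp_convex_polytope F" using F by (simp add: hyp_coxeter_polytope_def)
  note Ps = polytope_subset[OF P]
  fix a b assume ab: "a \<in> hyp.nrm (hcone F)" "b \<in> hyp.nrm (hcone F)" "a \<noteq> b"
    and ne: "hyp.face (hcone F) a \<inter> hyp.face (hcone F) b \<noteq> {}"
    and dim: "dim (hyp.face (hcone F) a \<inter> hyp.face (hcone F) b) = DIM('a \<times> real) - 2"
  define f where "f = F \<inter> hyp_hyperplane (flip a)"
  define g where "g = F \<inter> hyp_hyperplane (flip b)"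
  have "f \<noteq> g" using facets_hcone[OF P] ab unfolding bij_betw_def inj_on_def f_def g_def by blast
  have fg: "hcone (f \<inter> g) = hyp.face (hcone F) a \<inter> hyp.face (hcone F) b"
    by (simp only: hcone_Int[of f g]) (simp add: f_def g_def hcone_face)
  obtain q where q: "q \<in> hcone (f \<inter> g)" using ne fg by blast
  then have pq: "proj q \<in> f \<inter> g" by (simp add: hcone_def)
  have "f \<inter> g \<subseteq> hyp_space" using Ps by (auto simp: f_def)
  then have "dim (f \<inter> g) = DIM('a \<times> real) - 2" using dim_hcone[of "f \<inter> g"] unfolding fg dim by simp
  then have "hyp_dim (f \<inter> g) = int DIM('a) - 2" using DIM_positive[where 'a='a] by (simp add: hyp_dim_def)
  then obtain m :: nat where m: "m \<ge> 2" "pi - arccos (lorentz (flip a) (flip b)) = pi / real m"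
    using F nrm_outer_normal[OF P ab(1)] nrm_outer_normal[OF P ab(2)] \<open>f \<noteq> g\<close> pq
    unfolding hyp_coxeter_polytope_def f_def[symmetric] g_def[symmetric] by blast
  have "\<bar>lorentz (flip a) (flip b)\<bar> \<le> 1"
    using pq hyp.nrm_unit[OF ab(1)] hyp.nrm_unit[OF ab(2)]
    by (intro lorentz_le_one[of "proj q"]) (auto simp: f_def g_def hyp_hyperplane_def)
  then have "\<bar>lorentz a b\<bar> \<le> 1" by simp
  moreover have "arccos (lorentz a b) = pi - pi / real m" using m(2) by simp
  ultimately have "lorentz a b = cos (pi - pi / real m)" by (metis cos_arccos_abs)
  then have "hyp.B a b = - cos (pi / real m)" by simp
  then show "\<exists>m::nat. m \<ge> 2 \<and> hyp.B a b = - cos (pi / real m)" using m(1) by blast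
qed

text \<open>An intersection of full dimension is itself a cell, and the hyperbolic points strictly
  inside it form a nonempty relatively open subset of both tiles.\<close>

lemma disjoint_hcone:
  assumes S: "hyp_convex_polytope (S :: ('a::euclidean_space \<times> real) set)" and T: "hyp_convex_polytope T"
    and disj: "(top_of_set hyp_space interior_of S) \<inter> (top_of_set hyp_space interior_of T) = {}"
  shows "dim (hcone S \<inter> hcone T) \<noteq> DIM('a \<times> real)"
proof
  assume d: "dim (hcone S \<inter> hcone T) = DIM('a \<times> real)"
  obtain E E' where E: "finite E" "\<forall>a\<in>E. hyp.B a a = 1" "hcone S = hyp.cell E"
    "finite E'" "\<forall>a\<in>E'. hyp.B a a = 1" "hcone T = hyp.cell E'"
    using polytope_hcone[OF S] polytope_hcone[OF T] unfolding hyp.poly_def by blast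
  define R where "R = hcone S \<inter> hcone T"
  have "R = hyp.cell (E \<union> E')" unfolding R_def E(3,6) by (auto simp: hyp.cell_def)
  moreover have "finite (E \<union> E')" "\<forall>a\<in>E \<union> E'. hyp.B a a = 1" using E by auto
  ultimately have poly: "hyp.poly R" using d unfolding hyp.poly_def R_def by blast
  obtain p where p: "p \<in> R" "\<And>a. a \<in> hyp.nrm R \<Longrightarrow> a \<bullet> p < 0" using hyp.poly_normals(3)[OF poly] by blast
  define U where "U = hyp_space \<inter> (\<Inter>a\<in>hyp.nrm R. {x. a \<bullet> x < 0})"
  have "open (\<Inter>a\<in>hyp.nrm R. {x. a \<bullet> x < 0})"
    using hyp.poly_normals(1)[OF poly] by (intro open_INT ballI open_halfspace_lt)
  then have U: "openin (top_of_set hyp_space) U" unfolding U_def by (rule openin_open_Int)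
  have "U \<subseteq> R"
  proof
    fix x assume x: "x \<in> U"
    then have "x \<in> hyp.ocone" using hyp_space_ocone[of x] by (simp add: U_def)
    moreover have "a \<bullet> x \<le> 0" if "a \<in> hyp.nrm R" for a using x that by (auto simp: U_def less_imp_le)
    ultimately have "x \<in> hyp.cell (hyp.nrm R)" by (simp add: hyp.cell_def)
    then show "x \<in> R" using hyp.poly_normals(2)[OF poly] by simp
  qed
  then have "U \<subseteq> S" "U \<subseteq> T"
    using hcone_restrict[OF polytope_subset[OF S]] hcone_restrict[OF polytope_subset[OF T]]
    by (auto simp: R_def U_def)
  then have "U \<subseteq> (top_of_set hyp_space interior_of S) \<inter> (top_of_set hyp_space interior_of T)"
    using U interior_of_maximal by (metis le_inf_iff)
  moreover have po: "p \<in> hyp.ocone" using p(1) by (simp add: R_def hcone_def)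
  have "proj p \<in> U" unfolding U_def using proj_hyp_space[OF po] inner_proj[OF po] p(2) by blast
  ultimately show False using disj by blast
qed

lemma sets_polytope:
  fixes P :: "('a::euclidean_space \<times> real) set"
  assumes "hyp_convex_polytope P"
  shows "P \<in> sets borel"
proof -
  from assms
  obtain E where E: "P = hyp_space \<inter> (\<Inter>e\<in>E. hyp_halfspace e)"
    unfolding hyp_convex_polytope_def by blast
  have "P = {p. lorentz p p = - 1} \<inter> {p. snd p > 0} \<inter> (\<Inter>e\<in>E. {p. lorentz e p \<le> 0})"
    unfolding E by (auto simp: hyp_space_def hyp_halfspace_def)
  moreover have "closed {p :: 'a \<times> real. lorentz p p = - 1}"
    unfolding lorentz_def by (intro closed_Collect_eq continuous_intros)
  moreover have "open {p :: 'a \<times> real. snd p > 0}" by (intro open_Collect_less continuous_intros)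
  moreover have "closed (\<Inter>e\<in>E. {p :: 'a \<times> real. lorentz e p \<le> 0})"
    unfolding lorentz_def by (intro closed_INT ballI closed_Collect_le continuous_intros)
  ultimately show ?thesis by (simp add: sets.Int borel_closed borel_open del: INT_extend_simps)
qed

lemma hyp_finite_volume_light:
  assumes P: "hyp_convex_polytope P" "emeasure hyp_measure P < \<infinity>"
    and F: "hyp_convex_polytope F" "F \<subseteq> P"
    and x: "x \<noteq> 0" "\<And>a. a \<in> hyp.nrm (hcone F) \<Longrightarrow> a \<bullet> x \<le> 0"
  shows "snd x > 0 \<and> 1 * norm (fst x) \<le> snd x"
proof -
  note poly = polytope_hcone[OF F(1)]
  have "norm (fst x) \<le> snd x"
  proof (rule ccontr)
    assume "\<not> ?thesis"
    then have less: "snd x < norm (fst x)" by simp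
    obtain p where p: "p \<in> hcone F" "\<And>a. a \<in> hyp.nrm (hcone F) \<Longrightarrow> a \<bullet> p < 0"
      using hyp.poly_normals(3)[OF poly] by blast
    have "p \<in> hyp.ocone" using p(1) by (simp add: hcone_def)
    from light_direction[OF this p(2) x(2) less] obtain u where
      u: "norm u = 1" "\<And>a. a \<in> hyp.nrm (hcone F) \<Longrightarrow> a \<bullet> (u, 1::real) < 0" by blast
    have sub: "{p \<in> hyp_space. \<forall>a\<in>hyp.nrm (hcone F). a \<bullet> p \<le> 0} \<subseteq> P"
    proof
      fix q assume q: "q \<in> {p \<in> hyp_space. \<forall>a\<in>hyp.nrm (hcone F). a \<bullet> p \<le> 0}"
      then have "q \<in> hyp.cell (hyp.nrm (hcone F))" using hyp_space_ocone[of q] by (simp add: hyp.cell_def)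
      then have "q \<in> hcone F" using hyp.poly_normals(2)[OF poly] by simp
      then show "q \<in> P" using q hcone_restrict[OF polytope_subset[OF F(1)]] F(2) by blast
    qed
    have "emeasure hyp_measure P = \<infinity>"
      by (rule infinite_hyp_measure[OF hyp.poly_normals(1)[OF poly] u sets_polytope[OF P(1)] sub])
    then show False using P(2) by simp
  qed
  moreover have "snd x \<noteq> 0 \<or> norm (fst x) \<noteq> 0" using x(1) by (auto simp: prod_eq_iff)
  ultimately show ?thesis using norm_ge_zero[of "fst x"] by linarith
qed

lemma hyp_facet_bound:
  fixes P :: "('a::euclidean_space \<times> real) set"
  assumes P: "hyp_convex_polytope P" "emeasure hyp_measure P < \<infinity>"
    and dec: "hyp_coxeter_decomposition P \<Theta>" and F: "F \<in> \<Theta>"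
  shows "finite {f. f hyp_facet_of F}" "card {f. f hyp_facet_of F} \<le> card {f. f hyp_facet_of P}"
proof -
  have til: "hyp_tiling P \<Theta>" and cox: "\<And>T. T \<in> \<Theta> \<Longrightarrow> hyp_coxeter_polytope T"
    and sym: "\<And>S T f e. S \<in> \<Theta> \<Longrightarrow> T \<in> \<Theta> \<Longrightarrow> S \<noteq> T \<Longrightarrow> f hyp_facet_of S \<Longrightarrow> f hyp_facet_of T \<Longrightarrow>
      hyp_outer_normal S f e \<Longrightarrow> hyp_reflection e ` S = T"
    using dec unfolding hyp_coxeter_decomposition_def by blast+
  note t = til[unfolded hyp_tiling_def]
  have fin: "finite \<Theta>" using t by (rule conjunct1)
  have polyT: "\<And>T. T \<in> \<Theta> \<Longrightarrow> hyp_convex_polytope T"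
    using t[THEN conjunct2, THEN conjunct1] by blast
  have un: "\<Union>\<Theta> = P" using t[THEN conjunct2, THEN conjunct2, THEN conjunct1] .
  have disj: "\<And>S T. S \<in> \<Theta> \<Longrightarrow> T \<in> \<Theta> \<Longrightarrow> S \<noteq> T \<Longrightarrow>
      (top_of_set hyp_space interior_of S) \<inter> (top_of_set hyp_space interior_of T) = {}"
    using t[THEN conjunct2, THEN conjunct2, THEN conjunct2, THEN conjunct1] by blast
  have f2f: "\<And>S T. S \<in> \<Theta> \<Longrightarrow> T \<in> \<Theta> \<Longrightarrow> S \<noteq> T \<Longrightarrow> hyp_dim (S \<inter> T) = int DIM('a) - 1 \<Longrightarrow>
      (S \<inter> T) hyp_facet_of S \<and> (S \<inter> T) hyp_facet_of T"
    using t[THEN conjunct2, THEN conjunct2, THEN conjunct2, THEN conjunct2] by blast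
  have unC: "\<Union>(hcone ` \<Theta>) = hcone P" using hcone_Union[of \<Theta>] un by simp
  interpret decomposition 1 "hcone ` \<Theta>" "hcone F"
  proof
    show "finite (hcone ` \<Theta>)" using fin by simp
    show "hyp.poly T" if "T \<in> hcone ` \<Theta>" for T using that polytope_hcone polyT by blast
    show "hyp.poly (\<Union>(hcone ` \<Theta>))" unfolding unC by (rule polytope_hcone[OF P(1)])
    show "hcone F \<in> hcone ` \<Theta>" using F by blast
    show "hyp.coxeter_angles (hcone F)" by (rule coxeter_angles_hcone[OF cox[OF F]])
  next
    fix S' T' assume "S' \<in> hcone ` \<Theta>" "T' \<in> hcone ` \<Theta>" and ne: "S' \<noteq> T'"
    then obtain S T where ST: "S \<in> \<Theta>" "T \<in> \<Theta>" "S' = hcone S" "T' = hcone T" by blast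
    then have "S \<noteq> T" using ne by blast
    show "dim (S' \<inter> T') \<noteq> DIM('a \<times> real)"
      unfolding ST(3,4) by (rule disjoint_hcone[OF polyT[OF ST(1)] polyT[OF ST(2)] disj[OF ST(1,2) \<open>S \<noteq> T\<close>]])
    assume d: "dim (S' \<inter> T') = DIM('a \<times> real) - 1"
    have "S \<inter> T \<subseteq> hyp_space" using polytope_subset[OF polyT[OF ST(1)]] by blast
    then have "hyp_dim (S \<inter> T) = int DIM('a) - 1"
      using d dim_hcone[of "S \<inter> T"] by (simp add: hyp_dim_def ST hcone_Int)
    then have fac: "(S \<inter> T) hyp_facet_of S" "(S \<inter> T) hyp_facet_of T" "hyp_dim (S \<inter> T) = int DIM('a) - 1"
      using f2f[OF ST(1,2) \<open>S \<noteq> T\<close>] by blast+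
    then obtain e where e: "hyp_outer_normal S (S \<inter> T) e" by (auto simp: hyp_facet_of_def)
    note n = outer_normal_nrm[OF polyT[OF ST(1)] e fac(3)]
    have "hyp_reflection e ` S = T" by (rule sym[OF ST(1,2) \<open>S \<noteq> T\<close> fac(1,2) e])
    moreover have "lorentz e e = 1" using e by (simp add: hyp_outer_normal_def)
    ultimately have "hyp.refl (flip e) ` S' = T'" using hcone_reflection[of e S] by (simp add: ST)
    then show "\<exists>a\<in>hyp.nrm S'. S' \<inter> T' = hyp.face S' a \<and> hyp.refl a ` S' = T'"
      using n by (intro bexI[of _ "flip e"]) (auto simp: ST hcone_Int)
  next
    fix x :: "'a \<times> real" assume x: "x \<noteq> 0" "\<And>a. a \<in> hyp.nrm (hcone F) \<Longrightarrow> a \<bullet> x \<le> 0"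
    show "0 < snd x \<and> 1 * norm (fst x) \<le> snd x"
      using hyp_finite_volume_light[OF P polyT[OF F] _ x] un F by blast
  qed
  have c: "card {f. f hyp_facet_of Q} = card (hyp.nrm (hcone Q))" if "hyp_convex_polytope Q" for Q :: "('a \<times> real) set"
    using bij_betw_same_card[OF facets_hcone[OF that]] by simp
  show "card {f. f hyp_facet_of F} \<le> card {f. f hyp_facet_of P}"
    using facet_count unfolding unC c[OF P(1)] c[OF polyT[OF F]] .
  \<comment> \<open>Needed besides the inequality, as \<open>card\<close> of an infinite set is
    0.\<close>
  show "finite {f. f hyp_facet_of F}"
    using bij_betw_finite[OF facets_hcone[OF polyT[OF F]]] hyp.poly_normals(1)[OF polytope_hcone[OF polyT[OF F]]] by simp
qed

section \<open>Euclidean polytopes as cones\<close>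

interpretation euc: model 0 by unfold_locales simp

definition nproj :: "'a::euclidean_space \<times> real \<Rightarrow> 'a" where
  "nproj p = (1 / snd p) *\<^sub>R fst p"

definition econe :: "'a::euclidean_space set \<Rightarrow> ('a \<times> real) set" where
  "econe S = {p. snd p > 0 \<and> nproj p \<in> S}"

lemma euc_ocone: "p \<in> euc.ocone \<longleftrightarrow> snd p > 0" by (simp add: euc.ocone_def)

lemma euc_B: "euc.B a b = fst a \<bullet> fst b" by (simp add: euc.B_def)

lemma mem_econe: "(x, 1) \<in> econe S \<longleftrightarrow> x \<in> S" by (simp add: econe_def nproj_def)

lemma econe_Int: "econe (S \<inter> T) = econe S \<inter> econe T" by (auto simp: econe_def)

lemma econe_Union: "econe (\<Union>X) = \<Union>(econe ` X)" by (auto simp: econe_def)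

lemma inner_nproj: "snd p > 0 \<Longrightarrow> (u, - b) \<bullet> p = snd p * (u \<bullet> nproj p - b)"
  by (simp add: nproj_def inner_prod_def algebra_simps)

text \<open>The cone spans the same space as the copy of \<open>S\<close> at height one. The affine
  hull of this copy avoids 0, which accounts for the extra dimension.\<close>

lemma dim_econe: "int (dim (econe S)) = aff_dim S + 1"
proof -
  define emb where "emb = (\<lambda>x::'a. (x, 1::real))"
  have "econe S \<subseteq> span (emb ` S)"
  proof
    fix p assume "p \<in> econe S"
    then have p: "snd p > 0" "nproj p \<in> S" by (auto simp: econe_def)
    have "p = snd p *\<^sub>R emb (nproj p)" using p(1) by (simp add: emb_def nproj_def prod_eq_iff)
    moreover have "snd p *\<^sub>R emb (nproj p) \<in> span (emb ` S)" using p(2) by (intro span_scale span_base) auto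
    ultimately show "p \<in> span (emb ` S)" by simp
  qed
  then have "dim (econe S) \<le> dim (emb ` S)" using dim_subset[of "econe S" "span (emb ` S)"] by simp
  moreover have "emb ` S \<subseteq> econe S" by (auto simp: emb_def mem_econe)
  then have "dim (emb ` S) \<le> dim (econe S)" by (rule dim_subset)
  ultimately have "int (dim (econe S)) = int (dim (insert 0 (emb ` S)))" by (simp add: dim_insert span_zero)
  also have "\<dots> = aff_dim (insert 0 (emb ` S))" by (rule aff_dim_zero[symmetric]) (simp add: hull_inc)
  also have "\<dots> = aff_dim (emb ` S) + 1"
  proof -
    have "affine hull (emb ` S) \<subseteq> {p. (0, 1) \<bullet> p = 1}"
      by (rule hull_minimal) (auto simp: emb_def intro: affine_hyperplane)
    then have "0 \<notin> affine hull (emb ` S)" by auto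
    then show ?thesis by (simp add: aff_dim_insert)
  qed
  also have "aff_dim (emb ` S) = aff_dim S"
  proof -
    have "emb ` S = (+) (0, 1) ` (\<lambda>x. (x, 0)) ` S" by (force simp: emb_def image_image)
    moreover have "linear (\<lambda>x::'a. (x, 0::real))" by (rule linearI) auto
    moreover have "inj (\<lambda>x::'a. (x, 0::real))" by (auto simp: inj_on_def)
    ultimately show ?thesis by (simp add: aff_dim_translation_eq aff_dim_injective_linear_image)
  qed
  finally show ?thesis .
qed

lemma polytope_econe:
  assumes "euc_convex_polytope (P :: 'a::euclidean_space set)"
  shows "euc.poly (econe P)"
proof -
  have "polyhedron P" using assms by (simp add: euc_convex_polytope_def)
  then obtain H where H: "finite H" "P = \<Inter>H" "\<forall>h\<in>H. \<exists>a b. a \<noteq> 0 \<and> h = {x. a \<bullet> x \<le> b}"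
    unfolding polyhedron_def by (elim exE conjE)
  have "\<exists>c. norm (fst c) = 1 \<and> h = {x. fst c \<bullet> x \<le> - snd c}" if h: "h \<in> H" for h
  proof -
    obtain a b where ab: "a \<noteq> 0" "h = {x. a \<bullet> x \<le> b}" using bspec[OF H(3) h] by blast
    have "(1 / norm a) *\<^sub>R a \<bullet> x \<le> b / norm a \<longleftrightarrow> a \<bullet> x \<le> b" for x
      using ab(1) by (simp add: divide_right_mono field_simps)
    then show ?thesis using ab by (intro exI[of _ "((1 / norm a) *\<^sub>R a, - (b / norm a))"]) simp
  qed
  then obtain c where c: "\<And>h. h \<in> H \<Longrightarrow> norm (fst (c h)) = 1" "\<And>h. h \<in> H \<Longrightarrow> h = {x. fst (c h) \<bullet> x \<le> - snd (c h)}"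
    by metis
  have "econe P = euc.cell (c ` H)"
  proof (rule set_eqI)
    fix p
    show "p \<in> econe P \<longleftrightarrow> p \<in> euc.cell (c ` H)"
    proof (cases "snd p > 0")
      case True
      have "nproj p \<in> h \<longleftrightarrow> c h \<bullet> p \<le> 0" if h: "h \<in> H" for h
      proof -
        have "c h \<bullet> p = snd p * (fst (c h) \<bullet> nproj p + snd (c h))"
          using inner_nproj[OF True, of "fst (c h)" "- snd (c h)"] by simp
        moreover have "nproj p \<in> h \<longleftrightarrow> fst (c h) \<bullet> nproj p \<le> - snd (c h)" using c(2)[OF h] by blast
        ultimately show ?thesis using True by (auto simp: mult_le_0_iff)
      qed
      then show ?thesis using True H(2) by (auto simp: econe_def euc.cell_def euc_ocone)
    qed (simp add: econe_def euc.cell_def euc_ocone)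
  qed
  moreover have "\<forall>a\<in>c ` H. euc.B a a = 1" using c(1) by (auto simp: euc_B dot_square_norm)
  moreover have "dim (econe P) = DIM('a \<times> real)"
    using dim_econe[of P] assms by (simp add: euc_convex_polytope_def)
  ultimately show ?thesis unfolding euc.poly_def using H(1) by blast
qed

lemma econe_halfspace: "S \<subseteq> {x. u \<bullet> x \<le> b} \<longleftrightarrow> (\<forall>p\<in>econe S. (u, - b) \<bullet> p \<le> 0)"
proof
  assume "S \<subseteq> {x. u \<bullet> x \<le> b}"
  then show "\<forall>p\<in>econe S. (u, - b) \<bullet> p \<le> 0"
    by (auto simp only: econe_def mem_Collect_eq inner_nproj intro!: mult_nonneg_nonpos) auto
next
  assume *: "\<forall>p\<in>econe S. (u, - b) \<bullet> p \<le> 0"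
  show "S \<subseteq> {x. u \<bullet> x \<le> b}"
  proof
    fix x assume "x \<in> S"
    then have "(u, - b) \<bullet> (x, 1) \<le> 0" using * mem_econe by blast
    then show "x \<in> {x. u \<bullet> x \<le> b}" by simp
  qed
qed

lemma econe_face: "econe (S \<inter> {x. u \<bullet> x = b}) = euc.face (econe S) (u, - b)"
proof (rule set_eqI)
  fix p
  show "p \<in> econe (S \<inter> {x. u \<bullet> x = b}) \<longleftrightarrow> p \<in> euc.face (econe S) (u, - b)"
  proof (cases "snd p > 0")
    case True
    show ?thesis unfolding econe_def euc.face_def mem_Collect_eq inner_nproj[OF True] using True by auto
  qed (simp add: econe_def euc.face_def)
qed

lemma euc_outer_normal_nrm:
  assumes n: "euc_outer_normal (P :: 'a::euclidean_space set) f u b" and d: "aff_dim f = int DIM('a) - 1"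
  shows "(u, - b) \<in> euc.nrm (econe P)" "econe f = euc.face (econe P) (u, - b)"
proof -
  have n': "norm u = 1" "P \<subseteq> {x. u \<bullet> x \<le> b}" "f = P \<inter> {x. u \<bullet> x = b}"
    using n by (auto simp: euc_outer_normal_def)
  show f: "econe f = euc.face (econe P) (u, - b)" unfolding n'(3) by (rule econe_face)
  have "dim (econe f) = DIM('a)" using dim_econe[of f] d by simp
  then show "(u, - b) \<in> euc.nrm (econe P)"
    using n'(1) econe_halfspace[of P u b] n'(2) f by (simp add: euc.nrm_def euc_B dot_square_norm)
qed

lemma nrm_euc_outer_normal:
  assumes P: "euc_convex_polytope (P :: 'a::euclidean_space set)" and a: "(u, - b) \<in> euc.nrm (econe P)"
  shows "euc_outer_normal P (P \<inter> {x. u \<bullet> x = b}) u b" "(P \<inter> {x. u \<bullet> x = b}) facet_of P"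
proof -
  have a': "norm u = 1" "P \<subseteq> {x. u \<bullet> x \<le> b}" "dim (euc.face (econe P) (u, - b)) = DIM('a)"
    using a econe_halfspace[of P u b] by (auto simp: euc.nrm_def euc_B norm_eq_1)
  then show "euc_outer_normal P (P \<inter> {x. u \<bullet> x = b}) u b" by (simp add: euc_outer_normal_def)
  have "aff_dim (P \<inter> {x. u \<bullet> x = b}) = int DIM('a) - 1"
    using dim_econe[of "P \<inter> {x. u \<bullet> x = b}"] a'(3) unfolding econe_face by simp
  moreover from this have "P \<inter> {x. u \<bullet> x = b} \<noteq> {}" using DIM_positive[where 'a='a] by auto
  moreover have "(P \<inter> {x. u \<bullet> x = b}) face_of P"
    using P a'(2) by (intro face_of_Int_supporting_hyperplane_le)
      (auto simp: euc_convex_polytope_def polyhedron_imp_convex)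
  ultimately show "(P \<inter> {x. u \<bullet> x = b}) facet_of P"
    using P by (simp add: facet_of_def euc_convex_polytope_def)
qed

text \<open>Faces of polyhedra are exposed; it remains to normalise the exposing functional.\<close>

lemma facet_outer_normal:
  assumes P: "euc_convex_polytope (P :: 'a::euclidean_space set)" and f: "f facet_of P"
  shows "\<exists>u b. euc_outer_normal P f u b" "aff_dim f = int DIM('a) - 1"
proof -
  show "aff_dim f = int DIM('a) - 1" using assms by (simp add: facet_of_def euc_convex_polytope_def)
  have "f exposed_face_of P" using P f exposed_face_of_polyhedron by (auto simp: euc_convex_polytope_def facet_of_def)
  moreover have "f \<noteq> {}" "f \<noteq> P" using f by (auto simp: facet_of_def)
  ultimately obtain a b where ab: "a \<noteq> 0" "P \<subseteq> {x. a \<bullet> x \<le> b}" "f = P \<inter> {x. a \<bullet> x = b}"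
    unfolding exposed_face_of by blast
  have "(1 / norm a) *\<^sub>R a \<bullet> x \<le> b / norm a \<longleftrightarrow> a \<bullet> x \<le> b" "(1 / norm a) *\<^sub>R a \<bullet> x = b / norm a \<longleftrightarrow> a \<bullet> x = b" for x
    using ab(1) by (simp_all add: field_simps)
  then have "euc_outer_normal P f ((1 / norm a) *\<^sub>R a) (b / norm a)"
    using ab by (simp add: euc_outer_normal_def)
  then show "\<exists>u b. euc_outer_normal P f u b" by blast
qed

lemma facets_econe:
  assumes P: "euc_convex_polytope (P :: 'a::euclidean_space set)"
  shows "bij_betw (\<lambda>a. P \<inter> {x. fst a \<bullet> x = - snd a}) (euc.nrm (econe P)) {f. f facet_of P}"
  unfolding bij_betw_def
proof
  show "inj_on (\<lambda>a. P \<inter> {x. fst a \<bullet> x = - snd a}) (euc.nrm (econe P))"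
  proof (rule inj_onI)
    fix a b assume ab: "a \<in> euc.nrm (econe P)" "b \<in> euc.nrm (econe P)"
      "P \<inter> {x. fst a \<bullet> x = - snd a} = P \<inter> {x. fst b \<bullet> x = - snd b}"
    have "euc.face (econe P) a = euc.face (econe P) b"
      using econe_face[of P "fst a" "- snd a"] econe_face[of P "fst b" "- snd b"] ab(3) by simp
    then show "a = b" using inj_onD[OF euc.inj_on_face[OF polytope_econe[OF P]]] ab(1,2) by blast
  qed
  show "(\<lambda>a. P \<inter> {x. fst a \<bullet> x = - snd a}) ` euc.nrm (econe P) = {f. f facet_of P}"
  proof (intro equalityI subsetI)
    fix f assume "f \<in> {f. f facet_of P}"
    then obtain u b where e: "euc_outer_normal P f u b" "aff_dim f = int DIM('a) - 1"
      using facet_outer_normal[OF P] by blast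
    have "(u, - b) \<in> euc.nrm (econe P)" by (rule euc_outer_normal_nrm(1)[OF e])
    moreover have "f = P \<inter> {x. fst (u, - b) \<bullet> x = - snd (u, - b)}" using e(1) by (simp add: euc_outer_normal_def)
    ultimately show "f \<in> (\<lambda>a. P \<inter> {x. fst a \<bullet> x = - snd a}) ` euc.nrm (econe P)" by blast
  next
    fix f assume "f \<in> (\<lambda>a. P \<inter> {x. fst a \<bullet> x = - snd a}) ` euc.nrm (econe P)"
    then obtain a where "a \<in> euc.nrm (econe P)" "f = P \<inter> {x. fst a \<bullet> x = - snd a}" by blast
    then show "f \<in> {f. f facet_of P}" using nrm_euc_outer_normal(2)[OF P, of "fst a" "- snd a"] by simp
  qed
qed

lemma econe_reflection: "norm u = 1 \<Longrightarrow> econe (euc_reflection u b ` S) = euc.refl (u, - b) ` econe S"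
proof -
  assume u: "norm u = 1"
  have inv: "euc.refl (u, - b) (euc.refl (u, - b) p) = p" for p
    using u by (intro euc.refl_refl) (simp add: euc_B dot_square_norm)
  have sn: "snd (euc.refl (u, - b) p) = snd p" for p by (simp add: euc.refl_def euc.sh_def)
  have pr: "nproj (euc.refl (u, - b) p) = euc_reflection u b (nproj p)" if "snd p > 0" for p
  proof -
    have "nproj (euc.refl (u, - b) p) = (1 / snd p) *\<^sub>R (fst p - (2 * ((u, - b) \<bullet> p)) *\<^sub>R u)"
      unfolding nproj_def sn by (simp add: euc.refl_def euc.sh_def)
    also have "\<dots> = nproj p - (2 * (u \<bullet> nproj p - b)) *\<^sub>R u"
      unfolding inner_nproj[OF that] using that by (simp add: nproj_def scaleR_diff_right)
    finally show ?thesis by (simp add: euc_reflection_def)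
  qed
  have inv': "euc_reflection u b (euc_reflection u b x) = x" for x
  proof -
    have "u \<bullet> u = 1" using u by (simp add: dot_square_norm)
    then have "u \<bullet> euc_reflection u b x - b = - (u \<bullet> x - b)"
      by (simp add: euc_reflection_def inner_diff_right)
    then show ?thesis
      unfolding euc_reflection_def[of u b "euc_reflection u b x"] by (simp add: euc_reflection_def scaleR_diff_left)
  qed
  show ?thesis
  proof (intro set_eqI iffI)
    fix p assume "p \<in> econe (euc_reflection u b ` S)"
    then obtain q where q: "snd p > 0" "q \<in> S" "nproj p = euc_reflection u b q" by (auto simp: econe_def)
    have "euc.refl (u, - b) p \<in> econe S" using q by (simp add: econe_def sn pr inv')
    then show "p \<in> euc.refl (u, - b) ` econe S" using inv[of p] by (metis imageI)
  next
    fix p assume "p \<in> euc.refl (u, - b) ` econe S"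
    then obtain q where "q \<in> econe S" "p = euc.refl (u, - b) q" by blast
    then show "p \<in> econe (euc_reflection u b ` S)" by (simp add: econe_def sn pr)
  qed
qed

section \<open>Angles, interiors and volume of Euclidean tiles\<close>

lemma coxeter_angles_econe:
  assumes F: "euc_coxeter_polytope (F :: 'a::euclidean_space set)"
  shows "euc.coxeter_angles (econe F)"
  unfolding euc.coxeter_angles_def
proof (intro ballI impI, elim conjE)
  have P: "euc_convex_polytope F" using F by (simp add: euc_coxeter_polytope_def)
  fix a b assume ab: "a \<in> euc.nrm (econe F)" "b \<in> euc.nrm (econe F)" "a \<noteq> b"
    and ne: "euc.face (econe F) a \<inter> euc.face (econe F) b \<noteq> {}"
    and dim: "dim (euc.face (econe F) a \<inter> euc.face (econe F) b) = DIM('a \<times> real) - 2"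
  define f where "f = F \<inter> {x. fst a \<bullet> x = - snd a}"
  define g where "g = F \<inter> {x. fst b \<bullet> x = - snd b}"
  have "f \<noteq> g" using facets_econe[OF P] ab unfolding bij_betw_def inj_on_def f_def g_def by blast
  have fg: "econe (f \<inter> g) = euc.face (econe F) a \<inter> euc.face (econe F) b"
    by (simp only: econe_Int[of f g]) (simp add: f_def g_def econe_face)
  have "f \<inter> g \<noteq> {}" using ne fg by (auto simp: econe_def)
  have "aff_dim (f \<inter> g) = int DIM('a) - 2"
    using dim_econe[of "f \<inter> g"] DIM_positive[where 'a='a] unfolding fg dim by simp
  have na: "euc_outer_normal F f (fst a) (- snd a)" "f facet_of F"
    using nrm_euc_outer_normal[OF P, of "fst a" "- snd a"] ab(1) by (simp_all add: f_def)
  have nb: "euc_outer_normal F g (fst b) (- snd b)" "g facet_of F"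
    using nrm_euc_outer_normal[OF P, of "fst b" "- snd b"] ab(2) by (simp_all add: g_def)
  obtain m :: nat where m: "m \<ge> 2" "pi - arccos (fst a \<bullet> fst b) = pi / real m"
    using F na nb \<open>f \<noteq> g\<close> \<open>f \<inter> g \<noteq> {}\<close> \<open>aff_dim (f \<inter> g) = _\<close> unfolding euc_coxeter_polytope_def by blast
  have "norm (fst a) = 1" "norm (fst b) = 1" using na(1) nb(1) by (auto simp: euc_outer_normal_def)
  then have "\<bar>fst a \<bullet> fst b\<bar> \<le> 1" using Cauchy_Schwarz_ineq2[of "fst a" "fst b"] by simp
  moreover have "arccos (fst a \<bullet> fst b) = pi - pi / real m" using m(2) by simp
  ultimately have "fst a \<bullet> fst b = cos (pi - pi / real m)" by (metis cos_arccos_abs)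
  then have "euc.B a b = - cos (pi / real m)" by (simp add: euc_B)
  then show "\<exists>m::nat. m \<ge> 2 \<and> euc.B a b = - cos (pi / real m)" using m(1) by blast
qed

lemma disjoint_econe:
  assumes S: "euc_convex_polytope (S :: 'a::euclidean_space set)" and T: "euc_convex_polytope T"
    and disj: "interior S \<inter> interior T = {}"
  shows "dim (econe S \<inter> econe T) \<noteq> DIM('a \<times> real)"
proof
  assume d: "dim (econe S \<inter> econe T) = DIM('a \<times> real)"
  have "aff_dim (S \<inter> T) = int DIM('a)" using dim_econe[of "S \<inter> T"] d by (simp add: econe_Int)
  moreover have "convex (S \<inter> T)" "interior (S \<inter> T) = {}"
    using S T disj by (auto simp: euc_convex_polytope_def polyhedron_imp_convex convex_Int)
  then obtain a b where "a \<noteq> 0" "S \<inter> T \<subseteq> {x. a \<bullet> x = b}" by (rule empty_interior_subset_hyperplane)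
  then have "aff_dim (S \<inter> T) \<le> int DIM('a) - 1"
    using aff_dim_subset[of "S \<inter> T" "{x. a \<bullet> x = b}"] by (simp add: aff_dim_hyperplane)
  ultimately show False by simp
qed

text \<open>Euclidean counterpart of \<open>light_direction\<close>. If \<open>x\<close> has
  negative height, following it from \<open>p\<close> down to height zero gives a horizontal vector
  on which all constraints are negative; at height zero \<open>x\<close> itself serves.\<close>

lemma recession_direction:
  fixes p x :: "'a::euclidean_space \<times> real"
  assumes p: "snd p > 0" "\<And>a. a \<in> N \<Longrightarrow> a \<bullet> p < 0"
    and x: "x \<noteq> 0" "\<And>a. a \<in> N \<Longrightarrow> a \<bullet> x \<le> 0" "snd x \<le> 0"
  shows "\<exists>d. d \<noteq> 0 \<and> (\<forall>a\<in>N. fst a \<bullet> d \<le> 0)"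
proof -
  consider "N = {}" | "snd x = 0" | "N \<noteq> {}" "snd x < 0" using x(3) by linarith
  then show ?thesis
  proof cases
    case 1
    obtain b :: 'a where "b \<in> Basis" using nonempty_Basis by blast
    then show ?thesis using 1 by (intro exI[of _ b]) (auto simp: nonzero_Basis)
  next
    case 2
    then have "fst x \<noteq> 0" using x(1) by (auto simp: prod_eq_iff)
    moreover have "fst a \<bullet> fst x \<le> 0" if "a \<in> N" for a using x(2)[OF that] 2 by (simp add: inner_prod_def)
    ultimately show ?thesis by blast
  next
    case 3
    define y where "y = p + (snd p / - snd x) *\<^sub>R x"
    have sy: "snd y = 0" using 3 by (simp add: y_def)
    have neg: "a \<bullet> y < 0" if "a \<in> N" for a
    proof -
      have "(snd p / - snd x) * (a \<bullet> x) \<le> 0"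
        using p(1) 3(2) x(2)[OF that] by (intro mult_nonneg_nonpos divide_nonneg_nonneg) auto
      then show ?thesis using p(2)[OF that] unfolding y_def inner_add_right inner_scaleR_right by linarith
    qed
    then have fy: "fst a \<bullet> fst y < 0" if "a \<in> N" for a using that sy by (simp add: inner_prod_def)
    then have "fst y \<noteq> 0" using 3(1) by force
    then show ?thesis using fy by (intro exI[of _ "fst y"]) (auto simp: less_imp_le)
  qed
qed

text \<open>Otherwise \<open>F\<close> has a recession direction and contains all translates along
  it of a ball around an interior point, which have infinite total volume.\<close>

lemma euc_finite_volume_bounded:
  assumes P: "euc_convex_polytope (P :: 'a::euclidean_space set)" "emeasure lborel P < \<infinity>"
    and F: "euc_convex_polytope F" "F \<subseteq> P"
    and x: "x \<noteq> 0" "\<And>a. a \<in> euc.nrm (econe F) \<Longrightarrow> a \<bullet> x \<le> 0"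
  shows "snd x > 0"
proof (rule ccontr)
  assume "\<not> ?thesis"
  then have sx: "snd x \<le> 0" by simp
  define N where "N = euc.nrm (econe F)"
  note poly = polytope_econe[OF F(1)]
  have fN: "finite N" unfolding N_def by (rule euc.poly_normals(1)[OF poly])
  obtain p where p: "p \<in> econe F" "\<And>a. a \<in> N \<Longrightarrow> a \<bullet> p < 0"
    using euc.poly_normals(3)[OF poly] unfolding N_def by blast
  have sp: "snd p > 0" using p(1) by (simp add: econe_def)
  have xN: "a \<bullet> x \<le> 0" if "a \<in> N" for a using x(2) that by (simp add: N_def)
  obtain d where d: "d \<noteq> 0" "\<And>a. a \<in> N \<Longrightarrow> fst a \<bullet> d \<le> 0"
    using recession_direction[OF sp p(2) x(1) xN sx] by blast
  define U where "U = (\<Inter>a\<in>N. {z. fst a \<bullet> z < - snd a})"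
  have "open U" unfolding U_def using fN by (intro open_INT ballI open_halfspace_lt)
  moreover have "nproj p \<in> U"
  proof -
    have "fst a \<bullet> nproj p < - snd a" if "a \<in> N" for a
    proof -
      have "snd p * (fst a \<bullet> nproj p - - snd a) < 0"
        using p(2)[OF that] inner_nproj[OF sp, of "fst a" "- snd a"] by simp
      then show ?thesis using sp by (simp add: mult_less_0_iff)
    qed
    then show ?thesis by (simp add: U_def)
  qed
  ultimately obtain r where r: "r > 0" "ball (nproj p) r \<subseteq> U" using open_contains_ball by blast
  have "emeasure lborel P = \<infinity>"
  proof (rule infinite_lborel_ray[OF _ d(1) r(1)])
    show "P \<in> sets lborel" using P(1) by (simp add: euc_convex_polytope_def polyhedron_imp_closed borel_closed)
    fix t :: real assume t: "t \<ge> 0"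
    show "ball (nproj p + t *\<^sub>R d) r \<subseteq> P"
    proof
      fix y assume "y \<in> ball (nproj p + t *\<^sub>R d) r"
      then have "y - t *\<^sub>R d \<in> ball (nproj p) r" by (simp add: dist_norm algebra_simps)
      then have yU: "y - t *\<^sub>R d \<in> U" using r(2) by blast
      have "a \<bullet> (y, 1) \<le> 0" if "a \<in> N" for a
      proof -
        have "fst a \<bullet> (y - t *\<^sub>R d) < - snd a" using yU that by (simp add: U_def)
        moreover have "t * (fst a \<bullet> d) \<le> 0" using t d(2)[OF that] by (rule mult_nonneg_nonpos)
        ultimately show ?thesis by (simp add: inner_prod_def inner_diff_right)
      qed
      then have "(y, 1) \<in> euc.cell N" by (simp add: euc.cell_def euc_ocone)
      then have "(y, 1) \<in> econe F" using euc.poly_normals(2)[OF poly] by (simp add: N_def)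
      then show "y \<in> P" using F(2) mem_econe by blast
    qed
  qed
  then show False using P(2) by simp
qed

lemma euc_facet_bound:
  fixes P :: "'a::euclidean_space set"
  assumes P: "euc_convex_polytope P" "emeasure lborel P < \<infinity>"
    and dec: "euc_coxeter_decomposition P \<Theta>" and F: "F \<in> \<Theta>"
  shows "finite {f. f facet_of F}" "card {f. f facet_of F} \<le> card {f. f facet_of P}"
proof -
  have til: "euc_tiling P \<Theta>" and cox: "\<And>T. T \<in> \<Theta> \<Longrightarrow> euc_coxeter_polytope T"
    and sym: "\<And>S T f u b. S \<in> \<Theta> \<Longrightarrow> T \<in> \<Theta> \<Longrightarrow> S \<noteq> T \<Longrightarrow> f facet_of S \<Longrightarrow> f facet_of T \<Longrightarrow>
      euc_outer_normal S f u b \<Longrightarrow> euc_reflection u b ` S = T"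
    using dec unfolding euc_coxeter_decomposition_def by blast+
  note t = til[unfolded euc_tiling_def]
  have fin: "finite \<Theta>" using t by (rule conjunct1)
  have polyT: "\<And>T. T \<in> \<Theta> \<Longrightarrow> euc_convex_polytope T"
    using t[THEN conjunct2, THEN conjunct1] by blast
  have un: "\<Union>\<Theta> = P" using t[THEN conjunct2, THEN conjunct2, THEN conjunct1] .
  have disj: "\<And>S T. S \<in> \<Theta> \<Longrightarrow> T \<in> \<Theta> \<Longrightarrow> S \<noteq> T \<Longrightarrow> interior S \<inter> interior T = {}"
    using t[THEN conjunct2, THEN conjunct2, THEN conjunct2, THEN conjunct1] by blast
  have f2f: "\<And>S T. S \<in> \<Theta> \<Longrightarrow> T \<in> \<Theta> \<Longrightarrow> S \<noteq> T \<Longrightarrow> aff_dim (S \<inter> T) = int DIM('a) - 1 \<Longrightarrow>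
      (S \<inter> T) facet_of S \<and> (S \<inter> T) facet_of T"
    using t[THEN conjunct2, THEN conjunct2, THEN conjunct2, THEN conjunct2] by blast
  have unC: "\<Union>(econe ` \<Theta>) = econe P" using econe_Union[of \<Theta>] un by simp
  interpret decomposition 0 "econe ` \<Theta>" "econe F"
  proof
    show "finite (econe ` \<Theta>)" using fin by simp
    show "euc.poly T" if "T \<in> econe ` \<Theta>" for T using that polytope_econe polyT by blast
    show "euc.poly (\<Union>(econe ` \<Theta>))" unfolding unC by (rule polytope_econe[OF P(1)])
    show "econe F \<in> econe ` \<Theta>" using F by blast
    show "euc.coxeter_angles (econe F)" by (rule coxeter_angles_econe[OF cox[OF F]])
  next
    fix S' T' assume "S' \<in> econe ` \<Theta>" "T' \<in> econe ` \<Theta>" and ne: "S' \<noteq> T'"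
    then obtain S T where ST: "S \<in> \<Theta>" "T \<in> \<Theta>" "S' = econe S" "T' = econe T" by blast
    then have "S \<noteq> T" using ne by blast
    show "dim (S' \<inter> T') \<noteq> DIM('a \<times> real)"
      unfolding ST(3,4) by (rule disjoint_econe[OF polyT[OF ST(1)] polyT[OF ST(2)] disj[OF ST(1,2) \<open>S \<noteq> T\<close>]])
    assume d: "dim (S' \<inter> T') = DIM('a \<times> real) - 1"
    have "aff_dim (S \<inter> T) = int DIM('a) - 1"
      using d dim_econe[of "S \<inter> T"] by (simp add: ST econe_Int)
    then have fac: "(S \<inter> T) facet_of S" "(S \<inter> T) facet_of T" "aff_dim (S \<inter> T) = int DIM('a) - 1"
      using f2f[OF ST(1,2) \<open>S \<noteq> T\<close>] by blast+
    then obtain u b where e: "euc_outer_normal S (S \<inter> T) u b"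
      using facet_outer_normal(1)[OF polyT[OF ST(1)]] by blast
    note n = euc_outer_normal_nrm[OF e fac(3)]
    have "euc_reflection u b ` S = T" by (rule sym[OF ST(1,2) \<open>S \<noteq> T\<close> fac(1,2) e])
    moreover have "norm u = 1" using e by (simp add: euc_outer_normal_def)
    ultimately have "euc.refl (u, - b) ` S' = T'" using econe_reflection[of u b S] by (simp add: ST)
    then show "\<exists>a\<in>euc.nrm S'. S' \<inter> T' = euc.face S' a \<and> euc.refl a ` S' = T'"
      using n by (intro bexI[of _ "(u, - b)"]) (auto simp: ST econe_Int)
  next
    fix x :: "'a \<times> real" assume x: "x \<noteq> 0" "\<And>a. a \<in> euc.nrm (econe F) \<Longrightarrow> a \<bullet> x \<le> 0"
    have "F \<subseteq> P" using un F by blast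
    from euc_finite_volume_bounded[OF P polyT[OF F] this x]
    show "0 < snd x \<and> 0 * norm (fst x) \<le> snd x" by simp
  qed
  have c: "card {f. f facet_of Q} = card (euc.nrm (econe Q))" if "euc_convex_polytope Q" for Q :: "'a set"
    using bij_betw_same_card[OF facets_econe[OF that]] by simp
  show "card {f. f facet_of F} \<le> card {f. f facet_of P}"
    using facet_count unfolding unC c[OF P(1)] c[OF polyT[OF F]] .
  show "finite {f. f facet_of F}"
    using bij_betw_finite[OF facets_econe[OF polyT[OF F]]] euc.poly_normals(1)[OF polytope_econe[OF polyT[OF F]]] by simp
qed

theorem theorem1:
  fixes k :: nat
  shows
    "(\<forall>(P :: ('a::euclidean_space \<times> real) set) \<Theta> F.
        hyp_convex_polytope P \<and> emeasure hyp_measure P < \<infinity> \<and>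
        card {f. f hyp_facet_of P} = k \<and>
        hyp_coxeter_decomposition P \<Theta> \<and> F \<in> \<Theta> \<longrightarrow>
        finite {f. f hyp_facet_of F} \<and> card {f. f hyp_facet_of F} \<le> k) \<and>
     (\<forall>(P :: 'a set) \<Theta> F.
        euc_convex_polytope P \<and> emeasure lborel P < \<infinity> \<and>
        card {f. f facet_of P} = k \<and>
        euc_coxeter_decomposition P \<Theta> \<and> F \<in> \<Theta> \<longrightarrow>
        finite {f. f facet_of F} \<and> card {f. f facet_of F} \<le> k)"
  using hyp_facet_bound euc_facet_bound by blast

end
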